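(* Let $F$ be a field of characteristic $0$, $d\ge1$, and let $\lambda\vdash k$ be a partition. The tensor polynomial $ST(\lambda)(x_1,\dots,x_k)$ is NOT a tensor polynomial identity of $d\times d$ matrices $M_d(F)$ if and only if $k\le d^2$ and $\lambda\oplus1^{d^2-k}$ is a refinement of the partition $\delta_d:=(2d-1,2d-3,\dots,5,3,1)\vdash d^2$.
   Context: $F\langle X\rangle$ is the free associative algebra in $x_1,x_2,\dots$; elements of $F\langle X\rangle^{\otimes n}$ are tensor polynomials, and such an element is a tensor polynomial identity (TPI) of $M_d(F)$ if it vanishes in $M_d(F)^{\otimes n}$ under every evaluation $x_i\mapsto A_i\in M_d(F)$ (extended to an algebra homomorphism $F\langle X\rangle^{\otimes n}\to M_d(F)^{\otimes n}$). For a partition $\lambda=(\lambda_1,\dots,\lambda_n)\vdash k$ with $n$ parts, set $X_j:=x_{\lambda_1+\dots+\lambda_{j-1}+1}\cdots x_{\lambda_1+\dots+\lambda_j}$ and $ST(\lambda):=\sum_{\sigma\in S_k}\epsilon_\sigma (X_1\otimes\cdots\otimes X_n)(x_{\sigma(1)},\dots,x_{\sigma(k)})\in F\langle X\rangle^{\otimes n}$, i.e. the alternation of $X_1\otimes\cdots\otimes X_n$ over the variables $x_1,\dots,x_k$. For partitions $\lambda,\mu$, $\lambda\oplus\mu$ is the partition whose parts are those of $\lambda$ together with those of $\mu$, arranged non-increasingly; $1^r$ is the partition with $r$ parts equal to $1$ (empty if $r=0$). For a partition $\mu=(\mu_1,\dots,\mu_n)$ with $n$ parts and $\sigma\in S_n$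 with cycle decomposition $\sigma=c_1\cdots c_l$ (including fixed points as $1$-cycles), $\sigma(\mu)$ is the partition $(\sum_{i\in c_1}\mu_i,\dots,\sum_{i\in c_l}\mu_i)$ arranged non-increasingly. $\mu$ is a refinement of $\lambda$ if $\sigma(\mu)=\lambda$ for some $\sigma\in S_n$. *)

theory Defs
  imports "Jordan_Normal_Form.Matrix" "HOL-Combinatorics.Permutations" "HOL-Library.Multiset"
begin

definition is_partition :: "nat list \<Rightarrow> nat \<Rightarrow> bool" where
  "is_partition lam k \<longleftrightarrow> sorted_wrt (\<ge>) lam \<and> (\<forall>x\<in>set lam. 0 < x) \<and> sum_list lam = k"

definition psum :: "nat list \<Rightarrow> nat list \<Rightarrow> nat list" where
  "psum lam mu = rev (sort (lam @ mu))"

definition delta :: "nat \<Rightarrow> nat list" where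
  "delta d = map (\<lambda>i. 2 * (d - i) - 1) [0..<d]"

definition cyc :: "(nat \<Rightarrow> nat) \<Rightarrow> nat \<Rightarrow> nat set" where
  "cyc \<sigma> i = {(\<sigma> ^^ m) i | m. True}"

definition cycles_of :: "(nat \<Rightarrow> nat) \<Rightarrow> nat \<Rightarrow> nat set set" where
  "cycles_of \<sigma> n = cyc \<sigma> ` {..<n}"

definition perm_part :: "(nat \<Rightarrow> nat) \<Rightarrow> nat list \<Rightarrow> nat list" where
  "perm_part \<sigma> mu = rev (sorted_list_of_multiset
      (image_mset (\<lambda>C. \<Sum>i\<in>C. mu ! i) (mset_set (cycles_of \<sigma> (length mu)))))"

definition is_refinement :: "nat list \<Rightarrow> nat list \<Rightarrow> bool" where
  "is_refinement mu lam \<longleftrightarrow> (\<exists>\<sigma>. \<sigma> permutes {..<length mu} \<and> perm_part \<sigma> mu = lam)"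

text \<open>An element of F<X>^{\<otimes>n} is written in the basis of tensors of monomials
  w_1 \<otimes> ... \<otimes> w_n (each w_j a word in the variables x_0, x_1, ..., i.e. a nat list):
  a finitely supported coefficient function on length-n lists of words.\<close>
definition tensor_poly :: "nat \<Rightarrow> (nat list list \<Rightarrow> 'a::zero) \<Rightarrow> bool" where
  "tensor_poly n c \<longleftrightarrow> finite {ws. c ws \<noteq> 0} \<and> (\<forall>ws. c ws \<noteq> 0 \<longrightarrow> length ws = n)"

definition mat_word :: "nat \<Rightarrow> (nat \<Rightarrow> 'a::comm_ring_1 mat) \<Rightarrow> nat list \<Rightarrow> 'a mat" where
  "mat_word d A w = foldr (\<lambda>i M. A i * M) w (1\<^sub>m d)"

text \<open>Coordinates of the evaluation in M_d(F)^{\<otimes>n} with respect to the basis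
  E_{i_1 l_1} \<otimes> ... \<otimes> E_{i_n l_n} of matrix units.\<close>
definition tensor_eval_coord ::
  "nat \<Rightarrow> nat \<Rightarrow> (nat list list \<Rightarrow> 'a::comm_ring_1) \<Rightarrow> (nat \<Rightarrow> 'a mat) \<Rightarrow> nat list \<Rightarrow> nat list \<Rightarrow> 'a" where
  "tensor_eval_coord d n c A is ls =
     (\<Sum>ws\<in>{ws. c ws \<noteq> 0}. c ws * (\<Prod>j<n. mat_word d A (ws ! j) $$ (is ! j, ls ! j)))"

definition is_TPI :: "nat \<Rightarrow> nat \<Rightarrow> (nat list list \<Rightarrow> 'a::comm_ring_1) \<Rightarrow> bool" where
  "is_TPI d n c \<longleftrightarrow>
     (\<forall>A. (\<forall>i. A i \<in> carrier_mat d d) \<longrightarrow>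
        (\<forall>is ls. length is = n \<longrightarrow> length ls = n \<longrightarrow> (\<forall>j<n. is ! j < d \<and> ls ! j < d) \<longrightarrow>
           tensor_eval_coord d n c A is ls = 0))"

definition blocks :: "nat list \<Rightarrow> nat list list" where
  "blocks lam = map (\<lambda>j. [sum_list (take j lam) ..< sum_list (take (Suc j) lam)]) [0..<length lam]"

text \<open>ST(lam) = \<Sum>_{\<sigma> \<in> S_k} sign \<sigma> (X_1 \<otimes> ... \<otimes> X_n)(x_{\<sigma> 0}, ..., x_{\<sigma>(k-1)}),
  as a coefficient function: the coefficient of w_1 \<otimes> ... \<otimes> w_n is the sum of the signs
  of those \<sigma> whose substituted monomial tensor equals it.\<close>
definition ST :: "nat list \<Rightarrow> nat list list \<Rightarrow> 'a::comm_ring_1" where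
  "ST lam ws = (\<Sum>\<sigma>\<in>{\<sigma>. \<sigma> permutes {..<sum_list lam} \<and> ws = map (map \<sigma>) (blocks lam)}.
                  of_int (sign \<sigma>))"

end

theory Submission
  imports Defs "HOL-Combinatorics.Cycles"
begin

text \<open>
  Evaluated at distinct matrix units, the coordinates of \<open>ST(\<lambda>)\<close> are signed counts of systems of
  paths in the complete digraph with loops on \<open>d\<close> vertices, of lengths \<open>\<lambda>\<^sub>1, \<dots>, \<lambda>\<^sub>n\<close>, that use each
  chosen edge once. Appending parts \<open>1\<close> to \<open>\<lambda>\<close> records the unused edges, so one may take
  \<open>k = d\<^sup>2\<close>. The resulting integer matrix \<open>J\<close> on \<open>V\<^sup>\<otimes>\<^sup>n\<close> commutes with \<open>gl(V)\<close>, because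
  \<open>ad x\<close> has trace \<open>0\<close>, hence with all symmetrised tensors. An averaging argument over \<open>S\<^sub>n\<close>, which uses
  that \<open>J\<close> is real, then shows that \<open>J \<noteq> 0\<close> iff \<open>tr (\<sigma> J) \<noteq> 0\<close> for some \<open>\<sigma> \<in> S\<^sub>n\<close>.

  The number \<open>tr (\<sigma> J)\<close> is an alternated product of traces of monomials, whose lengths are the
  parts of \<open>\<sigma>(\<lambda>)\<close>. It vanishes if two lengths agree or one of them is even (an odd permutation
  preserves the monomials up to rotation), or if one is at least \<open>2d\<close> (Amitsur--Levitzki).
  So \<open>\<sigma>(\<lambda>)\<close> consists of distinct odd numbers below \<open>2d\<close> with sum \<open>d\<^sup>2\<close>, that is, \<open>\<sigma>(\<lambda>) = \<delta>\<^sub>d\<close>.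
  That the product for \<open>\<delta>\<^sub>d\<close> is nonzero comes for free: \<open>J\<close> is visibly nonzero
  for \<open>\<lambda> = (1, \<dots>, 1)\<close>, hence some product of traces is nonzero, and \<open>\<delta>\<^sub>d\<close> is the only candidate.
\<close>

subsection \<open>Invariant matrices on tensor powers\<close>

text \<open>An alternated product of traces of total degree d^2 is an invariant top form on M_d(F).
  Classically the invariants of the exterior algebra are generated by the forms tr St_1, tr St_3,
  ..., tr St_(2d-1), and the product of all of them has top degree; this is where
  \<open>delta d\<close> comes from. The obstacle is to pass from a nonzero entry of J to a nonzero
  trace. Schur-Weyl duality would place J in the span of S_n. The averaging takes the place of the
  double commutant theorem: it uses that J commutes with symmetrised elementary tensors, and that a
  sum of integer squares vanishes only if every square does. So the invariant theory is carried out
  over the integers, and the field enters through \<open>of_int\<close> in the final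
  evaluation.\<close>

text \<open>The standard volume form at the basis vectors with indices h 0, ..., h (m - 1).
  \<open>restrict_id\<close> is there because \<open>sign\<close> reads a function on all naturals,
  whereas \<open>h\<close> carries no meaning from \<open>m\<close> on.\<close>

definition map_sign :: "nat \<Rightarrow> (nat \<Rightarrow> nat) \<Rightarrow> int" where
  "map_sign m h = (if bij_betw h {..<m} {..<m} then sign (restrict_id h {..<m}) else 0)"

lemma map_sign_cong:
  assumes "\<And>t. t < m \<Longrightarrow> h t = h' t"
  shows "map_sign m h = map_sign m h'"
proof -
  have "bij_betw h {..<m} {..<m} = bij_betw h' {..<m} {..<m}"
    using assms by (intro bij_betw_cong) auto
  moreover have "restrict_id h {..<m} = restrict_id h' {..<m}"
    using assms by (auto simp: restrict_id_def)
  ultimately show ?thesis unfolding map_sign_def by simp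
qed

lemma map_sign_permutes:
  assumes "p permutes {..<m}"
  shows "map_sign m p = sign p"
proof -
  have "restrict_id p {..<m} = p"
    using permutes_not_in[OF assms] by (auto simp: restrict_id_def)
  then show ?thesis
    using permutes_imp_bij[OF assms] by (simp add: map_sign_def)
qed

lemma map_sign_comp:
  assumes p: "p permutes {..<m}"
  shows "map_sign m (h \<circ> p) = map_sign m h * sign p"
proof (cases "bij_betw h {..<m} {..<m}")
  case True
  have "restrict_id (h \<circ> p) {..<m} = restrict_id h {..<m} \<circ> p"
    using permutes_in_image[OF p] permutes_not_in[OF p] by (auto simp: restrict_id_def fun_eq_iff)
  moreover have "bij_betw (h \<circ> p) {..<m} {..<m}"
    using bij_betw_trans[OF permutes_imp_bij[OF p] True] .
  moreover have "permutation (restrict_id h {..<m})" "permutation p"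
    using True p by (auto intro!: permutes_imp_permutation[of "{..<m}"] permutes_restrict_id)
  ultimately show ?thesis using True by (simp add: map_sign_def sign_compose)
next
  case False
  then have "\<not> bij_betw (h \<circ> p) {..<m} {..<m}"
    using bij_betw_comp_iff[OF permutes_imp_bij[OF p]] by blast
  with False show ?thesis by (simp add: map_sign_def)
qed

lemma map_sign_not_inj:
  assumes "s < m" "t < m" "s \<noteq> t" "h s = h t"
  shows "map_sign m h = 0"
  using assms unfolding map_sign_def bij_betw_def inj_on_def by auto

text \<open>If one summand is nonzero, its modified map is a bijection hitting the old value \<open>h t\<close> once
  more, at \<open>t'\<close> say; then \<open>t\<close> and \<open>t'\<close> give the only nonzero summands, and they differ by a swap.\<close>
lemma sum_map_sign_update:
  assumes "\<And>t. t < m \<Longrightarrow> h t < m" and "\<And>e. P e \<Longrightarrow> f e \<noteq> e"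
  shows "(\<Sum>t | t < m \<and> P (h t). map_sign m (h(t := f (h t)))) = 0"
proof (cases "\<exists>t. t < m \<and> P (h t) \<and> map_sign m (h(t := f (h t))) \<noteq> 0")
  case False
  then show ?thesis by (intro sum.neutral) auto
next
  case True
  then obtain t where t: "t < m" "P (h t)" "map_sign m (h(t := f (h t))) \<noteq> 0" by blast
  then have bij: "bij_betw (h(t := f (h t))) {..<m} {..<m}"
    by (auto simp: map_sign_def split: if_splits)
  then obtain t' where t': "t' < m" "(h(t := f (h t))) t' = h t"
    using assms(1)[OF t(1)] unfolding bij_betw_def by (metis imageE lessThan_iff)
  with assms(2)[OF t(2)] have ne: "t' \<noteq> t" by auto
  with t'(2) have eq: "h t' = h t" by simp
  \<comment> \<open>Away from \<open>t\<close> and \<open>t'\<close> the collision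
    \<open>h t = h t'\<close> survives the update.\<close>
  have other: "map_sign m (h(s := f (h s))) = 0" if "s \<noteq> t" "s \<noteq> t'" for s
    using map_sign_not_inj[OF t(1) t'(1) ne[symmetric]] that eq by auto
  have "(\<Sum>s | s < m \<and> P (h s). map_sign m (h(s := f (h s)))) =
        (\<Sum>s\<in>{t, t'}. map_sign m (h(s := f (h s))))"
    using t t'(1) eq other by (intro sum.mono_neutral_right) auto
  also have "h(t' := f (h t')) = h(t := f (h t)) \<circ> transpose t t'"
    using ne eq by (auto simp: fun_eq_iff transpose_def)
  then have "map_sign m (h(t' := f (h t'))) = - map_sign m (h(t := f (h t)))"
    using map_sign_comp[of "transpose t t'" m "h(t := f (h t))"] t(1) t'(1) ne
    by (simp add: permutes_swap_id sign_swap_id)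
  then have "(\<Sum>s\<in>{t, t'}. map_sign m (h(s := f (h s)))) = 0"
    using ne by simp
  finally show ?thesis .
qed

text \<open>The pair \<open>(i, j)\<close> with \<open>i, j < d\<close> (a matrix unit, or an edge of the complete digraph with
  loops) is coded as \<open>i * d + j < d * d\<close>.\<close>

lemma code_less: "i < d \<Longrightarrow> j < d \<Longrightarrow> i * d + j < d * (d::nat)"
proof -
  assume "i < d" "j < d"
  then have "i * d + j < Suc i * d" by simp
  also have "\<dots> \<le> d * d" using \<open>i < d\<close> by (intro mult_right_mono) auto
  finally show ?thesis .
qed

text \<open>Every vertex has out-degree \<open>d\<close> and, by the next count, in-degree
  \<open>d\<close>: left and right multiplication by \<open>E_pp\<close> on M_d have the same
  trace.\<close>

lemma card_div_eq: "p < d \<Longrightarrow> card {e. e < d * d \<and> e div d = p} = (d::nat)"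
proof -
  assume p: "p < d"
  have "{e. e < d * d \<and> e div d = p} = (\<lambda>j. p * d + j) ` {..<d}"
  proof (intro equalityI subsetI)
    fix e assume "e \<in> {e. e < d * d \<and> e div d = p}"
    then have "e = p * d + e mod d" "e mod d < d" using p by auto
    then show "e \<in> (\<lambda>j. p * d + j) ` {..<d}" by blast
  qed (use p code_less in auto)
  then show ?thesis by (simp add: card_image)
qed

lemma card_mod_eq: "q < d \<Longrightarrow> card {e. e < d * d \<and> e mod d = q} = (d::nat)"
proof -
  assume q: "q < d"
  have "{e. e < d * d \<and> e mod d = q} = (\<lambda>i. i * d + q) ` {..<d}"
  proof (intro equalityI subsetI)
    fix e assume "e \<in> {e. e < d * d \<and> e mod d = q}"
    then have "e = (e div d) * d + q" "e div d < d" by (auto simp: less_mult_imp_div_less)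
    then show "e \<in> (\<lambda>i. i * d + q) ` {..<d}" by blast
  qed (use q code_less in auto)
  moreover have "inj_on (\<lambda>i. i * d + q) {..<d}" using q by (auto simp: inj_on_def)
  ultimately show ?thesis by (simp add: card_image)
qed

lemma card_map_sign_fibre:
  assumes "map_sign m h \<noteq> 0"
  shows "card {t. t < m \<and> P (h t)} = card {e. e < m \<and> P e}"
proof -
  have b: "bij_betw h {..<m} {..<m}" using assms by (auto simp: map_sign_def split: if_splits)
  have "bij_betw h {t. t < m \<and> P (h t)} {e. e < m \<and> P e}"
    using b unfolding bij_betw_def inj_on_def by (auto simp: set_eq_iff image_iff) (metis lessThan_iff)+
  then show ?thesis by (rule bij_betw_same_card)
qed

text \<open>A matrix indexed by \<open>S \<rightarrow> {..<d}\<close> commutes with the derivations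
  \<open>\<Sum>t\<in>S. 1 \<otimes> \<dots> \<otimes> E\<^sub>p\<^sub>q \<otimes> \<dots> \<otimes> 1\<close>; both sides are the entry \<open>(a, b)\<close> of a product.\<close>
definition gl_invariant :: "nat \<Rightarrow> nat set \<Rightarrow> ((nat \<Rightarrow> nat) \<Rightarrow> (nat \<Rightarrow> nat) \<Rightarrow> int) \<Rightarrow> bool" where
  "gl_invariant d S J \<longleftrightarrow> (\<forall>p<d. \<forall>q<d. \<forall>a\<in>S \<rightarrow>\<^sub>E {..<d}. \<forall>b\<in>S \<rightarrow>\<^sub>E {..<d}.
     (\<Sum>t | t \<in> S \<and> a t = p. J (a(t := q)) b) = (\<Sum>t | t \<in> S \<and> b t = q. J a (b(t := p))))"

text \<open>The entry is the volume form of M_d at the matrix units with tail \<open>u t\<close> and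
  head \<open>w (\<kappa> t)\<close>. Changing a tail is left multiplication by a matrix unit,
  changing a head is right multiplication, and a derivation scales a volume form by its trace. Both
  traces are \<open>d\<close> for \<open>p = q\<close> and 0 otherwise.\<close>

lemma gl_invariant_edges:
  assumes \<kappa>: "\<kappa> permutes {..<d*d}"
  shows "gl_invariant d {..<d*d} (\<lambda>u w. map_sign (d*d) (\<lambda>t. u t * d + w (\<kappa> t)))"
  unfolding gl_invariant_def
proof (intro allI impI ballI)
  fix p q u w
  assume p: "p < d" and q: "q < d"
    and u: "u \<in> {..<d*d} \<rightarrow>\<^sub>E {..<d}" and w: "w \<in> {..<d*d} \<rightarrow>\<^sub>E {..<d}"
  define m where "m = d * d"
  define h where "h = (\<lambda>t. u t * d + w (\<kappa> t))"
  have kap: "\<kappa> t < m \<longleftrightarrow> t < m" for t using permutes_in_image[OF \<kappa>, of t] by (simp add: m_def)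
  have ud: "u t < d" and wd: "w (\<kappa> t) < d" if "t < m" for t
    using that u w kap unfolding m_def by auto
  have hdiv: "h t div d = u t" and hmod: "h t mod d = w (\<kappa> t)" if "t < m" for t
    using wd[OF that] by (auto simp: h_def)
  have hm: "h t < m" if "t < m" for t using ud wd that code_less by (auto simp: h_def m_def)
  have L: "(\<Sum>t | t \<in> {..<d*d} \<and> u t = p. map_sign (d*d) (\<lambda>s. (u(t := q)) s * d + w (\<kappa> s))) =
        (\<Sum>t | t < m \<and> h t div d = p. map_sign m (h(t := q * d + h t mod d)))"
  proof (rule sum.cong)
    show "{t \<in> {..<d * d}. u t = p} = {t. t < m \<and> h t div d = p}"
      by (auto simp: m_def[symmetric] hdiv)
    show "map_sign (d*d) (\<lambda>s. (u(t := q)) s * d + w (\<kappa> s)) = map_sign m (h(t := q * d + h t mod d))"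
      if "t \<in> {t. t < m \<and> h t div d = p}" for t
      using that unfolding m_def[symmetric] by (intro map_sign_cong) (auto simp: hmod, auto simp: h_def)
  qed
  \<comment> \<open>The head of the edge at \<open>t\<close> is stored at position
    \<open>\<kappa> t\<close>; reindexing by \<open>\<kappa>\<close> turns positions of
    \<open>w\<close> into edges.\<close>
  have R: "(\<Sum>t | t \<in> {..<d*d} \<and> w t = q. map_sign (d*d) (\<lambda>s. u s * d + (w(t := p)) (\<kappa> s))) =
        (\<Sum>t | t < m \<and> h t mod d = q. map_sign m (h(t := (h t div d) * d + p)))"
  proof (rule sum.reindex_bij_witness[where i = \<kappa> and j = "inv_into UNIV \<kappa>"])
    fix t assume t: "t \<in> {t \<in> {..<d * d}. w t = q}"
    show "\<kappa> (inv_into UNIV \<kappa> t) = t" using permutes_inverses[OF \<kappa>] by simp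
    have it: "inv_into UNIV \<kappa> t < m" using t kap[of "inv_into UNIV \<kappa> t"] permutes_inverses[OF \<kappa>] by (simp add: m_def)
    then show "inv_into UNIV \<kappa> t \<in> {t. t < m \<and> h t mod d = q}"
      using t hmod[OF it] permutes_inverses[OF \<kappa>] by simp
    show "map_sign m (h(inv_into UNIV \<kappa> t := h (inv_into UNIV \<kappa> t) div d * d + p)) =
          map_sign (d*d) (\<lambda>s. u s * d + (w(t := p)) (\<kappa> s))"
      unfolding m_def[symmetric] using permutes_inverses[OF \<kappa>] hdiv[OF it]
      by (intro map_sign_cong) (auto simp: h_def)
  next
    fix t assume t: "t \<in> {t. t < m \<and> h t mod d = q}"
    show "inv_into UNIV \<kappa> (\<kappa> t) = t" using permutes_inverses[OF \<kappa>] by simp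
    show "\<kappa> t \<in> {t \<in> {..<d * d}. w t = q}" using t kap hmod by (auto simp: m_def)
  qed
  have "(\<Sum>t | t < m \<and> h t div d = p. map_sign m (h(t := q * d + h t mod d))) =
        (\<Sum>t | t < m \<and> h t mod d = q. map_sign m (h(t := (h t div d) * d + p)))"
  proof (cases "p = q")
    case True
    have "(\<Sum>t | t < m \<and> h t div d = p. map_sign m (h(t := q * d + h t mod d))) =
          (\<Sum>t | t < m \<and> h t div d = p. map_sign m h)"
      using True by (intro sum.cong refl arg_cong[where f = "map_sign m"]) (auto simp: fun_eq_iff)
    moreover have "(\<Sum>t | t < m \<and> h t mod d = q. map_sign m (h(t := (h t div d) * d + p))) =
          (\<Sum>t | t < m \<and> h t mod d = q. map_sign m h)"
      using True by (intro sum.cong refl arg_cong[where f = "map_sign m"]) (auto simp: fun_eq_iff)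
    moreover have "card {t. t < m \<and> h t div d = p} = card {t. t < m \<and> h t mod d = q}"
      if "map_sign m h \<noteq> 0"
      using card_map_sign_fibre[OF that, of "\<lambda>e. e div d = p"]
        card_map_sign_fibre[OF that, of "\<lambda>e. e mod d = q"] card_div_eq[OF p] card_mod_eq[OF q]
      by (simp add: m_def)
    ultimately show ?thesis by (cases "map_sign m h = 0") auto
  next
    case False
    have "(\<Sum>t | t < m \<and> h t div d = p. map_sign m (h(t := q * d + h t mod d))) = 0"
    proof (rule sum_map_sign_update[OF hm, where P = "\<lambda>e. e div d = p" and f = "\<lambda>e. q * d + e mod d"])
      show "q * d + e mod d \<noteq> e" if "e div d = p" for e
      proof
        assume "q * d + e mod d = e"
        then have "(q * d + e mod d) div d = p" using that by simp
        then show False using False p by simp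
      qed
    qed
    moreover have "(\<Sum>t | t < m \<and> h t mod d = q. map_sign m (h(t := (h t div d) * d + p))) = 0"
    proof (rule sum_map_sign_update[OF hm, where P = "\<lambda>e. e mod d = q" and f = "\<lambda>e. (e div d) * d + p"])
      show "(e div d) * d + p \<noteq> e" if "e mod d = q" for e
      proof
        assume "(e div d) * d + p = e"
        then have "((e div d) * d + p) mod d = q" using that by simp
        then show False using False p by simp
      qed
    qed
    ultimately show ?thesis by simp
  qed
  then show "(\<Sum>t | t \<in> {..<d*d} \<and> u t = p. map_sign (d*d) (\<lambda>s. (u(t := q)) s * d + w (\<kappa> s))) =
     (\<Sum>t | t \<in> {..<d*d} \<and> w t = q. map_sign (d*d) (\<lambda>s. u s * d + (w(t := p)) (\<kappa> s)))"
    unfolding L R .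
qed

section \<open>Partial traces of invariant matrices\<close>

definition merge :: "nat set \<Rightarrow> (nat \<Rightarrow> nat) \<Rightarrow> (nat \<Rightarrow> nat) \<Rightarrow> nat \<Rightarrow> nat" where
  "merge S a c = (\<lambda>t. if t \<in> S then a t else c t)"

lemma merge_in_PiE:
  assumes "a \<in> A \<rightarrow>\<^sub>E D" "c \<in> B \<rightarrow>\<^sub>E D"
  shows "merge A a c \<in> (A \<union> B) \<rightarrow>\<^sub>E D"
  using assms by (auto simp: merge_def PiE_iff extensional_def)

lemma sum_PiE_Un:
  assumes "A \<inter> B = {}"
  shows "(\<Sum>u\<in>(A \<union> B) \<rightarrow>\<^sub>E D. h u) = (\<Sum>a\<in>A \<rightarrow>\<^sub>E D. \<Sum>c\<in>B \<rightarrow>\<^sub>E D. h (merge A a c))"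
  unfolding sum.cartesian_product
proof (rule sum.reindex_bij_witness[where i = "\<lambda>(a, c). merge A a c" and j = "\<lambda>u. (restrict u A, restrict u B)"], goal_cases)
  case (1 u)
  then show ?case by (auto simp: merge_def PiE_iff extensional_def fun_eq_iff)
next
  case (5 u)
  then have "merge A (restrict u A) (restrict u B) = u"
    by (auto simp: merge_def PiE_iff extensional_def fun_eq_iff)
  then show ?case by simp
qed (use assms in \<open>auto simp: merge_def PiE_iff extensional_def fun_eq_iff\<close>)

text \<open>Let the derivation act on all of \<open>A\<close> and sum over the traced-out indices:
  by cyclicity of the trace, the terms acting on a factor outside \<open>S\<close> agree on both
  sides and cancel.\<close>

lemma gl_invariant_partial_trace:
  assumes fin: "finite A" and sub: "S \<subseteq> A" and inv: "gl_invariant d A K"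
  shows "gl_invariant d S (\<lambda>a b. \<Sum>c\<in>(A - S) \<rightarrow>\<^sub>E {..<d}. K (merge S a c) (merge S b c))"
  unfolding gl_invariant_def
proof (intro allI impI ballI)
  fix p q a b
  assume p: "p < d" and q: "q < d" and a: "a \<in> S \<rightarrow>\<^sub>E {..<d}" and b: "b \<in> S \<rightarrow>\<^sub>E {..<d}"
  let ?C = "(A - S) \<rightarrow>\<^sub>E {..<d}"
  have finS: "finite S" and finC: "finite ?C" using fin sub finite_subset by (auto intro: finite_PiE)
  have W: "merge S x c \<in> A \<rightarrow>\<^sub>E {..<d}" if "x \<in> S \<rightarrow>\<^sub>E {..<d}" "c \<in> ?C" for x c
    using merge_in_PiE[OF that] sub by (simp add: Un_absorb1)
  have split: "(\<Sum>t | t \<in> A \<and> merge S x c t = r. F t) =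
      (\<Sum>t | t \<in> S \<and> x t = r. F t) + (\<Sum>t | t \<in> A - S \<and> c t = r. F t)" for x c r and F :: "nat \<Rightarrow> int"
  proof -
    have "{t. t \<in> A \<and> merge S x c t = r} = {t. t \<in> S \<and> x t = r} \<union> {t. t \<in> A - S \<and> c t = r}"
      using sub by (auto simp: merge_def)
    then show ?thesis using fin finS by (simp add: sum.union_disjoint disjoint_iff)
  qed
  have upd: "merge S (x(t := r)) c = (merge S x c)(t := r)" if "t \<in> S" for x c t r
    using that by (auto simp: merge_def)
  \<comment> \<open>Renaming \<open>c\<close> to \<open>c(t := q)\<close> matches the summands: the
    row index is then unmodified, and the column index has \<open>p\<close> restored at
    \<open>t\<close>.\<close>
  have internal: "(\<Sum>c\<in>?C. \<Sum>t | t \<in> A - S \<and> c t = p. K ((merge S a c)(t := q)) (merge S b c)) =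
      (\<Sum>c\<in>?C. \<Sum>t | t \<in> A - S \<and> c t = q. K (merge S a c) ((merge S b c)(t := p)))"
  proof -
    have "(\<Sum>(c, t)\<in>(SIGMA c:?C. {t. t \<in> A - S \<and> c t = p}). K ((merge S a c)(t := q)) (merge S b c)) =
       (\<Sum>(c, t)\<in>(SIGMA c:?C. {t. t \<in> A - S \<and> c t = q}). K (merge S a c) ((merge S b c)(t := p)))"
    proof (rule sum.reindex_bij_witness[where i = "\<lambda>(c, t). (c(t := p), t)" and j = "\<lambda>(c, t). (c(t := q), t)"], goal_cases)
      case (5 x)
      obtain c t where x: "x = (c, t)" by force
      have "(merge S a c)(t := q) = merge S a (c(t := q))" "merge S b c = (merge S b (c(t := q)))(t := p)"
        using 5 x by (auto simp: merge_def)
      with 5 x show ?case by simp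
    qed (use p q in \<open>auto simp: PiE_iff extensional_def split: if_splits\<close>)
    then show ?thesis using fin finC by (simp add: sum.Sigma)
  qed
  have "(\<Sum>c\<in>?C. \<Sum>t | t \<in> A \<and> merge S a c t = p. K ((merge S a c)(t := q)) (merge S b c)) =
        (\<Sum>c\<in>?C. \<Sum>t | t \<in> A \<and> merge S b c t = q. K (merge S a c) ((merge S b c)(t := p)))"
    by (intro sum.cong[OF refl] inv[unfolded gl_invariant_def, rule_format] W a b p q)
  then have "(\<Sum>c\<in>?C. \<Sum>t | t \<in> S \<and> a t = p. K ((merge S a c)(t := q)) (merge S b c)) =
        (\<Sum>c\<in>?C. \<Sum>t | t \<in> S \<and> b t = q. K (merge S a c) ((merge S b c)(t := p)))"
    unfolding split sum.distrib using internal by simp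
  then show "(\<Sum>t | t \<in> S \<and> a t = p. \<Sum>c\<in>?C. K (merge S (a(t := q)) c) (merge S b c)) =
        (\<Sum>t | t \<in> S \<and> b t = q. \<Sum>c\<in>?C. K (merge S a c) (merge S (b(t := p)) c))"
    by (subst (1 2) sum.swap) (simp add: upd)
qed

section \<open>Commutation with symmetrised elementary tensors\<close>

definition injections :: "nat set \<Rightarrow> nat set \<Rightarrow> (nat \<Rightarrow> nat) set" where
  "injections R S = {f \<in> R \<rightarrow>\<^sub>E S. inj_on f R}"

text \<open>The index reached from \<open>a\<close> by an elementary tensor whose factor
  \<open>f r\<close> is a matrix unit with row \<open>b r\<close>. It is meant for \<open>f\<close>
  injective on \<open>R\<close>, so that \<open>inv_into\<close> recovers \<open>r\<close>.\<close>

definition overwrite :: "nat set \<Rightarrow> (nat \<Rightarrow> nat) \<Rightarrow> (nat \<Rightarrow> nat) \<Rightarrow> (nat \<Rightarrow> nat) \<Rightarrow> nat \<Rightarrow> nat" where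
  "overwrite R f b a = (\<lambda>s. if s \<in> f ` R then b (inv_into R f s) else a s)"

lemma finite_injections: "finite R \<Longrightarrow> finite S \<Longrightarrow> finite (injections R S)"
  unfolding injections_def by (intro finite_subset[OF _ finite_PiE[of R "\<lambda>_. S"]]) auto

lemma overwrite_apply: "inj_on f R \<Longrightarrow> r \<in> R \<Longrightarrow> overwrite R f b a (f r) = b r"
  by (simp add: overwrite_def)

lemma overwrite_outside: "s \<notin> f ` R \<Longrightarrow> overwrite R f b a s = a s"
  by (simp add: overwrite_def)

lemma overwrite_eqI:
  assumes "inj_on f R" "\<And>r. r \<in> R \<Longrightarrow> u (f r) = b r" "\<And>s. s \<notin> f ` R \<Longrightarrow> u s = a s"
  shows "overwrite R f b a = u"
  using assms by (auto simp: fun_eq_iff overwrite_def)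

lemma overwrite_in_PiE:
  assumes "f \<in> injections R S" "\<And>r. r \<in> R \<Longrightarrow> b r \<in> D" "a \<in> S \<rightarrow>\<^sub>E D"
  shows "overwrite R f b a \<in> S \<rightarrow>\<^sub>E D"
proof -
  have "f r \<in> S" if "r \<in> R" for r using assms(1) that by (auto simp: injections_def)
  moreover have "b (inv_into R f s) \<in> D" if "s \<in> f ` R" for s
    using assms(2) inv_into_into[OF that] .
  ultimately show ?thesis using assms(3) unfolding overwrite_def PiE_iff extensional_def by auto
qed

lemma sum_injections_insert:
  assumes "r \<notin> R" "finite R" "finite S"
  shows "(\<Sum>f\<in>injections (insert r R) S. F f) = (\<Sum>g\<in>injections R S. \<Sum>s\<in>S - g ` R. F (g(r := s)))"
proof -
  have "(\<Sum>f\<in>injections (insert r R) S. F f) =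
     (\<Sum>(g, s)\<in>(SIGMA g:injections R S. S - g ` R). F (g(r := s)))"
  proof (rule sum.reindex_bij_witness[where i = "\<lambda>(g, s). g(r := s)" and j = "\<lambda>f. (restrict f R, f r)"], goal_cases)
    case (1 f)
    then show ?case using assms(1) by (auto simp: injections_def PiE_iff extensional_def fun_eq_iff)
  next
    case (2 f)
    have "inj_on (restrict f R) R" using 2 by (auto simp: injections_def inj_on_def)
    then show ?case using 2 assms(1) by (auto simp: injections_def inj_on_def)
  next
    case (3 x)
    then show ?case using assms(1) by (auto simp: injections_def PiE_iff extensional_def fun_eq_iff)
  next
    case (4 x)
    obtain g s where x: "x = (g, s)" by force
    have "inj_on (g(r := s)) (insert r R)" using 4 x assms(1) by (auto simp: injections_def inj_on_def)
    then show ?case using 4 x assms(1) by (auto simp: injections_def PiE_iff extensional_def)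
  next
    case (5 f)
    have "(restrict f R)(r := f r) = f"
      using 5 assms(1) by (auto simp: injections_def PiE_iff extensional_def fun_eq_iff)
    then show ?case by simp
  qed
  then show ?thesis using assms(2,3) by (simp add: sum.Sigma finite_injections)
qed

lemma sum_split_injection:
  assumes "g \<in> injections R S" "finite R" "finite S"
  shows "(\<Sum>s\<in>S. F s) = (\<Sum>s\<in>S - g ` R. F s) + (\<Sum>i\<in>R. (F (g i) :: int))"
proof -
  have "g ` R \<subseteq> S" "inj_on g R" using assms(1) by (auto simp: injections_def)
  then show ?thesis using assms(2,3) sum.subset_diff[of "g ` R" S F] by (simp add: sum.reindex)
qed

lemma sum_if_swap:
  "(\<Sum>s\<in>S. if P s then \<Sum>g\<in>A. H g s else 0) = (\<Sum>g\<in>A. \<Sum>s\<in>S. if P s then H g s else (0 :: int))"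
  by (subst sum.swap) (intro sum.cong refl, simp)

text \<open>\<open>J\<close> commutes with the sum, over all injections \<open>f\<close> of \<open>R\<close> into \<open>S\<close>, of the operators having the
  matrix unit \<open>E\<^bsub>b r, e r\<^esub>\<close> in the tensor factor \<open>f r\<close> and the identity in the remaining factors. The
  induction multiplies such a sum by a derivation, which adds one more matrix unit up to terms
  in which two matrix units met in the same factor.\<close>
lemma gl_invariant_injections:
  assumes fin: "finite S" "finite R" and inv: "gl_invariant d S J"
    and "\<forall>r\<in>R. b r < d" "\<forall>r\<in>R. e r < d" "a \<in> S \<rightarrow>\<^sub>E {..<d}" "a' \<in> S \<rightarrow>\<^sub>E {..<d}"
  shows "(\<Sum>f\<in>injections R S. if \<forall>r\<in>R. a' (f r) = e r then J a (overwrite R f b a') else 0) =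
    (\<Sum>f\<in>injections R S. if \<forall>r\<in>R. a (f r) = b r then J (overwrite R f e a) a' else 0)"
  using fin(2) assms(4-)
proof (induction R arbitrary: b e a rule: finite_induct)
  case empty
  have "injections {} S = {\<lambda>x. undefined}" by (auto simp: injections_def)
  then show ?case by (simp add: overwrite_def)
next
  case (insert r R b e a)
  \<comment> \<open>\<open>E_pq\<close> is the matrix unit contributed by the new index
    \<open>r\<close>; its derivation inserts it into every factor in turn.\<close>
  define p q where "p = b r" and "q = e r"
  have pq: "p < d" "q < d" using insert.prems by (auto simp: p_def q_def)
  note inv' = inv[unfolded gl_invariant_def, rule_format, OF pq, unfolded sum.inter_filter[OF fin(1)]]
  let ?L = "\<lambda>b a. \<Sum>f\<in>injections R S. if \<forall>r\<in>R. a' (f r) = e r then J a (overwrite R f b a') else 0"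
  let ?R = "\<lambda>b a. \<Sum>f\<in>injections R S. if \<forall>r\<in>R. a (f r) = b r then J (overwrite R f e a) a' else 0"
  have IH1: "?L b (a(s := q)) = ?R b (a(s := q))" if "s \<in> S" for s
    using insert.prems pq that by (intro insert.IH) (auto simp: PiE_iff extensional_def)
  \<comment> \<open>Where \<open>E_pq\<close> meets \<open>E_qj\<close> in one factor, the product
    is \<open>E_pj\<close>. These terms form the sum for \<open>b(i := p)\<close>, which is why
    \<open>b\<close> is arbitrary in the induction.\<close>
  have IH2: "?L (b(i := p)) a = ?R (b(i := p)) a" if "i \<in> R" for i
    using insert.prems pq that by (intro insert.IH) auto
  have ne: "i \<noteq> r" if "i \<in> R" for i using that insert.hyps by auto
  have upd: "overwrite (insert r R) (g(r := s)) x y = (overwrite R g x y)(s := x r)"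
    if "g \<in> injections R S" "s \<in> S - g ` R" for g s x y
  proof (rule overwrite_eqI)
    have g: "inj_on g R" using that by (simp add: injections_def)
    then show "inj_on (g(r := s)) (insert r R)" using that insert.hyps by (auto simp: inj_on_def)
    show "((overwrite R g x y)(s := x r)) ((g(r := s)) i) = x i" if "i \<in> insert r R" for i
      using that overwrite_apply[OF g] \<open>s \<in> S - g ` R\<close> by auto
    show "((overwrite R g x y)(s := x r)) i = y i" if "i \<notin> (g(r := s)) ` insert r R" for i
      using that insert.hyps by (auto simp: overwrite_def)
  qed
  have "(\<Sum>f\<in>injections (insert r R) S. if \<forall>i\<in>insert r R. a' (f i) = e i
            then J a (overwrite (insert r R) f b a') else 0) =
        (\<Sum>g\<in>injections R S. \<Sum>s\<in>S - g ` R. if \<forall>i\<in>R. a' (g i) = e i then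
            if a' s = q then J a ((overwrite R g b a')(s := p)) else 0 else 0)"
    unfolding sum_injections_insert[OF insert.hyps(2,1) fin(1)]
    by (intro sum.cong refl) (auto simp: upd p_def q_def ne)
  \<comment> \<open>The new factor \<open>s\<close> has to avoid the image of \<open>g\<close>, but
    invariance speaks of the sum over all of \<open>S\<close>; so the terms with
    \<open>s = g i\<close> are added and subtracted.\<close>
  also have "\<dots> = (\<Sum>g\<in>injections R S. if \<forall>i\<in>R. a' (g i) = e i then
      (\<Sum>s\<in>S. if a s = p then J (a(s := q)) (overwrite R g b a') else 0)
      - (\<Sum>i\<in>R. if b i = q then J a (overwrite R g (b(i := p)) a') else 0) else 0)"
  proof (rule sum.cong[OF refl])
    fix g assume g: "g \<in> injections R S"
    then have injg: "inj_on g R" by (simp add: injections_def)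
    let ?c = "overwrite R g b a'"
    have c: "?c \<in> S \<rightarrow>\<^sub>E {..<d}" using g insert.prems by (intro overwrite_in_PiE) auto
    have "(\<Sum>s\<in>S. if a s = p then J (a(s := q)) ?c else 0) = (\<Sum>s\<in>S. if ?c s = q then J a (?c(s := p)) else 0)"
      using inv'[of a ?c] insert.prems c by auto
    also have "\<dots> = (\<Sum>s\<in>S - g ` R. if ?c s = q then J a (?c(s := p)) else 0)
        + (\<Sum>i\<in>R. if ?c (g i) = q then J a (?c(g i := p)) else 0)"
      by (rule sum_split_injection[OF g insert.hyps(1) fin(1)])
    also have "(\<Sum>s\<in>S - g ` R. if ?c s = q then J a (?c(s := p)) else 0) =
        (\<Sum>s\<in>S - g ` R. if a' s = q then J a (?c(s := p)) else 0)"
      by (intro sum.cong) (auto simp: overwrite_outside)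
    also have "(\<Sum>i\<in>R. if ?c (g i) = q then J a (?c(g i := p)) else 0) =
        (\<Sum>i\<in>R. if b i = q then J a (overwrite R g (b(i := p)) a') else 0)"
    proof (rule sum.cong[OF refl])
      fix i assume i: "i \<in> R"
      have "overwrite R g (b(i := p)) a' = ?c(g i := p)"
        using injg i by (intro overwrite_eqI) (auto simp: overwrite_apply overwrite_outside inj_on_def)
      then show "(if ?c (g i) = q then J a (?c(g i := p)) else 0) =
          (if b i = q then J a (overwrite R g (b(i := p)) a') else 0)"
        using overwrite_apply[OF injg i] by simp
    qed
    finally show "(\<Sum>s\<in>S - g ` R. if \<forall>i\<in>R. a' (g i) = e i then
            if a' s = q then J a (?c(s := p)) else 0 else 0) =
       (if \<forall>i\<in>R. a' (g i) = e i then
      (\<Sum>s\<in>S. if a s = p then J (a(s := q)) ?c else 0)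
      - (\<Sum>i\<in>R. if b i = q then J a (overwrite R g (b(i := p)) a') else 0) else 0)"
      by (cases "\<forall>i\<in>R. a' (g i) = e i") (simp_all only: if_True if_False sum.neutral_const, simp)
  qed
  also have "\<dots> = (\<Sum>g\<in>injections R S.
        (\<Sum>s\<in>S. if a s = p then if \<forall>i\<in>R. a' (g i) = e i then J (a(s := q)) (overwrite R g b a') else 0 else 0)
      - (\<Sum>i\<in>R. if b i = q then if \<forall>i\<in>R. a' (g i) = e i then J a (overwrite R g (b(i := p)) a') else 0 else 0))"
  proof (rule sum.cong[OF refl])
    fix g
    show "(if \<forall>i\<in>R. a' (g i) = e i then
      (\<Sum>s\<in>S. if a s = p then J (a(s := q)) (overwrite R g b a') else 0)
      - (\<Sum>i\<in>R. if b i = q then J a (overwrite R g (b(i := p)) a') else 0) else 0) =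
        (\<Sum>s\<in>S. if a s = p then if \<forall>i\<in>R. a' (g i) = e i then J (a(s := q)) (overwrite R g b a') else 0 else 0)
      - (\<Sum>i\<in>R. if b i = q then if \<forall>i\<in>R. a' (g i) = e i then J a (overwrite R g (b(i := p)) a') else 0 else 0)"
    proof -
      have "(if C then (\<Sum>s\<in>S. if a s = p then F s else 0) - (\<Sum>i\<in>R. if b i = q then G i else 0) else 0) =
        (\<Sum>s\<in>S. if a s = p then if C then F s else 0 else 0) - (\<Sum>i\<in>R. if b i = q then if C then G i else 0 else 0)"
        for C and F G :: "nat \<Rightarrow> int"
        by (cases C) (simp_all cong: if_cong)
      then show ?thesis .
    qed
  qed
  also have "\<dots> = (\<Sum>s\<in>S. if a s = p then ?L b (a(s := q)) else 0) - (\<Sum>i\<in>R. if b i = q then ?L (b(i := p)) a else 0)"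
    unfolding sum_subtractf sum_if_swap ..
  also have "\<dots> = (\<Sum>s\<in>S. if a s = p then ?R b (a(s := q)) else 0) - (\<Sum>i\<in>R. if b i = q then ?R (b(i := p)) a else 0)"
  proof (intro arg_cong2[where f = "(-)"] sum.cong[OF refl])
    show "(if a s = p then ?L b (a(s := q)) else 0) = (if a s = p then ?R b (a(s := q)) else 0)"
      if "s \<in> S" for s
      using IH1[OF that] by (rule arg_cong)
    show "(if b i = q then ?L (b(i := p)) a else 0) = (if b i = q then ?R (b(i := p)) a else 0)"
      if "i \<in> R" for i
      using IH2[OF that] by (rule arg_cong)
  qed
  also have "\<dots> = (\<Sum>g\<in>injections R S.
        (\<Sum>s\<in>S. if a s = p then if \<forall>i\<in>R. (a(s := q)) (g i) = b i then J (overwrite R g e (a(s := q))) a' else 0 else 0)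
      - (\<Sum>i\<in>R. if b i = q then if \<forall>j\<in>R. a (g j) = (b(i := p)) j then J (overwrite R g e a) a' else 0 else 0))"
    unfolding sum_subtractf sum_if_swap ..
  also have "\<dots> = (\<Sum>g\<in>injections R S. \<Sum>s\<in>S - g ` R. if \<forall>i\<in>R. a (g i) = b i then
            if a s = p then J ((overwrite R g e a)(s := q)) a' else 0 else 0)"
  proof (rule sum.cong[OF refl])
    fix g assume g: "g \<in> injections R S"
    then have injg: "inj_on g R" by (simp add: injections_def)
    let ?F = "\<lambda>s. if a s = p then if \<forall>i\<in>R. (a(s := q)) (g i) = b i then J (overwrite R g e (a(s := q))) a' else 0 else 0"
    have 1: "(\<Sum>s\<in>S. ?F s) = (\<Sum>s\<in>S - g ` R. ?F s) + (\<Sum>i\<in>R. ?F (g i))"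
      by (rule sum_split_injection[OF g insert.hyps(1) fin(1)])
    have 2: "(\<Sum>s\<in>S - g ` R. ?F s) = (\<Sum>s\<in>S - g ` R. if \<forall>i\<in>R. a (g i) = b i then
            if a s = p then J ((overwrite R g e a)(s := q)) a' else 0 else 0)"
    proof (rule sum.cong[OF refl])
      fix s assume s: "s \<in> S - g ` R"
      have "overwrite R g e (a(s := q)) = (overwrite R g e a)(s := q)"
        using s injg by (intro overwrite_eqI) (auto simp: overwrite_apply overwrite_outside)
      moreover have "(a(s := q)) (g i) = a (g i)" if "i \<in> R" for i using s that by auto
      ultimately show "?F s = (if \<forall>i\<in>R. a (g i) = b i then
            if a s = p then J ((overwrite R g e a)(s := q)) a' else 0 else 0)" by auto
    qed
    \<comment> \<open>On this side a collision at \<open>s = g i\<close> means that \<open>a\<close>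
      has the value \<open>p\<close> there and that \<open>b i\<close>, compared with the updated
      value, is \<open>q\<close>.\<close>
    have 3: "(\<Sum>i\<in>R. ?F (g i)) =
        (\<Sum>i\<in>R. if b i = q then if \<forall>j\<in>R. a (g j) = (b(i := p)) j then J (overwrite R g e a) a' else 0 else 0)"
    proof (rule sum.cong[OF refl])
      fix i assume i: "i \<in> R"
      have "overwrite R g e (a(g i := q)) = overwrite R g e a"
        using i injg by (intro overwrite_eqI) (auto simp: overwrite_apply overwrite_outside)
      moreover have "a (g i) = p \<and> (\<forall>j\<in>R. (a(g i := q)) (g j) = b j) \<longleftrightarrow>
          b i = q \<and> (\<forall>j\<in>R. a (g j) = (b(i := p)) j)"
        using i injg by (auto simp: inj_on_def)
      moreover have "(if A then if B then x else 0 else 0) = (if A \<and> B then x else 0)" for A B and x :: int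
        by simp
      ultimately show "?F (g i) =
        (if b i = q then if \<forall>j\<in>R. a (g j) = (b(i := p)) j then J (overwrite R g e a) a' else 0 else 0)"
        by (simp only:)
    qed
    show "(\<Sum>s\<in>S. ?F s) -
        (\<Sum>i\<in>R. if b i = q then if \<forall>j\<in>R. a (g j) = (b(i := p)) j then J (overwrite R g e a) a' else 0 else 0) =
        (\<Sum>s\<in>S - g ` R. if \<forall>i\<in>R. a (g i) = b i then
            if a s = p then J ((overwrite R g e a)(s := q)) a' else 0 else 0)"
      unfolding 1 2 3 by (rule add_diff_cancel_right')
  qed
  also have "\<dots> = (\<Sum>f\<in>injections (insert r R) S. if \<forall>i\<in>insert r R. a (f i) = b i
            then J (overwrite (insert r R) f e a) a' else 0)"
    unfolding sum_injections_insert[OF insert.hyps(2,1) fin(1)]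
    by (intro sum.cong refl) (auto simp: upd p_def q_def ne)
  finally show ?case .
qed

lemma bij_betw_permutes_injections:
  assumes "finite S"
  shows "bij_betw (\<lambda>\<sigma>. restrict \<sigma> S) {\<sigma>. \<sigma> permutes S} (injections S S)"
proof (rule bij_betwI[where g = "\<lambda>f. restrict_id f S"])
  show "(\<lambda>\<sigma>. restrict \<sigma> S) \<in> {\<sigma>. \<sigma> permutes S} \<rightarrow> injections S S"
    by (auto simp: injections_def permutes_in_image inj_on_def dest: permutes_inj_on[of _ _ S])
  show "(\<lambda>f. restrict_id f S) \<in> injections S S \<rightarrow> {\<sigma>. \<sigma> permutes S}"
  proof
    fix f assume "f \<in> injections S S"
    then have "inj_on f S" "f ` S \<subseteq> S" by (auto simp: injections_def)
    then have "bij_betw f S S" using assms by (simp add: bij_betw_def endo_inj_surj)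
    then show "restrict_id f S \<in> {\<sigma>. \<sigma> permutes S}" using permutes_restrict_id by auto
  qed
  show "restrict_id (restrict \<sigma> S) S = \<sigma>" if "\<sigma> \<in> {\<sigma>. \<sigma> permutes S}" for \<sigma>
    using that by (auto simp: restrict_id_def fun_eq_iff permutes_not_in)
  show "restrict (restrict_id f S) S = f" if "f \<in> injections S S" for f
    using that by (auto simp: injections_def PiE_iff extensional_def fun_eq_iff)
qed

lemma comp_permutes_in_PiE:
  assumes "\<tau> permutes S" "a \<in> S \<rightarrow>\<^sub>E D"
  shows "a \<circ> \<tau> \<in> S \<rightarrow>\<^sub>E D"
  using assms by (auto simp: PiE_iff extensional_def permutes_in_image permutes_not_in)

text \<open>The case \<open>R = S\<close>, with the matrix unit of row \<open>a r\<close> and column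
  \<open>b r\<close> in the factor \<open>f r\<close>: every factor is occupied, so \<open>J\<close>
  commutes with all symmetrised elementary tensors. Injections of \<open>S\<close> into itself are
  permutations, and passing to their inverses turns \<open>overwrite\<close> into
  composition.\<close>

lemma gl_invariant_permutations:
  assumes fin: "finite S" and inv: "gl_invariant d S J"
    and W: "a \<in> S \<rightarrow>\<^sub>E {..<d}" "a' \<in> S \<rightarrow>\<^sub>E {..<d}" "b \<in> S \<rightarrow>\<^sub>E {..<d}" "e \<in> S \<rightarrow>\<^sub>E {..<d}"
  shows "(\<Sum>\<tau> | \<tau> permutes S. if a \<circ> \<tau> = a' then J (b \<circ> \<tau>) e else 0) =
         (\<Sum>\<tau> | \<tau> permutes S. if b \<circ> \<tau> = e then J a' (a \<circ> \<tau>) else 0)"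
proof -
  have tr: "(\<Sum>f\<in>injections S S. if \<forall>r\<in>S. x (f r) = y r then F (overwrite S f z x) else 0) =
     (\<Sum>\<tau> | \<tau> permutes S. if y \<circ> \<tau> = x then F (z \<circ> \<tau>) else 0)"
    if "x \<in> S \<rightarrow>\<^sub>E {..<d}" "y \<in> S \<rightarrow>\<^sub>E {..<d}" "z \<in> S \<rightarrow>\<^sub>E {..<d}" for x y z and F :: "(nat \<Rightarrow> nat) \<Rightarrow> int"
  proof -
    have "(\<Sum>f\<in>injections S S. if \<forall>r\<in>S. x (f r) = y r then F (overwrite S f z x) else 0) =
       (\<Sum>\<sigma> | \<sigma> permutes S. if \<forall>r\<in>S. x (restrict \<sigma> S r) = y r then F (overwrite S (restrict \<sigma> S) z x) else 0)"
      by (rule sum.reindex_bij_betw[OF bij_betw_permutes_injections[OF fin], symmetric])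
    also have "\<dots> = (\<Sum>\<sigma> | \<sigma> permutes S. if y \<circ> inv_into UNIV \<sigma> = x then F (z \<circ> inv_into UNIV \<sigma>) else 0)"
    proof (rule sum.cong[OF refl])
      fix \<sigma> assume "\<sigma> \<in> {\<sigma>. \<sigma> permutes S}"
      then have \<sigma>: "\<sigma> permutes S" by simp
      note pinv = permutes_inverses[OF \<sigma>]
      have iS: "inv_into UNIV \<sigma> s \<in> S \<longleftrightarrow> s \<in> S" for s
        using permutes_in_image[OF permutes_inv[OF \<sigma>]] .
      have out: "inv_into UNIV \<sigma> s = s" if "s \<notin> S" for s
        using permutes_not_in[OF permutes_inv[OF \<sigma>] that] .
      have "(\<forall>r\<in>S. x (restrict \<sigma> S r) = y r) \<longleftrightarrow> y \<circ> inv_into UNIV \<sigma> = x"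
      proof
        assume h: "\<forall>r\<in>S. x (restrict \<sigma> S r) = y r"
        show "y \<circ> inv_into UNIV \<sigma> = x"
        proof
          fix s show "(y \<circ> inv_into UNIV \<sigma>) s = x s"
            using h[rule_format, of "inv_into UNIV \<sigma> s"] iS[of s] pinv out[of s] that
            by (cases "s \<in> S") (auto simp: PiE_iff extensional_def)
        qed
      next
        assume h: "y \<circ> inv_into UNIV \<sigma> = x"
        show "\<forall>r\<in>S. x (restrict \<sigma> S r) = y r"
          using pinv by (auto simp: h[symmetric])
      qed
      moreover have "overwrite S (restrict \<sigma> S) z x = z \<circ> inv_into UNIV \<sigma>"
      proof (rule overwrite_eqI)
        show "inj_on (restrict \<sigma> S) S" using permutes_inj_on[OF \<sigma>, of S] by (simp add: inj_on_def)
        show "(z \<circ> inv_into UNIV \<sigma>) (restrict \<sigma> S r) = z r" if "r \<in> S" for r using that pinv by simp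
        show "(z \<circ> inv_into UNIV \<sigma>) s = x s" if "s \<notin> restrict \<sigma> S ` S" for s
        proof -
          have "restrict \<sigma> S ` S = S" using permutes_image[OF \<sigma>] by simp
          then have "s \<notin> S" using that by simp
          then show ?thesis using out[of s] \<open>x \<in> _\<close> \<open>z \<in> _\<close> by (simp add: PiE_iff extensional_def)
        qed
      qed
      ultimately show "(if \<forall>r\<in>S. x (restrict \<sigma> S r) = y r then F (overwrite S (restrict \<sigma> S) z x) else 0) =
         (if y \<circ> inv_into UNIV \<sigma> = x then F (z \<circ> inv_into UNIV \<sigma>) else 0)" by simp
    qed
    also have "\<dots> = (\<Sum>\<tau> | \<tau> permutes S. if y \<circ> \<tau> = x then F (z \<circ> \<tau>) else 0)"
      by (rule sum_permutations_inverse[symmetric])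
    finally show ?thesis .
  qed
  have "(\<Sum>f\<in>injections S S. if \<forall>r\<in>S. e (f r) = b r then J a' (overwrite S f a e) else 0) =
    (\<Sum>f\<in>injections S S. if \<forall>r\<in>S. a' (f r) = a r then J (overwrite S f b a') e else 0)"
    using W by (intro gl_invariant_injections[OF fin fin inv]) auto
  then show ?thesis using tr[of e b a "J a'"] tr[of a' a b "\<lambda>u. J u e"] W by simp
qed

text \<open>Averaging: with \<open>Q \<tau> = tr (\<tau>\<^sup>-\<^sup>1 J J\<^sup>T)\<close>, commutation with the symmetrised operators rewrites
  \<open>\<Sum>\<tau>. (Q \<tau>)\<^sup>2\<close> as a combination of the traces \<open>tr (\<tau> J)\<close>. So if those vanish, then so does
  \<open>Q id\<close>, the sum of the squares of the entries of \<open>J\<close>.\<close>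
lemma gl_invariant_trace_nonzero:
  assumes fin: "finite S" and inv: "gl_invariant d S J"
    and W: "a \<in> S \<rightarrow>\<^sub>E {..<d}" "b \<in> S \<rightarrow>\<^sub>E {..<d}" and nz: "J a b \<noteq> 0"
  shows "\<exists>\<tau>. \<tau> permutes S \<and> (\<Sum>u\<in>S \<rightarrow>\<^sub>E {..<d}. J u (u \<circ> \<tau>)) \<noteq> 0"
proof (rule ccontr)
  assume "\<not> ?thesis"
  then have tr0: "(\<Sum>u\<in>S \<rightarrow>\<^sub>E {..<d}. J u (u \<circ> \<tau>)) = 0" if "\<tau> permutes S" for \<tau> using that by auto
  define X where "X = (S \<rightarrow>\<^sub>E {..<d})"
  define P where "P = {\<tau>. \<tau> permutes S}"
  have finX: "finite X" and finP: "finite P"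
    using fin unfolding X_def P_def by (auto intro: finite_PiE finite_permutations)
  have comp: "x \<circ> \<tau> \<in> X" if "\<tau> \<in> P" "x \<in> X" for x \<tau>
    using that comp_permutes_in_PiE[of \<tau> S x "{..<d}"] unfolding X_def P_def by blast
  define M where "M = (\<lambda>x x'. \<Sum>c\<in>X. J x c * J x' c)"
  define Q where "Q = (\<lambda>\<tau>. \<Sum>x\<in>X. M x (x \<circ> \<tau>))"
  \<comment> \<open>In \<open>Q \<tau> * Q \<tau>\<close> one factor is expanded with the constraint
    \<open>x \<circ> \<tau> = x'\<close>, the other by entries of \<open>J\<close>. The inner sum
    over \<open>\<tau>\<close> is then one side of the commutation relation.\<close>
  have Q1: "Q \<tau> = (\<Sum>x\<in>X. \<Sum>x'\<in>X. if x \<circ> \<tau> = x' then M x x' else 0)" if "\<tau> \<in> P" for \<tau>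
    unfolding Q_def using finX comp[OF that] by (intro sum.cong) (auto simp: sum.delta)
  have Q2: "Q \<tau> = (\<Sum>y\<in>X. \<Sum>z\<in>X. J y z * J (y \<circ> \<tau>) z)" for \<tau>
    unfolding Q_def M_def ..
  have "(\<Sum>\<tau>\<in>P. Q \<tau> * Q \<tau>) = (\<Sum>\<tau>\<in>P. \<Sum>x\<in>X. \<Sum>x'\<in>X. \<Sum>y\<in>X. \<Sum>z\<in>X.
      M x x' * J y z * (if x \<circ> \<tau> = x' then J (y \<circ> \<tau>) z else 0))"
  proof (rule sum.cong[OF refl])
    fix \<tau> assume \<tau>: "\<tau> \<in> P"
    have "Q \<tau> * Q \<tau> = (\<Sum>x\<in>X. \<Sum>x'\<in>X. (if x \<circ> \<tau> = x' then M x x' else 0) * (\<Sum>y\<in>X. \<Sum>z\<in>X. J y z * J (y \<circ> \<tau>) z))"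
      using Q1[OF \<tau>] Q2[of \<tau>] by (simp add: sum_distrib_right)
    then show "Q \<tau> * Q \<tau> = (\<Sum>x\<in>X. \<Sum>x'\<in>X. \<Sum>y\<in>X. \<Sum>z\<in>X.
      M x x' * J y z * (if x \<circ> \<tau> = x' then J (y \<circ> \<tau>) z else 0))"
      unfolding sum_distrib_left by (auto intro!: sum.cong simp: sum_distrib_left ac_simps)
  qed
  also have "\<dots> = (\<Sum>x\<in>X. \<Sum>x'\<in>X. \<Sum>y\<in>X. \<Sum>z\<in>X.
      M x x' * J y z * (\<Sum>\<tau>\<in>P. if x \<circ> \<tau> = x' then J (y \<circ> \<tau>) z else 0))"
    unfolding sum_distrib_left sum.swap[of _ X P] ..
  also have "\<dots> = (\<Sum>x\<in>X. \<Sum>x'\<in>X. \<Sum>y\<in>X. \<Sum>z\<in>X.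
      M x x' * J y z * (\<Sum>\<tau>\<in>P. if y \<circ> \<tau> = z then J x' (x \<circ> \<tau>) else 0))"
  proof -
    have "(\<Sum>\<tau>\<in>P. if x \<circ> \<tau> = x' then J (y \<circ> \<tau>) z else 0) = (\<Sum>\<tau>\<in>P. if y \<circ> \<tau> = z then J x' (x \<circ> \<tau>) else 0)"
      if "x \<in> X" "x' \<in> X" "y \<in> X" "z \<in> X" for x x' y z
      using gl_invariant_permutations[OF fin inv that[unfolded X_def]] unfolding P_def .
    then show ?thesis by (intro sum.cong refl) simp
  qed
  also have "\<dots> = (\<Sum>\<tau>\<in>P. \<Sum>x\<in>X. \<Sum>x'\<in>X. \<Sum>y\<in>X. \<Sum>z\<in>X.
      M x x' * J y z * (if y \<circ> \<tau> = z then J x' (x \<circ> \<tau>) else 0))"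
    unfolding sum_distrib_left sum.swap[of _ X P] ..
  also have "\<dots> = 0"
  proof (rule sum.neutral, rule ballI)
    fix \<tau> assume \<tau>: "\<tau> \<in> P"
    have "(\<Sum>y\<in>X. \<Sum>z\<in>X. M x x' * J y z * (if y \<circ> \<tau> = z then J x' (x \<circ> \<tau>) else 0)) = 0" for x x'
    proof -
      have "(\<Sum>y\<in>X. \<Sum>z\<in>X. M x x' * J y z * (if y \<circ> \<tau> = z then J x' (x \<circ> \<tau>) else 0)) =
         (\<Sum>y\<in>X. \<Sum>z\<in>X. if y \<circ> \<tau> = z then M x x' * J y z * J x' (x \<circ> \<tau>) else 0)"
        by (intro sum.cong) auto
      \<comment> \<open>After the exchange the constraint ties \<open>z\<close> to \<open>y\<close>,
        so that the sum of \<open>J y (y \<circ> \<tau>)\<close> splits off, a trace assumed to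
        vanish.\<close>
      also have "\<dots> = (\<Sum>y\<in>X. M x x' * J y (y \<circ> \<tau>) * J x' (x \<circ> \<tau>))"
        using finX comp[OF \<tau>] by (intro sum.cong) (auto simp: sum.delta)
      also have "\<dots> = M x x' * (\<Sum>y\<in>X. J y (y \<circ> \<tau>)) * J x' (x \<circ> \<tau>)"
        by (simp add: sum_distrib_left sum_distrib_right)
      finally show ?thesis using tr0[of \<tau>] \<tau> unfolding X_def P_def by simp
    qed
    then show "(\<Sum>x\<in>X. \<Sum>x'\<in>X. \<Sum>y\<in>X. \<Sum>z\<in>X.
      M x x' * J y z * (if y \<circ> \<tau> = z then J x' (x \<circ> \<tau>) else 0)) = 0" by simp
  qed
  finally have "\<forall>\<tau>\<in>P. Q \<tau> * Q \<tau> = 0"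
    using sum_nonneg_eq_0_iff[OF finP, of "\<lambda>\<tau>. Q \<tau> * Q \<tau>"] by auto
  moreover have "id \<in> P" by (simp add: P_def permutes_id)
  ultimately have "Q id = 0" by auto
  then have "(\<Sum>x\<in>X. \<Sum>c\<in>X. J x c * J x c) = 0" by (simp add: Q2)
  moreover have "(\<Sum>c\<in>X. J x c * J x c) \<ge> 0" for x by (intro sum_nonneg) auto
  ultimately have "\<forall>x\<in>X. (\<Sum>c\<in>X. J x c * J x c) = 0"
    by (subst (asm) sum_nonneg_eq_0_iff[OF finX]) auto
  then have "(\<Sum>c\<in>X. J a c * J a c) = 0" using W by (simp add: X_def)
  then have "\<forall>c\<in>X. J a c * J a c = 0" by (subst (asm) sum_nonneg_eq_0_iff[OF finX]) auto
  then show False using nz W by (auto simp: X_def)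
qed

subsection \<open>Cycles\<close>

text \<open>Makes the list-based theory of \<open>support\<close> and \<open>cycle_of_list\<close>
  available for cycles given as orbits.\<close>

lemma cyc_eq_support: "permutation p \<Longrightarrow> cyc p x = set (support p x)"
  by (subst support_set) (auto simp: cyc_def)

lemma card_cyc: "permutation p \<Longrightarrow> card (cyc p x) = least_power p x"
  using distinct_card[OF cycle_of_permutation] by (simp add: cyc_eq_support)

lemma finite_cyc: "permutation p \<Longrightarrow> finite (cyc p x)"
  by (simp add: cyc_eq_support)

lemma self_in_cyc: "x \<in> cyc p x"
  unfolding cyc_def by (auto intro: exI[of _ 0])

lemma funpow_in_cyc: "(p ^^ i) x \<in> cyc p x"
  unfolding cyc_def by auto

lemma card_cyc_pos: "permutation p \<Longrightarrow> 0 < card (cyc p x)"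
  using self_in_cyc finite_cyc by (metis card_gt_0_iff empty_iff)

lemma funpow_card_cyc: "permutation p \<Longrightarrow> (p ^^ card (cyc p x)) x = x"
  by (simp add: card_cyc least_power_of_permutation)

lemma cyc_conv_image: "permutation p \<Longrightarrow> cyc p x = (\<lambda>i. (p ^^ i) x) ` {..<card (cyc p x)}"
  unfolding card_cyc by (simp add: cyc_eq_support atLeast0LessThan)

lemma inj_on_cyc: "permutation p \<Longrightarrow> inj_on (\<lambda>i. (p ^^ i) x) {..<card (cyc p x)}"
  using cycle_of_permutation[of p x] unfolding card_cyc by (simp add: distinct_map atLeast0LessThan)

lemma cyc_eq_iff:
  assumes "permutation p"
  shows "cyc p y = cyc p x \<longleftrightarrow> y \<in> cyc p x"
proof
  show "y \<in> cyc p x" if "cyc p y = cyc p x" using that self_in_cyc by blast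
  assume "y \<in> cyc p x"
  then have "y \<in> cyc p y \<inter> cyc p x" using self_in_cyc by auto
  then show "cyc p y = cyc p x"
    using disjoint_support[OF assms] unfolding cyc_eq_support[OF assms, symmetric] disjoint_def
    by blast
qed

lemma cyc_step_iff:
  assumes "permutation p"
  shows "p y \<in> cyc p x \<longleftrightarrow> y \<in> cyc p x"
proof -
  have "p y \<in> cyc p y" using funpow_in_cyc[where p = p and i = 1 and x = y] by simp
  then have "cyc p (p y) = cyc p y" using cyc_eq_iff[OF assms] by blast
  then show ?thesis using cyc_eq_iff[OF assms] by metis
qed

lemma cyc_subset:
  assumes "p permutes A" "x \<in> A"
  shows "cyc p x \<subseteq> A"
proof -
  have "(p ^^ i) x \<in> A" for i by (induction i) (use assms(2) permutes_in_image[OF assms(1)] in auto)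
  then show ?thesis unfolding cyc_def by auto
qed

text \<open>A cycle of length n is a product of n - 1 transpositions.\<close>

lemma sign_cycle_of_list:
  "distinct cs \<Longrightarrow> cs \<noteq> [] \<Longrightarrow> sign (cycle_of_list cs) = (if even (length cs) then - 1 else 1)"
proof (induction cs rule: cycle_of_list.induct)
  case (1 i j cs)
  then have "sign (cycle_of_list (i # j # cs)) = - sign (cycle_of_list (j # cs))"
    by (simp add: sign_compose permutation_swap_id permutation_of_cycle sign_swap_id)
  also have "\<dots> = - (if even (length (j # cs)) then - 1 else 1)"
    using 1 by (subst 1(1)) auto
  finally show ?case by (simp del: cycle_of_list.simps)
qed auto

text \<open>Serves to exchange two cycles of equal length; in the form \<open>apply_transps\<close>
  the parity can be read off from the number of transpositions.\<close>

lemma apply_transps_zip: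
  assumes "length xs = length ys" "distinct (xs @ ys)"
  shows "\<And>i. i < length xs \<Longrightarrow> apply_transps (zip xs ys) (xs ! i) = ys ! i"
    and "\<And>i. i < length xs \<Longrightarrow> apply_transps (zip xs ys) (ys ! i) = xs ! i"
    and "\<And>z. z \<notin> set xs \<Longrightarrow> z \<notin> set ys \<Longrightarrow> apply_transps (zip xs ys) z = z"
proof -
  have "(\<forall>i<length xs. apply_transps (zip xs ys) (xs ! i) = ys ! i \<and> apply_transps (zip xs ys) (ys ! i) = xs ! i) \<and>
        (\<forall>z. z \<notin> set xs \<longrightarrow> z \<notin> set ys \<longrightarrow> apply_transps (zip xs ys) z = z)"
    using assms
  proof (induction xs ys rule: list_induct2)
    case Nil
    then show ?case by simp
  next
    case (Cons x xs y ys)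
    then have IH: "\<And>i. i < length xs \<Longrightarrow> apply_transps (zip xs ys) (xs ! i) = ys ! i"
      "\<And>i. i < length xs \<Longrightarrow> apply_transps (zip xs ys) (ys ! i) = xs ! i"
      "\<And>z. z \<notin> set xs \<Longrightarrow> z \<notin> set ys \<Longrightarrow> apply_transps (zip xs ys) z = z"
      by auto
    have ne: "xs ! i \<noteq> x" "xs ! i \<noteq> y" "ys ! i \<noteq> x" "ys ! i \<noteq> y" if "i < length xs" for i
      using that Cons by (auto dest: nth_mem)
    show ?case
    proof (intro conjI allI impI)
      fix i assume i: "i < length (x # xs)"
      show "apply_transps (zip (x # xs) (y # ys)) ((x # xs) ! i) = (y # ys) ! i"
        using i ne IH Cons.prems by (cases i) auto
      show "apply_transps (zip (x # xs) (y # ys)) ((y # ys) ! i) = (x # xs) ! i"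
        using i ne IH Cons.prems by (cases i) auto
    next
      fix z assume "z \<notin> set (x # xs)" "z \<notin> set (y # ys)"
      then show "apply_transps (zip (x # xs) (y # ys)) z = z" using IH by auto
    qed
  qed
  then show "\<And>i. i < length xs \<Longrightarrow> apply_transps (zip xs ys) (xs ! i) = ys ! i"
    and "\<And>i. i < length xs \<Longrightarrow> apply_transps (zip xs ys) (ys ! i) = xs ! i"
    and "\<And>z. z \<notin> set xs \<Longrightarrow> z \<notin> set ys \<Longrightarrow> apply_transps (zip xs ys) z = z" by auto
qed

subsection \<open>Alternated products of traces\<close>

text \<open>Up to sign, the value at all \<open>d * d\<close> matrix units of the alternation of
  \<open>\<Prod>\<^sub>c tr (\<Prod>\<^sub>t x\<^sub>t)\<close>, where \<open>c\<close> runs over the cycles of \<open>\<nu>\<close>, and \<open>t\<close> over \<open>c\<close>.\<close>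
definition cycle_trace :: "nat \<Rightarrow> (nat \<Rightarrow> nat) \<Rightarrow> int" where
  "cycle_trace d \<nu> = (\<Sum>u\<in>{..<d*d} \<rightarrow>\<^sub>E {..<d}. map_sign (d*d) (\<lambda>t. u t * d + u (\<nu> t)))"

text \<open>Renaming the positions by \<open>g\<close> only permutes the alternated variables, at
  the cost of \<open>sign g\<close>. For \<open>\<mu> = \<nu>\<close>, an odd \<open>g\<close> that
  commutes with \<open>\<nu>\<close> therefore forces the value 0.\<close>

lemma cycle_trace_conj:
  assumes g: "g permutes {..<d*d}" and "g \<circ> \<nu> = \<mu> \<circ> g"
  shows "cycle_trace d \<nu> = sign g * cycle_trace d \<mu>"
proof -
  have eq: "g (\<nu> t) = \<mu> (g t)" for t using assms(2) by (metis comp_apply)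
  have "cycle_trace d \<nu> = (\<Sum>u\<in>{..<d*d} \<rightarrow>\<^sub>E {..<d}. map_sign (d*d) (\<lambda>t. (u \<circ> g) t * d + (u \<circ> g) (\<nu> t)))"
    unfolding cycle_trace_def
  proof (rule sum.reindex_bij_witness[where i = "\<lambda>u. u \<circ> g" and j = "\<lambda>u. u \<circ> inv_into UNIV g"])
    fix u assume u: "u \<in> {..<d*d} \<rightarrow>\<^sub>E {..<d}"
    show 1: "u \<circ> inv_into UNIV g \<circ> g = u" using permutes_inv_o[OF g] by (simp add: comp_assoc)
    show "u \<circ> g \<circ> inv_into UNIV g = u" using permutes_inv_o[OF g] by (simp add: comp_assoc)
    show "u \<circ> inv_into UNIV g \<in> {..<d*d} \<rightarrow>\<^sub>E {..<d}"
      using comp_permutes_in_PiE[OF permutes_inv[OF g] u] .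
    show "u \<circ> g \<in> {..<d*d} \<rightarrow>\<^sub>E {..<d}" using comp_permutes_in_PiE[OF g u] .
    show "map_sign (d*d) (\<lambda>t. (u \<circ> inv_into UNIV g \<circ> g) t * d + (u \<circ> inv_into UNIV g \<circ> g) (\<nu> t)) =
        map_sign (d*d) (\<lambda>t. u t * d + u (\<nu> t))" unfolding 1 ..
  qed
  also have "\<dots> = (\<Sum>u\<in>{..<d*d} \<rightarrow>\<^sub>E {..<d}. map_sign (d*d) ((\<lambda>t. u t * d + u (\<mu> t)) \<circ> g))"
    by (simp add: comp_def eq)
  also have "\<dots> = sign g * cycle_trace d \<mu>"
    by (simp add: map_sign_comp[OF g] cycle_trace_def sum_distrib_left ac_simps)
  finally show ?thesis .
qed

text \<open>The map \<open>g\<close> that acts as \<open>\<nu>\<close> on one cycle and trivially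
  elsewhere commutes with \<open>\<nu>\<close>, and it is odd if the cycle has even length.\<close>

lemma cycle_trace_odd_cycles:
  assumes \<nu>: "\<nu> permutes {..<d*d}" and nz: "cycle_trace d \<nu> \<noteq> 0" and x: "x < d * d"
  shows "odd (card (cyc \<nu> x))"
proof
  assume even: "even (card (cyc \<nu> x))"
  have p: "permutation \<nu>" using \<nu> permutes_imp_permutation by blast
  define g where "g = cycle_of_list (support \<nu> x)"
  have supp: "set (support \<nu> x) = cyc \<nu> x" using cyc_eq_support[OF p] by simp
  have gin: "g y = \<nu> y" if "y \<in> cyc \<nu> x" for y
    using cycle_restrict[OF p, of y x, unfolded supp, OF that] unfolding g_def by (rule sym)
  have gout: "g y = y" if "y \<notin> cyc \<nu> x" for y
    using id_outside_supp[of y "support \<nu> x", unfolded supp, OF that] unfolding g_def .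
  have "g permutes cyc \<nu> x" using cycle_permutes[of "support \<nu> x"] unfolding g_def supp .
  then have g: "g permutes {..<d*d}" using cyc_subset[OF \<nu>, of x] x permutes_subset by blast
  have "g \<circ> \<nu> = \<nu> \<circ> g"
  proof
    show "(g \<circ> \<nu>) y = (\<nu> \<circ> g) y" for y
      using gin gout cyc_step_iff[OF p] by (cases "y \<in> cyc \<nu> x") auto
  qed
  then have "cycle_trace d \<nu> = sign g * cycle_trace d \<nu>" by (rule cycle_trace_conj[OF g])
  moreover have "sign g = - 1"
    using sign_cycle_of_list[OF cycle_of_permutation[OF p], of x] even least_power_of_permutation(2)[OF p, of x]
    unfolding g_def card_cyc[OF p] by auto
  ultimately show False using nz by simp
qed

text \<open>Exchanging two cycles of length \<open>r\<close> step by step commutes with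
  \<open>\<nu>\<close> and takes \<open>r\<close> transpositions. As \<open>r\<close> is odd by the
  previous lemma, the exchange is odd.\<close>

lemma cycle_trace_distinct_cycles:
  assumes \<nu>: "\<nu> permutes {..<d*d}" and nz: "cycle_trace d \<nu> \<noteq> 0" and x: "x < d * d" and y: "y < d * d"
    and eq: "card (cyc \<nu> x) = card (cyc \<nu> y)"
  shows "cyc \<nu> x = cyc \<nu> y"
proof (rule ccontr)
  assume ne: "cyc \<nu> x \<noteq> cyc \<nu> y"
  have p: "permutation \<nu>" using \<nu> permutes_imp_permutation by blast
  have disj: "cyc \<nu> x \<inter> cyc \<nu> y = {}" using ne cyc_eq_iff[OF p] by blast
  define r where "r = card (cyc \<nu> x)"
  have r: "r = least_power \<nu> x" "r = least_power \<nu> y" using eq card_cyc[OF p] by (auto simp: r_def)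
  define xs ys where "xs = support \<nu> x" and "ys = support \<nu> y"
  have len: "length xs = r" "length ys = r" using r by (auto simp: xs_def ys_def)
  have sets: "set xs = cyc \<nu> x" "set ys = cyc \<nu> y"
    using cyc_eq_support[OF p] by (auto simp: xs_def ys_def)
  have dist: "distinct (xs @ ys)"
    using disj cycle_of_permutation[OF p, of x] cycle_of_permutation[OF p, of y] sets
    by (auto simp: xs_def[symmetric] ys_def[symmetric])
  have xsi: "xs ! i = (\<nu> ^^ i) x" and ysi: "ys ! i = (\<nu> ^^ i) y" if "i < r" for i
    using that r unfolding xs_def ys_def by simp_all
  have r0: "r > 0" using card_cyc_pos[OF p] by (simp add: r_def)
  have powr: "(\<nu> ^^ r) x = x" "(\<nu> ^^ r) y = y"
    using funpow_card_cyc[OF p] eq unfolding r_def by metis+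
  define g where "g = apply_transps (zip xs ys)"
  have lens: "length xs = length ys" using len by simp
  note tz = apply_transps_zip[OF lens dist, folded g_def]
  \<comment> \<open>The transpositions give this for exponents below \<open>r\<close>; both cycles
    close up after \<open>r\<close> steps.\<close>
  have gx: "g ((\<nu> ^^ i) x) = (\<nu> ^^ i) y" for i
    using tz(1)[of "i mod r"] r0 len xsi[of "i mod r"] ysi[of "i mod r"] funpow_mod_eq[OF powr(1)] funpow_mod_eq[OF powr(2)]
    by simp
  have gy: "g ((\<nu> ^^ i) y) = (\<nu> ^^ i) x" for i
    using tz(2)[of "i mod r"] r0 len xsi[of "i mod r"] ysi[of "i mod r"] funpow_mod_eq[OF powr(1)] funpow_mod_eq[OF powr(2)]
    by simp
  have gout: "g z = z" if "z \<notin> cyc \<nu> x" "z \<notin> cyc \<nu> y" for z using tz(3) that sets by auto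
  have comm: "g \<circ> \<nu> = \<nu> \<circ> g"
  proof
    fix z
    consider i where "z = (\<nu> ^^ i) x" | i where "z = (\<nu> ^^ i) y" | "z \<notin> cyc \<nu> x" "z \<notin> cyc \<nu> y"
      by (auto simp: cyc_def)
    then show "(g \<circ> \<nu>) z = (\<nu> \<circ> g) z"
    proof cases
      case 1
      then show ?thesis using gx[of "Suc i"] gx[of i] by simp
    next
      case 2
      then show ?thesis using gy[of "Suc i"] gy[of i] by simp
    next
      case 3
      then show ?thesis using gout cyc_step_iff[OF p] by simp
    qed
  qed
  have "set xs \<subseteq> {..<d*d}" "set ys \<subseteq> {..<d*d}" using cyc_subset[OF \<nu>] x y sets by auto
  then have g: "g permutes {..<d*d}" unfolding g_def
    by (intro permutes_apply_transps) (auto dest: set_zip_leftD set_zip_rightD)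
  have "\<forall>(a, b)\<in>set (zip xs ys). a \<noteq> b"
    using disj sets by (auto dest: set_zip_leftD set_zip_rightD)
  then have "evenperm g \<longleftrightarrow> even r" unfolding g_def using len by (simp add: evenperm_apply_transps_iff)
  moreover have "odd r" using cycle_trace_odd_cycles[OF \<nu> nz x] by (simp add: r_def)
  ultimately have "sign g = - 1" by (simp add: sign_def)
  then show False using cycle_trace_conj[OF g comm] nz by simp
qed

text \<open>Alternating the heads of more than \<open>d\<close> edges gives \<open>0\<close>, as two of them coincide.\<close>
lemma sum_cycle_trace_alternate:
  assumes \<nu>: "\<nu> permutes {..<d*d}" and C: "C \<subseteq> {..<d*d}" and "d < card C"
  shows "(\<Sum>\<tau> | \<tau> permutes C. sign \<tau> * cycle_trace d (\<nu> \<circ> \<tau>)) = 0"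
proof -
  have finC: "finite C" using C finite_subset by blast
  have "(\<Sum>\<tau> | \<tau> permutes C. sign \<tau> * map_sign (d*d) (\<lambda>t. u t * d + u (\<nu> (\<tau> t)))) = 0"
    if u: "u \<in> {..<d*d} \<rightarrow>\<^sub>E {..<d}" for u
  proof -
    have "(\<lambda>c. u (\<nu> c)) ` C \<subseteq> {..<d}"
    proof
      fix e assume "e \<in> (\<lambda>c. u (\<nu> c)) ` C"
      then obtain c where c: "c \<in> C" "e = u (\<nu> c)" by blast
      then have "\<nu> c \<in> {..<d*d}" using C permutes_in_image[OF \<nu>] by blast
      then show "e \<in> {..<d}" using PiE_mem[OF u] c(2) by simp
    qed
    then have "card ((\<lambda>c. u (\<nu> c)) ` C) \<le> d" using card_mono[of "{..<d}"] by simp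
    then have "\<not> inj_on (\<lambda>c. u (\<nu> c)) C" using \<open>d < card C\<close> by (intro pigeonhole) linarith
    then obtain c c' where c: "c \<in> C" "c' \<in> C" "c \<noteq> c'" "u (\<nu> c) = u (\<nu> c')" unfolding inj_on_def by blast
    let ?s = "transpose c c'"
    define F where "F \<tau> = sign \<tau> * map_sign (d*d) (\<lambda>t. u t * d + u (\<nu> (\<tau> t)))" for \<tau>
    have "u (\<nu> (?s t)) = u (\<nu> t)" for t using c by (auto simp: transpose_def)
    then have "F (?s \<circ> \<tau>) = - F \<tau>" if "\<tau> permutes C" for \<tau>
      using permutes_imp_permutation[OF finC that] c(3)
      by (simp add: F_def sign_compose permutation_swap_id sign_swap_id)
    then have "(\<Sum>\<tau> | \<tau> permutes C. F \<tau>) = - (\<Sum>\<tau> | \<tau> permutes C. F \<tau>)"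
      using setum_permutations_compose_left[OF permutes_swap_id[OF c(1,2)], of F]
      by (simp add: sum_negf)
    then show ?thesis unfolding F_def by simp
  qed
  then have "(\<Sum>u\<in>{..<d*d} \<rightarrow>\<^sub>E {..<d}. \<Sum>\<tau> | \<tau> permutes C. sign \<tau> * map_sign (d*d) (\<lambda>t. u t * d + u (\<nu> (\<tau> t)))) = 0"
    by simp
  then show ?thesis unfolding cycle_trace_def sum_distrib_left comp_def
    by (subst sum.swap) simp
qed

text \<open>The argument that deduces the Amitsur--Levitzki theorem from the vanishing of alternations over
  more than \<open>d\<close> indices. Cut a cycle of odd length at least \<open>2 * d\<close> into \<open>d\<close> pairs and one segment of
  odd length, and let \<open>\<tau>\<close> permute the ends of these \<open>d + 1\<close> pieces. If the pieces are glued to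
  several cycles, then one of these has even length; otherwise the result is conjugate to
  \<open>\<nu>\<close> by a permutation of the pairs, which is even.\<close>
lemma cycle_trace_short_cycles:
  assumes \<nu>: "\<nu> permutes {..<d*d}" and nz: "cycle_trace d \<nu> \<noteq> 0" and x: "x < d * d"
  shows "card (cyc \<nu> x) < 2 * d"
proof (rule ccontr)
  define c where "c = card (cyc \<nu> x)"
  assume "\<not> card (cyc \<nu> x) < 2 * d"
  then have "2 * d \<le> c" by (simp add: c_def)
  moreover have oddc: "odd c" unfolding c_def by (rule cycle_trace_odd_cycles[OF \<nu> nz x])
  ultimately have cd: "2 * d < c" by presburger
  have p: "permutation \<nu>" using \<nu> permutes_imp_permutation by blast
  have d0: "0 < d" using x by (cases d) auto
  define y where "y i = (\<nu> ^^ i) x" for i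
  have y_Suc: "\<nu> (y i) = y (Suc i)" for i by (simp add: y_def)
  have y_inj: "inj_on y {..<c}" using inj_on_cyc[OF p, of x] by (simp add: c_def y_def[abs_def])
  have y_img: "cyc \<nu> x = y ` {..<c}" using cyc_conv_image[OF p, of x] by (simp add: c_def y_def[abs_def])
  have y_c: "y (c + i) = y i" for i
    using funpow_card_cyc[OF p, of x] by (simp add: y_def c_def add.commute[of "card _"] funpow_add)
  have y_eq: "y i = y j \<longleftrightarrow> i = j" if "i < c" "j < c" for i j
    using y_inj that by (auto simp: inj_on_def)
  define B where "B = cyc \<nu> x"
  have yB: "y i \<in> B" for i by (simp add: B_def y_def funpow_in_cyc)
  have B_sub: "B \<subseteq> {..<d*d}" unfolding B_def using cyc_subset[OF \<nu>] x by auto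
  \<comment> \<open>The last positions of the pieces: 1, 3, ..., 2d - 1 for the pairs (0, 1), (2,
    3), ..., and c - 1 for the segment from 2d on, whose length c - 2d is odd.\<close>
  define K where "K = insert (c - 1) ((\<lambda>i. 2 * i + 1) ` {..<d})"
  have K_lt: "K \<subseteq> {..<c}" using cd by (auto simp: K_def)
  have even_notK: "2 * i \<notin> K" if "i < d" for i
    using that cd by (auto simp: K_def) presburger+
  have big_notK: "j \<notin> K" if "2 * d \<le> j" "Suc j < c" for j using that by (auto simp: K_def)
  have cardK: "card K = Suc d"
  proof -
    have "card ((\<lambda>i. 2 * i + 1) ` {..<d}) = d" by (simp add: card_image inj_on_def)
    moreover have "c - 1 \<notin> (\<lambda>i. 2 * i + 1) ` {..<d}" using cd by auto
    ultimately show ?thesis by (simp add: K_def)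
  qed
  define C where "C = y ` K"
  have cardC: "card C = Suc d"
    unfolding C_def using card_image[OF inj_on_subset[OF y_inj K_lt]] cardK by simp
  have CB: "C \<subseteq> B" using yB by (auto simp: C_def)
  have y_notC: "y j \<notin> C" if "j < c" "j \<notin> K" for j
    using that K_lt y_eq by (auto simp: C_def)
  have finC: "finite C" by (rule finite_subset[OF subset_trans[OF CB B_sub]]) simp
  \<comment> \<open>Every nonzero summand equals that of the identity. Hence the alternating sum,
    known to be 0, is a positive multiple of \<open>cycle_trace d \<nu>\<close>.\<close>
  have key: "sign \<tau> * cycle_trace d (\<nu> \<circ> \<tau>) = cycle_trace d \<nu>"
    if \<tau>: "\<tau> permutes C" and nz': "cycle_trace d (\<nu> \<circ> \<tau>) \<noteq> 0" for \<tau>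
  proof -
    define \<mu> where "\<mu> = \<nu> \<circ> \<tau>"
    have \<tau>m: "\<tau> permutes {..<d*d}" by (rule permutes_subset[OF \<tau> subset_trans[OF CB B_sub]])
    have \<mu>: "\<mu> permutes {..<d*d}" unfolding \<mu>_def by (rule permutes_compose[OF \<tau>m \<nu>])
    have pm: "permutation \<mu>" using \<mu> permutes_imp_permutation by blast
    have \<mu>_notK: "\<mu> (y j) = y (Suc j)" if "j < c" "j \<notin> K" for j
      using permutes_not_in[OF \<tau> y_notC[OF that]] by (simp add: \<mu>_def y_Suc)
    \<comment> \<open>From the end of a piece \<open>\<mu>\<close> moves to the beginning of a
      piece, at an even position up to \<open>2 * d\<close>; position \<open>c\<close> is position 0
      again.\<close>
    have \<mu>_K: "\<exists>i\<le>d. \<mu> (y k) = y (2 * i)" if k: "k \<in> K" for k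
    proof -
      have "\<tau> (y k) \<in> C" using k permutes_in_image[OF \<tau>] by (auto simp: C_def)
      then obtain k' where k': "k' \<in> K" "\<tau> (y k) = y k'" by (auto simp: C_def)
      then have eq: "\<mu> (y k) = y (Suc k')" by (simp add: \<mu>_def y_Suc)
      show ?thesis
      proof (cases "k' = c - 1")
        case True
        then have "\<mu> (y k) = y (2 * 0)" using eq cd y_c[of 0] by simp
        then show ?thesis by blast
      next
        case False
        then obtain i where "i < d" "k' = 2 * i + 1" using k' by (auto simp: K_def)
        then have "Suc i \<le> d" "\<mu> (y k) = y (2 * Suc i)" using eq by auto
        then show ?thesis by blast
      qed
    qed
    \<comment> \<open>The beginning of the long segment; \<open>z\<close> runs through its cycle
      under \<open>\<mu>\<close>.\<close>
    define w where "w = y (2 * d)"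
    define z where "z i = (\<mu> ^^ i) w" for i
    have z_Suc: "\<mu> (z i) = z (Suc i)" for i by (simp add: z_def)
    have z_y: "z i = y (2 * d + i)" if "2 * d + i < c" for i
      using that
    proof (induction i)
      case 0
      then show ?case by (simp add: z_def w_def)
    next
      case (Suc i)
      then have "\<mu> (y (2 * d + i)) = y (Suc (2 * d + i))"
        by (intro \<mu>_notK big_notK) auto
      then show ?case using Suc z_Suc[of i] by simp
    qed
    have zw: "z i \<in> cyc \<mu> w" for i by (simp add: z_def funpow_in_cyc)
    have \<tau>B: "\<tau> permutes B" using permutes_subset[OF \<tau> CB] .
    have \<mu>B: "\<mu> v \<in> B" if "v \<in> B" for v
      using that permutes_in_image[OF \<tau>B] cyc_step_iff[OF p] by (simp add: \<mu>_def B_def)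
    have cycB: "cyc \<mu> v \<subseteq> B" if "v \<in> B" for v
    proof -
      have "(\<mu> ^^ i) v \<in> B" for i by (induction i) (use that \<mu>B in auto)
      then show ?thesis by (auto simp: cyc_def)
    qed
    have pair: "\<mu> (y (2 * i)) = y (2 * i + 1)" if "i < d" for i
      using \<mu>_notK[of "2 * i"] even_notK[OF that] that cd by simp
    \<comment> \<open>A cycle that misses the long segment would consist of whole pairs and so have
      even length, which is excluded for \<open>\<mu>\<close> as well.\<close>
    have claim: "y (2 * i) \<in> cyc \<mu> w" if i: "i < d" for i
    proof (rule ccontr)
      assume "y (2 * i) \<notin> cyc \<mu> w"
      define D where "D = cyc \<mu> (y (2 * i))"
      have wD: "z j \<notin> D" for j
        using \<open>y (2 * i) \<notin> cyc \<mu> w\<close> cyc_eq_iff[OF pm] zw[of j] unfolding D_def by metis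
      define I where "I = {j. j < d \<and> y (2 * j) \<in> D}"
      have "D = (\<lambda>j. y (2 * j)) ` I \<union> (\<lambda>j. y (2 * j + 1)) ` I"
      proof (intro equalityI subsetI)
        fix v assume v: "v \<in> D"
        then have "v \<in> B" using cycB yB unfolding D_def by blast
        then obtain j where j: "j < c" "v = y j" using y_img by (auto simp: B_def)
        have "j < 2 * d"
        proof (rule ccontr)
          assume "\<not> j < 2 * d"
          then have "v = z (j - 2 * d)" using z_y[of "j - 2 * d"] j by simp
          then show False using v wD by simp
        qed
        show "v \<in> (\<lambda>j. y (2 * j)) ` I \<union> (\<lambda>j. y (2 * j + 1)) ` I"
        proof (cases "even j")
          case True
          then obtain j' where "j = 2 * j'" by blast
          then show ?thesis using v j \<open>j < 2 * d\<close> by (auto simp: I_def)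
        next
          case False
          then obtain j' where j': "j = 2 * j' + 1" by (elim oddE)
          then have "\<mu> (y (2 * j')) \<in> D" "j' < d" using pair[of j'] v j \<open>j < 2 * d\<close> by auto
          then have "j' \<in> I" using cyc_step_iff[OF pm] by (auto simp: I_def D_def)
          then show ?thesis using j' j by auto
        qed
      next
        fix v assume "v \<in> (\<lambda>j. y (2 * j)) ` I \<union> (\<lambda>j. y (2 * j + 1)) ` I"
        then obtain j where j: "j < d" "y (2 * j) \<in> D" "v = y (2 * j) \<or> v = y (2 * j + 1)"
          by (auto simp: I_def)
        then have "\<mu> (y (2 * j)) \<in> D" using cyc_step_iff[OF pm] by (simp add: D_def)
        then show "v \<in> D" using j pair[of j] by auto
      qed
      moreover have "(\<lambda>j. y (2 * j)) ` I \<inter> (\<lambda>j. y (2 * j + 1)) ` I = {}"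
      proof -
        have "y (2 * j) \<noteq> y (2 * j' + 1)" if "j < d" "j' < d" for j j'
          using that cd y_eq[of "2 * j" "2 * j' + 1"] by presburger
        then show ?thesis by (auto simp: I_def)
      qed
      moreover have "finite I" by (simp add: I_def)
      moreover have "inj_on (\<lambda>j. y (2 * j)) I" "inj_on (\<lambda>j. y (2 * j + 1)) I"
        using cd by (auto simp: inj_on_def I_def y_eq)
      ultimately have "card D = card I + card I" by (simp add: card_Un_disjoint card_image)
      moreover have "odd (card D)" unfolding D_def
        using cycle_trace_odd_cycles[OF \<mu>, of "y (2 * i)"] nz' B_sub yB by (auto simp: \<mu>_def)
      ultimately show False by simp
    qed
    have "y j \<in> cyc \<mu> w" if "j < c" for j
    proof (cases "j < 2 * d")
      case True
      show ?thesis
      proof (cases "even j")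
        case True
        then show ?thesis using claim[of "j div 2"] \<open>j < 2 * d\<close> by auto
      next
        case False
        then obtain j' where j': "j = 2 * j' + 1" by (elim oddE)
        then show ?thesis using pair[of j'] claim[of j'] True cyc_step_iff[OF pm, of "y (2 * j')" w] by auto
      qed
    next
      case False
      then show ?thesis using z_y[of "j - 2 * d"] zw[of "j - 2 * d"] that by simp
    qed
    then have "cyc \<mu> w = B" using cycB[of w] yB y_img by (auto simp: w_def B_def)
    then have cardw: "card (cyc \<mu> w) = c" by (simp add: B_def c_def)
    have z_eq: "z i = z j \<longleftrightarrow> i = j" if "i < c" "j < c" for i j
      using inj_on_cyc[OF pm, of w] that unfolding cardw z_def[symmetric] by (auto simp: inj_on_def)
    have z_c: "z c = z 0" using funpow_card_cyc[OF pm, of w] by (simp add: z_def cardw)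
    \<comment> \<open>The length of the long segment: the pairs follow in \<open>z\<close> from
      index \<open>q\<close> on.\<close>
    define q where "q = c - 2 * d"
    have q: "c = q + 2 * d" "0 < q" using cd by (auto simp: q_def)
    have step: "\<exists>h<d. z (q + 2 * i) = y (2 * h) \<and> z (q + 2 * i + 1) = y (2 * h + 1)"
      if "i < d" and zC: "z (q + 2 * i - 1) \<in> C" for i
    proof -
      obtain k where k: "k \<in> K" "z (q + 2 * i - 1) = y k" using zC unfolding C_def by blast
      have "z (q + 2 * i) = \<mu> (y k)" using z_Suc[of "q + 2 * i - 1"] k q by simp
      then obtain h where h: "h \<le> d" "z (q + 2 * i) = y (2 * h)" using \<mu>_K[OF k(1)] by auto
      \<comment> \<open>Otherwise \<open>z\<close> would return to the beginning of the long segment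
        before visiting all \<open>c\<close> positions.\<close>
      have "h \<noteq> d"
      proof
        assume "h = d"
        then have "z (q + 2 * i) = z 0" using h by (simp add: z_def w_def)
        then show False using z_eq[of "q + 2 * i" 0] q that by simp
      qed
      then have "h < d" using h by simp
      moreover have "z (q + 2 * i + 1) = y (2 * h + 1)"
        using pair[OF \<open>h < d\<close>] z_Suc[of "q + 2 * i"] h by simp
      ultimately show ?thesis using h by blast
    qed
    have "\<exists>h<d. z (q + 2 * i) = y (2 * h) \<and> z (q + 2 * i + 1) = y (2 * h + 1)" if "i < d" for i
      using that
    proof (induction i)
      case 0
      have "z (q + 2 * 0 - 1) = y (c - 1)" using z_y[of "q - 1"] q by (simp add: add.commute)
      then show ?case using 0 by (intro step) (auto simp: C_def K_def)
    next
      case (Suc i)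
      then obtain h where "h < d" "z (q + 2 * i + 1) = y (2 * h + 1)" by auto
      then show ?case using Suc.prems by (intro step) (auto simp: C_def K_def)
    qed
    then obtain h where h: "\<And>i. i < d \<Longrightarrow> h i < d" "\<And>i. i < d \<Longrightarrow> z (q + 2 * i) = y (2 * h i)"
      "\<And>i. i < d \<Longrightarrow> z (q + 2 * i + 1) = y (2 * h i + 1)" by metis
    have h_inj: "inj_on h {..<d}"
    proof (rule inj_onI)
      fix i j assume ij: "i \<in> {..<d}" "j \<in> {..<d}" "h i = h j"
      then have "z (q + 2 * i) = z (q + 2 * j)" using h by simp
      then show "i = j" using z_eq[of "q + 2 * i" "q + 2 * j"] q ij by simp
    qed
    moreover have "h ` {..<d} \<subseteq> {..<d}" using h(1) by auto
    ultimately have "bij_betw h {..<d} {..<d}" unfolding bij_betw_def using endo_inj_surj by blast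
    then have hp: "restrict_id h {..<d} permutes {..<d}" by (rule permutes_restrict_id)
    define a where "a i = y (2 * i)" for i
    define b where "b i = y (2 * i + 1)" for i
    have a_inj: "inj_on a {..<d}" and b_inj: "inj_on b {..<d}"
      using cd by (auto simp: inj_on_def a_def b_def y_eq)
    have ab: "a i \<noteq> b j" if "i < d" "j < d" for i j
      using that cd y_eq[of "2 * i" "2 * j + 1"] unfolding a_def b_def by presburger
    \<comment> \<open>The first members and the second members of the pairs are permuted alike by
      \<open>h\<close>; the two signs are equal, so the product \<open>g\<close> is even.\<close>
    define ga where "ga = map_permutation {..<d} a (restrict_id h {..<d})"
    define gb where "gb = map_permutation {..<d} b (restrict_id h {..<d})"
    define g where "g = ga \<circ> gb"
    have ga: "ga permutes a ` {..<d}" unfolding ga_def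
      using a_inj hp by (intro map_permutation_permutes) (auto simp: bij_betw_def)
    have gb: "gb permutes b ` {..<d}" unfolding gb_def
      using b_inj hp by (intro map_permutation_permutes) (auto simp: bij_betw_def)
    have sub: "a ` {..<d} \<subseteq> B" "b ` {..<d} \<subseteq> B" using yB by (auto simp: a_def b_def)
    have gaB: "ga permutes B" and gbB: "gb permutes B"
      by (rule permutes_subset[OF ga sub(1)], rule permutes_subset[OF gb sub(2)])
    have gB: "g permutes B" unfolding g_def by (rule permutes_compose[OF gbB gaB])
    have g: "g permutes {..<d*d}" using permutes_subset[OF gB B_sub] .
    have g_a: "g (a i) = a (h i)" if "i < d" for i
    proof -
      have "gb (a i) = a i" using permutes_not_in[OF gb] ab that by auto
      then show ?thesis using that a_inj by (simp add: g_def ga_def map_permutation_apply)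
    qed
    have g_b: "g (b i) = b (h i)" if "i < d" for i
    proof -
      have "gb (b i) = b (h i)" using that b_inj by (simp add: gb_def map_permutation_apply)
      moreover have "b (h i) \<notin> a ` {..<d}" using ab h(1)[OF that] by force
      ultimately show ?thesis using permutes_not_in[OF ga] by (simp add: g_def)
    qed
    have finB: "finite B" by (rule finite_subset[OF B_sub]) simp
    have "sign g = 1"
    proof -
      have "sign g = sign ga * sign gb" unfolding g_def
        using permutes_imp_permutation[OF finB] gaB gbB by (intro sign_compose) auto
      also have "sign ga = sign gb" unfolding ga_def gb_def
        using a_inj b_inj hp by (simp add: sign_map_permutation)
      finally show ?thesis by simp
    qed
    \<comment> \<open>Counted from the beginning of the long segment, \<open>g\<close> carries the
      cycle of \<open>\<nu>\<close> to that of \<open>\<mu>\<close>: it fixes the segment pointwise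
      and reorders the pairs.\<close>
    have g_y: "g (y (2 * d + i)) = z i" if i: "i < c" for i
    proof (cases "2 * d + i < c")
      case True
      have "y (2 * d + i) \<notin> a ` {..<d}" "y (2 * d + i) \<notin> b ` {..<d}"
        using True y_eq cd by (auto simp: a_def b_def)
      then have "g (y (2 * d + i)) = y (2 * d + i)"
        using permutes_not_in[OF ga] permutes_not_in[OF gb] by (simp add: g_def)
      then show ?thesis using z_y[OF True] by simp
    next
      case False
      define j where "j = i - q"
      have j: "i = q + j" "j < 2 * d" using False q i by (auto simp: j_def)
      have "y (2 * d + i) = y j" using y_c[of j] q j by (simp add: ac_simps)
      moreover have "g (y j) = z i"
      proof (cases "even j")
        case True
        then obtain j' where "j = 2 * j'" by blast
        then show ?thesis using g_a[of j'] h(2)[of j'] j by (simp add: a_def)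
      next
        case False
        then obtain j' where "j = 2 * j' + 1" by (elim oddE)
        then show ?thesis using g_b[of j'] h(3)[of j'] j by (simp add: b_def)
      qed
      ultimately show ?thesis by simp
    qed
    have comm: "g \<circ> \<nu> = \<mu> \<circ> g"
    proof
      fix v
      show "(g \<circ> \<nu>) v = (\<mu> \<circ> g) v"
      proof (cases "v \<in> B")
        case True
        then obtain j where j: "j < c" "v = y j" using y_img by (auto simp: B_def)
        obtain i where i: "i < c" "v = y (2 * d + i)"
        proof (cases "2 * d \<le> j")
          case True
          then show ?thesis using j that[of "j - 2 * d"] by simp
        next
          case False
          then show ?thesis using j that[of "j + q"] q y_c[of j] by (simp add: ac_simps)
        qed
        have "g (y (2 * d + Suc i)) = z (Suc i)"
        proof (cases "Suc i < c")
          case True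
          then show ?thesis by (rule g_y)
        next
          case False
          then have "Suc i = c" using i by simp
          then show ?thesis using g_y[of 0] y_c[of "2 * d"] z_c cd by (simp add: add.commute)
        qed
        then show ?thesis using i g_y[OF i(1)] z_Suc[of i] y_Suc by simp
      next
        case False
        then have "\<nu> v \<notin> B" using cyc_step_iff[OF p] by (simp add: B_def)
        then show ?thesis using False permutes_not_in[OF gB] permutes_not_in[OF \<tau>B] by (simp add: \<mu>_def)
      qed
    qed
    have "cycle_trace d \<nu> = cycle_trace d \<mu>" using cycle_trace_conj[OF g comm] \<open>sign g = 1\<close> by simp
    moreover have "sign \<tau> = 1"
    proof -
      have pg: "permutation g" and pt: "permutation \<tau>" using g \<tau>m permutes_imp_permutation by blast+
      \<comment> \<open>Conjugate permutations have the same sign, so the factor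
        \<open>\<tau>\<close> relating \<open>\<mu>\<close> to \<open>\<nu>\<close> is even.\<close>
      have "sign (g \<circ> \<nu>) = sign (\<mu> \<circ> g)" using comm by simp
      then have "sign \<nu> = sign \<nu> * sign \<tau>"
        using pg pt p pm \<open>sign g = 1\<close> by (simp add: sign_compose) (simp add: \<mu>_def sign_compose p pt)
      then show ?thesis by simp
    qed
    ultimately show ?thesis by (simp add: \<mu>_def)
  qed
  define N where "N = {\<tau>. \<tau> permutes C \<and> cycle_trace d (\<nu> \<circ> \<tau>) \<noteq> 0}"
  have finP: "finite {\<tau>. \<tau> permutes C}" using finC by (rule finite_permutations)
  have "(\<Sum>\<tau> | \<tau> permutes C. sign \<tau> * cycle_trace d (\<nu> \<circ> \<tau>)) =
        (\<Sum>\<tau>\<in>N. sign \<tau> * cycle_trace d (\<nu> \<circ> \<tau>))"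
    using finP by (intro sum.mono_neutral_right) (auto simp: N_def)
  also have "\<dots> = (\<Sum>\<tau>\<in>N. cycle_trace d \<nu>)"
    by (intro sum.cong refl key) (auto simp: N_def)
  finally have "int (card N) * cycle_trace d \<nu> = 0"
    using sum_cycle_trace_alternate[OF \<nu>, of C] CB B_sub cardC by auto
  moreover have "id \<in> N" using nz by (simp add: N_def permutes_id)
  moreover have "finite N" using finP by (simp add: N_def)
  ultimately show False using nz by auto
qed

text \<open>The signed count of path systems using every edge once: the position \<open>t\<close> carries the edge from
  \<open>u t\<close> to \<open>u (\<kappa> t)\<close>, except that for \<open>s \<in> S\<close> the tail \<open>u s\<close> is prescribed by \<open>a\<close>, and the head
  of the edge preceding \<open>s\<close> by \<open>b\<close>.\<close>
definition path_sum :: "nat \<Rightarrow> nat set \<Rightarrow> (nat \<Rightarrow> nat) \<Rightarrow> (nat \<Rightarrow> nat) \<Rightarrow> (nat \<Rightarrow> nat) \<Rightarrow> int" where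
  "path_sum d S \<kappa> a b = (\<Sum>c\<in>({..<d*d} - S) \<rightarrow>\<^sub>E {..<d}.
     map_sign (d*d) (\<lambda>t. merge S a c t * d + merge S b c (\<kappa> t)))"

text \<open>With \<open>b = a \<circ> \<tau>\<close>, the path that ends just before
  \<open>s\<close> continues at \<open>\<tau> s\<close>, so the paths close up to the cycles of
  \<open>\<tau> \<circ> \<kappa>\<close>.\<close>

lemma trace_path_sum:
  assumes S: "S \<subseteq> {..<d*d}" and \<tau>: "\<tau> permutes S"
  shows "(\<Sum>a\<in>S \<rightarrow>\<^sub>E {..<d}. path_sum d S \<kappa> a (a \<circ> \<tau>)) = cycle_trace d (\<tau> \<circ> \<kappa>)"
proof -
  have "{..<d*d} = S \<union> ({..<d*d} - S)" using S by auto
  then have "cycle_trace d (\<tau> \<circ> \<kappa>) = (\<Sum>u\<in>(S \<union> ({..<d*d} - S)) \<rightarrow>\<^sub>E {..<d}.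
      map_sign (d*d) (\<lambda>t. u t * d + u ((\<tau> \<circ> \<kappa>) t)))"
    unfolding cycle_trace_def by simp
  also have "\<dots> = (\<Sum>a\<in>S \<rightarrow>\<^sub>E {..<d}. \<Sum>c\<in>({..<d*d} - S) \<rightarrow>\<^sub>E {..<d}.
      map_sign (d*d) (\<lambda>t. merge S a c t * d + merge S a c ((\<tau> \<circ> \<kappa>) t)))"
    by (rule sum_PiE_Un) auto
  also have "\<dots> = (\<Sum>a\<in>S \<rightarrow>\<^sub>E {..<d}. path_sum d S \<kappa> a (a \<circ> \<tau>))"
  proof -
    have "merge S a c ((\<tau> \<circ> \<kappa>) t) = merge S (a \<circ> \<tau>) c (\<kappa> t)" for a c t
      using permutes_in_image[OF \<tau>] permutes_not_in[OF \<tau>] by (simp add: merge_def)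
    then show ?thesis unfolding path_sum_def by simp
  qed
  finally show ?thesis by simp
qed

text \<open>The path sum is a partial trace of the invariant edge matrix, so a nonzero entry yields
  a nonzero trace against some \<open>\<tau>\<close>. Conversely, a nonzero trace has a nonzero
  summand.\<close>

lemma path_sum_nonzero_iff:
  assumes S: "S \<subseteq> {..<d*d}" and \<kappa>: "\<kappa> permutes {..<d*d}"
  shows "(\<exists>a\<in>S \<rightarrow>\<^sub>E {..<d}. \<exists>b\<in>S \<rightarrow>\<^sub>E {..<d}. path_sum d S \<kappa> a b \<noteq> 0) \<longleftrightarrow>
    (\<exists>\<tau>. \<tau> permutes S \<and> cycle_trace d (\<tau> \<circ> \<kappa>) \<noteq> 0)"
proof
  assume "\<exists>a\<in>S \<rightarrow>\<^sub>E {..<d}. \<exists>b\<in>S \<rightarrow>\<^sub>E {..<d}. path_sum d S \<kappa> a b \<noteq> 0"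
  then obtain a b where ab: "a \<in> S \<rightarrow>\<^sub>E {..<d}" "b \<in> S \<rightarrow>\<^sub>E {..<d}" "path_sum d S \<kappa> a b \<noteq> 0" by blast
  have "gl_invariant d S (path_sum d S \<kappa>)"
    unfolding path_sum_def[abs_def]
    by (rule gl_invariant_partial_trace[OF finite_lessThan S gl_invariant_edges[OF \<kappa>]])
  moreover have "finite S" by (rule finite_subset[OF S]) simp
  ultimately obtain \<tau> where \<tau>: "\<tau> permutes S" "(\<Sum>u\<in>S \<rightarrow>\<^sub>E {..<d}. path_sum d S \<kappa> u (u \<circ> \<tau>)) \<noteq> 0"
    using gl_invariant_trace_nonzero[where J = "path_sum d S \<kappa>", OF _ _ ab] by blast
  then have "cycle_trace d (\<tau> \<circ> \<kappa>) \<noteq> 0" unfolding trace_path_sum[OF S \<tau>(1)] by simp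
  then show "\<exists>\<tau>. \<tau> permutes S \<and> cycle_trace d (\<tau> \<circ> \<kappa>) \<noteq> 0" using \<tau>(1) by blast
next
  assume "\<exists>\<tau>. \<tau> permutes S \<and> cycle_trace d (\<tau> \<circ> \<kappa>) \<noteq> 0"
  then obtain \<tau> where \<tau>: "\<tau> permutes S" "(\<Sum>u\<in>S \<rightarrow>\<^sub>E {..<d}. path_sum d S \<kappa> u (u \<circ> \<tau>)) \<noteq> 0"
    using trace_path_sum[OF S] by metis
  then obtain u where u: "u \<in> S \<rightarrow>\<^sub>E {..<d}" "path_sum d S \<kappa> u (u \<circ> \<tau>) \<noteq> 0"
    by (metis (no_types, lifting) sum.neutral)
  then show "\<exists>a\<in>S \<rightarrow>\<^sub>E {..<d}. \<exists>b\<in>S \<rightarrow>\<^sub>E {..<d}. path_sum d S \<kappa> a b \<noteq> 0"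
    using comp_permutes_in_PiE[OF \<tau>(1) u(1)] by blast
qed

lemma exists_cycle_trace_nonzero: "\<exists>\<nu>. \<nu> permutes {..<d*d} \<and> cycle_trace d \<nu> \<noteq> 0"
proof -
  \<comment> \<open>Every position is a start, and position \<open>t\<close> carries the edge coded
    by \<open>t\<close>, so the map whose sign is taken is the identity.\<close>
  define a where "a = (\<lambda>t\<in>{..<d*d}. t div d)"
  define b where "b = (\<lambda>t\<in>{..<d*d}. t mod d)"
  have a: "a \<in> {..<d*d} \<rightarrow>\<^sub>E {..<d}" by (auto simp: a_def less_mult_imp_div_less)
  have b: "b \<in> {..<d*d} \<rightarrow>\<^sub>E {..<d}" by (cases "d = 0") (auto simp: b_def)
  have "map_sign (d*d) (\<lambda>t. merge {..<d*d} a c t * d + merge {..<d*d} b c (id t)) = map_sign (d*d) id" for c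
    by (rule map_sign_cong) (simp add: merge_def a_def b_def)
  then have "path_sum d {..<d*d} id a b = 1"
    by (simp add: path_sum_def map_sign_permutes[OF permutes_id])
  then have "path_sum d {..<d*d} id a b \<noteq> 0" by simp
  then show ?thesis
    using path_sum_nonzero_iff[OF order.refl permutes_id, of d] a b by (auto simp: o_def)
qed

subsection \<open>Cycle types\<close>

lemma sum_card_cycles_of:
  assumes \<nu>: "\<nu> permutes {..<m}"
  shows "(\<Sum>C\<in>cycles_of \<nu> m. card C) = m"
proof -
  have p: "permutation \<nu>" using \<nu> permutes_imp_permutation by blast
  have "(\<Sum>C\<in>cycles_of \<nu> m. card C) = card (\<Union>(cycles_of \<nu> m))"
  proof (rule card_Union_disjoint[symmetric])
    show "pairwise disjnt (cycles_of \<nu> m)"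
      unfolding pairwise_def disjnt_def cycles_of_def using cyc_eq_iff[OF p] by blast
    show "\<And>C. C \<in> cycles_of \<nu> m \<Longrightarrow> finite C" using finite_cyc[OF p] by (auto simp: cycles_of_def)
  qed
  also have "\<Union>(cycles_of \<nu> m) = {..<m}"
    using cyc_subset[OF \<nu>] self_in_cyc by (fastforce simp: cycles_of_def)
  finally show ?thesis by simp
qed

lemma set_delta: "set (delta d) = (\<lambda>i. 2 * i + 1) ` {..<d}"
proof (intro equalityI subsetI)
  fix x assume "x \<in> set (delta d)"
  then obtain i where "i < d" "x = 2 * (d - i) - 1" by (auto simp: delta_def)
  then have "x = 2 * (d - i - 1) + 1" "d - i - 1 < d" by auto
  then show "x \<in> (\<lambda>i. 2 * i + 1) ` {..<d}" by blast
next
  fix x assume "x \<in> (\<lambda>i. 2 * i + 1) ` {..<d}"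
  then obtain i where i: "i < d" "x = 2 * i + 1" by auto
  then have "x = 2 * (d - (d - Suc i)) - 1" "d - Suc i < d" by auto
  then show "x \<in> set (delta d)" unfolding delta_def by auto
qed

lemma mset_delta: "mset (delta d) = mset_set ((\<lambda>i. 2 * i + 1) ` {..<d})"
proof -
  have "distinct (delta d)" by (auto simp: delta_def distinct_map inj_on_def)
  then show ?thesis using mset_set_set set_delta by metis
qed

lemma sum_odds: "(\<Sum>x\<in>(\<lambda>i. 2 * i + 1) ` {..<d}. x) = d * (d :: nat)"
proof -
  have "(\<Sum>i<d. 2 * i + 1) = d * d" by (induction d) auto
  then show ?thesis by (subst sum.reindex) (auto simp: inj_on_def)
qed

lemma cycle_trace_nonzero_imp_delta:
  assumes \<nu>: "\<nu> permutes {..<d*d}" and nz: "cycle_trace d \<nu> \<noteq> 0"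
  shows "image_mset card (mset_set (cycles_of \<nu> (d*d))) = mset (delta d)"
proof -
  let ?O = "(\<lambda>i. 2 * i + 1) ` {..<d}"
  have inj: "inj_on card (cycles_of \<nu> (d*d))"
    using cycle_trace_distinct_cycles[OF \<nu> nz] by (auto simp: inj_on_def cycles_of_def)
  have sub: "card ` cycles_of \<nu> (d*d) \<subseteq> ?O"
  proof
    fix n assume "n \<in> card ` cycles_of \<nu> (d*d)"
    then obtain x where x: "x < d * d" "n = card (cyc \<nu> x)" by (auto simp: cycles_of_def)
    then have "odd n" "n < 2 * d"
      using cycle_trace_odd_cycles[OF \<nu> nz] cycle_trace_short_cycles[OF \<nu> nz] by auto
    then obtain i where "n = 2 * i + 1" "i < d" by (auto elim: oddE)
    then show "n \<in> ?O" by blast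
  qed
  have "(\<Sum>x\<in>card ` cycles_of \<nu> (d*d). x) = d * d"
    using sum_card_cycles_of[OF \<nu>] inj by (simp add: sum.reindex)
  moreover have "(\<Sum>x\<in>?O. x) = (\<Sum>x\<in>card ` cycles_of \<nu> (d*d). x) + (\<Sum>x\<in>?O - card ` cycles_of \<nu> (d*d). x)"
    using sub by (simp add: sum.subset_diff add.commute)
  \<comment> \<open>All the odd numbers below 2d together have sum d^2, so the missing ones have sum
    0; as each is positive, none is missing.\<close>
  ultimately have "(\<Sum>x\<in>?O - card ` cycles_of \<nu> (d*d). x) = 0" using sum_odds[of d] by linarith
  then have "card ` cycles_of \<nu> (d*d) = ?O" using sub by (auto simp: sum_eq_0_iff)
  then show ?thesis using image_mset_mset_set[OF inj] mset_delta by simp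
qed

text \<open>Each cycle of \<open>\<nu>\<close> goes step by step onto the cycle of
  \<open>\<mu>\<close> of its length, unique by \<open>inj\<close>. That no two cycles of
  \<open>\<nu>\<close> share a target follows by counting, since \<open>g\<close> maps
  \<open>{..<m}\<close> onto itself.\<close>

lemma conjugate_of_cycle_type:
  assumes \<nu>: "\<nu> permutes {..<m}" and \<mu>: "\<mu> permutes {..<m}"
    and inj: "inj_on card (cycles_of \<mu> m)" and eq: "card ` cycles_of \<nu> m = card ` cycles_of \<mu> m"
  shows "\<exists>g. g permutes {..<m} \<and> g \<circ> \<nu> = \<mu> \<circ> g"
proof -
  have p: "permutation \<nu>" and pm: "permutation \<mu>" using \<nu> \<mu> permutes_imp_permutation by blast+
  define rep where "rep C = (SOME x. x \<in> C)" for C :: "nat set"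
  have rep: "rep (cyc q x) \<in> cyc q x" for q x unfolding rep_def using self_in_cyc by (rule someI)
  have "\<exists>z. z < m \<and> card (cyc \<mu> z) = card (cyc \<nu> x)" if "x < m" for x
  proof -
    have "card (cyc \<nu> x) \<in> card ` cycles_of \<nu> m" using that by (auto simp: cycles_of_def)
    then show ?thesis unfolding eq by (auto simp: cycles_of_def)
  qed
  then obtain f where f: "\<And>x. x < m \<Longrightarrow> f x < m" "\<And>x. x < m \<Longrightarrow> card (cyc \<mu> (f x)) = card (cyc \<nu> x)"
    by metis
  define r where "r x = rep (cyc \<nu> x)" for x
  define s where "s x = f (r x)" for x
  \<comment> \<open>The exponent is determined only modulo the length of the cycle; the cycle of
    \<open>s x\<close> has the same length, so \<open>g x\<close> does not depend on the
    choice.\<close>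
  define e where "e x = (SOME i. (\<nu> ^^ i) (r x) = x)" for x
  define g where "g x = (\<mu> ^^ e x) (s x)" for x
  have rc: "cyc \<nu> (r x) = cyc \<nu> x" for x using rep cyc_eq_iff[OF p] by (simp add: r_def)
  have rm: "r x < m" if "x < m" for x
    using rep cyc_subset[OF \<nu>, of x] that by (auto simp: r_def)
  have e: "(\<nu> ^^ e x) (r x) = x" for x
  proof -
    have "x \<in> cyc \<nu> (r x)" using rc self_in_cyc by blast
    then obtain i where "x = (\<nu> ^^ i) (r x)" unfolding cyc_def by blast
    from this[symmetric] show ?thesis unfolding e_def by (rule someI)
  qed
  have g: "g ((\<nu> ^^ i) x) = (\<mu> ^^ i) (s x)" if x: "x < m" "r x = x" for x i
  proof -
    let ?y = "(\<nu> ^^ i) x" and ?n = "card (cyc \<nu> x)"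
    have "cyc \<nu> ?y = cyc \<nu> x" using cyc_eq_iff[OF p] funpow_in_cyc by blast
    then have ry: "r ?y = x" using x by (simp add: r_def)
    have n: "card (cyc \<mu> (s x)) = ?n" using f x by (simp add: s_def)
    have "(\<nu> ^^ (e ?y mod ?n)) x = (\<nu> ^^ (i mod ?n)) x"
      using e[of ?y] ry funpow_mod_eq[OF funpow_card_cyc[OF p]] by simp
    then have "e ?y mod ?n = i mod ?n"
      using inj_on_cyc[OF p, of x] card_cyc_pos[OF p, of x] by (auto simp: inj_on_def)
    then have "(\<mu> ^^ e ?y) (s x) = (\<mu> ^^ i) (s x)"
      using funpow_mod_eq[OF funpow_card_cyc[OF pm], of _ "s x"] unfolding n by metis
    then show ?thesis using ry x by (simp add: g_def s_def)
  qed
  have rr: "r (r x) = r x" for x using rc by (simp add: r_def)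
  have g_step: "g (\<nu> x) = \<mu> (g x)" if "x < m" for x
    using g[OF rm[OF that] rr, of "e x"] g[OF rm[OF that] rr, of "Suc (e x)"] e[of x] by simp
  have g_img: "g ` {..<m} = {..<m}"
  proof (intro equalityI subsetI)
    fix z assume "z \<in> g ` {..<m}"
    then obtain x where x: "x < m" "z = g x" by auto
    have "s x < m" using f rm x by (simp add: s_def)
    then show "z \<in> {..<m}" using cyc_subset[OF \<mu>, of "s x"] funpow_in_cyc x by (auto simp: g_def)
  next
    fix z assume z: "z \<in> {..<m}"
    then have "card (cyc \<mu> z) \<in> card ` cycles_of \<nu> m" unfolding eq by (auto simp: cycles_of_def)
    then obtain x where x: "x < m" "card (cyc \<nu> x) = card (cyc \<mu> z)" by (auto simp: cycles_of_def)
    have "card (cyc \<mu> (s x)) = card (cyc \<mu> z)" using f(2)[OF rm[OF x(1)]] x rc by (simp add: s_def)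
    moreover have "s x < m" using f rm x by (simp add: s_def)
    ultimately have "cyc \<mu> (s x) = cyc \<mu> z" using inj z by (auto simp: inj_on_def cycles_of_def)
    then obtain i where i: "z = (\<mu> ^^ i) (s x)" using self_in_cyc[of z \<mu>] by (auto simp: cyc_def)
    have "s (r x) = s x" by (simp add: s_def rr)
    then have "z = g ((\<nu> ^^ i) (r x))" using g[OF rm[OF x(1)] rr, of i] i by simp
    moreover have "(\<nu> ^^ i) (r x) < m"
      using cyc_subset[OF \<nu>, of "r x"] rm[OF x(1)] funpow_in_cyc by blast
    ultimately show "z \<in> g ` {..<m}" by blast
  qed
  then have "bij_betw g {..<m} {..<m}" by (simp add: bij_betw_def eq_card_imp_inj_on)
  then have "restrict_id g {..<m} permutes {..<m}" by (rule permutes_restrict_id)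
  moreover have "restrict_id g {..<m} \<circ> \<nu> = \<mu> \<circ> restrict_id g {..<m}"
  proof
    fix x show "(restrict_id g {..<m} \<circ> \<nu>) x = (\<mu> \<circ> restrict_id g {..<m}) x"
      using g_step permutes_in_image[OF \<nu>, of x] permutes_not_in[OF \<nu>, of x] permutes_not_in[OF \<mu>, of x]
      by (cases "x \<in> {..<m}") auto
  qed
  ultimately show ?thesis by blast
qed

text \<open>For the converse: permutations of this cycle type are conjugate, so their values agree
  up to sign, and one of these values is known to be nonzero.\<close>

theorem cycle_trace_nonzero_iff:
  assumes \<nu>: "\<nu> permutes {..<d*d}"
  shows "cycle_trace d \<nu> \<noteq> 0 \<longleftrightarrow> image_mset card (mset_set (cycles_of \<nu> (d*d))) = mset (delta d)"
proof
  show "image_mset card (mset_set (cycles_of \<nu> (d*d))) = mset (delta d)" if "cycle_trace d \<nu> \<noteq> 0"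
    using cycle_trace_nonzero_imp_delta[OF \<nu> that] .
next
  assume type: "image_mset card (mset_set (cycles_of \<nu> (d*d))) = mset (delta d)"
  obtain \<mu> where \<mu>: "\<mu> permutes {..<d*d}" "cycle_trace d \<mu> \<noteq> 0" using exists_cycle_trace_nonzero by blast
  have eq: "image_mset card (mset_set (cycles_of \<nu> (d*d))) = image_mset card (mset_set (cycles_of \<mu> (d*d)))"
    using type cycle_trace_nonzero_imp_delta[OF \<mu>] by simp
  have "card ` cycles_of \<nu> (d*d) = card ` cycles_of \<mu> (d*d)"
    using arg_cong[OF eq, of set_mset] by (simp add: cycles_of_def)
  moreover have "inj_on card (cycles_of \<mu> (d*d))"
    using cycle_trace_distinct_cycles[OF \<mu>] by (auto simp: inj_on_def cycles_of_def)
  ultimately obtain g where "g permutes {..<d*d}" "g \<circ> \<nu> = \<mu> \<circ> g"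
    using conjugate_of_cycle_type[OF \<nu> \<mu>(1)] by blast
  then have "cycle_trace d \<nu> = sign g * cycle_trace d \<mu>" by (rule cycle_trace_conj)
  then show "cycle_trace d \<nu> \<noteq> 0" using \<mu>(2) by simp
qed

subsection \<open>The blocks of a composition\<close>

definition start :: "nat list \<Rightarrow> nat \<Rightarrow> nat" where
  "start lam j = sum_list (take j lam)"

definition starts :: "nat list \<Rightarrow> nat set" where
  "starts lam = start lam ` {..<length lam}"

definition block_of :: "nat list \<Rightarrow> nat \<Rightarrow> nat" where
  "block_of lam t = (LEAST j. t < start lam (Suc j))"

text \<open>Closing each block up cyclically gives a permutation. The head of the last edge of a
  block is then stored at the start of that block, where \<open>path_sum\<close> reads the value
  prescribed by \<open>b\<close>.\<close>

definition next_in_block :: "nat list \<Rightarrow> nat \<Rightarrow> nat" where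
  "next_in_block lam t = (if t < sum_list lam then
     if Suc t = start lam (Suc (block_of lam t)) then start lam (block_of lam t) else Suc t else t)"

lemma start_0 [simp]: "start lam 0 = 0"
  by (simp add: start_def)

lemma start_Suc: "j < length lam \<Longrightarrow> start lam (Suc j) = start lam j + lam ! j"
  by (simp add: start_def take_Suc_conv_app_nth)

lemma start_length [simp]: "start lam (length lam) = sum_list lam"
  by (simp add: start_def)

lemma start_mono: "i \<le> j \<Longrightarrow> start lam i \<le> start lam j"
proof -
  assume "i \<le> j"
  then have "take j lam = take i lam @ take (j - i) (drop i lam)" by (metis le_add_diff_inverse take_add)
  then show ?thesis by (simp add: start_def)
qed

lemma start_le: "start lam j \<le> sum_list lam"
proof -
  have "sum_list lam = sum_list (take j lam) + sum_list (drop j lam)"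
    by (metis append_take_drop_id sum_list_append)
  then show ?thesis by (simp add: start_def)
qed

lemma start_append: "j \<le> length lam \<Longrightarrow> start (lam @ mu) j = start lam j"
  by (simp add: start_def)

lemma start_append_replicate:
  "i \<le> r \<Longrightarrow> start (lam @ replicate r 1) (length lam + i) = sum_list lam + i"
  by (simp add: start_def sum_list_replicate min_def)

lemma starts_append_replicate: "starts (lam @ replicate r 1) = starts lam \<union> {sum_list lam..<sum_list lam + r}"
proof -
  have "{..<length (lam @ replicate r 1)} = {..<length lam} \<union> (\<lambda>i. length lam + i) ` {..<r}"
  proof (intro equalityI subsetI)
    fix j assume "j \<in> {..<length (lam @ replicate r 1)}"
    then show "j \<in> {..<length lam} \<union> (\<lambda>i. length lam + i) ` {..<r}"
      by (cases "j < length lam") (auto intro!: image_eqI[of _ _ "j - length lam"])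
  qed auto
  then have "starts (lam @ replicate r 1) = start (lam @ replicate r 1) ` {..<length lam} \<union>
      (\<lambda>i. start (lam @ replicate r 1) (length lam + i)) ` {..<r}"
    unfolding starts_def by (simp only: image_Un image_image)
  also have "start (lam @ replicate r 1) ` {..<length lam} = starts lam"
    unfolding starts_def by (intro image_cong) (auto simp: start_append)
  also have "(\<lambda>i. start (lam @ replicate r 1) (length lam + i)) ` {..<r} = (\<lambda>i. i + sum_list lam) ` {0..<r}"
    by (intro image_cong) (auto simp: start_append_replicate[unfolded One_nat_def])
  also have "\<dots> = {sum_list lam..<sum_list lam + r}" unfolding image_add_atLeastLessThan' by (simp add: add.commute)
  finally show ?thesis .
qed

lemma block_of_eqI:
  assumes "start lam j \<le> t" "t < start lam (Suc j)"
  shows "block_of lam t = j"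
  unfolding block_of_def
proof (rule Least_equality)
  show "t < start lam (Suc j)" by fact
  show "j \<le> i" if "t < start lam (Suc i)" for i
  proof (rule ccontr)
    assume "\<not> j \<le> i"
    then have "start lam (Suc i) \<le> start lam j" by (intro start_mono) auto
    then show False using that assms by simp
  qed
qed

lemma block_of_bounds:
  assumes "t < sum_list lam"
  shows "block_of lam t < length lam" "start lam (block_of lam t) \<le> t" "t < start lam (Suc (block_of lam t))"
proof -
  have ne: "lam \<noteq> []" using assms by auto
  have ex: "t < start lam (Suc (length lam - 1))" using assms ne by simp
  show 1: "t < start lam (Suc (block_of lam t))" unfolding block_of_def using ex by (rule LeastI)
  have "block_of lam t \<le> length lam - 1" unfolding block_of_def using ex by (rule Least_le)
  then show "block_of lam t < length lam" using ne by (cases lam) auto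
  show "start lam (block_of lam t) \<le> t"
  proof (cases "block_of lam t")
    case (Suc i)
    then have "i < (LEAST j. t < start lam (Suc j))" by (simp add: block_of_def)
    then have "\<not> t < start lam (Suc i)" by (rule not_less_Least)
    then show ?thesis using Suc by simp
  qed simp
qed

lemma block_of_append:
  assumes "t < sum_list lam"
  shows "block_of (lam @ mu) t = block_of lam t"
  using block_of_bounds[OF assms] by (intro block_of_eqI) (auto simp: start_append)

text \<open>A block of length 1 is a fixed point, and so is, by the default value, every position
  beyond the blocks.\<close>

lemma next_in_block_append_replicate: "next_in_block (lam @ replicate r 1) = next_in_block lam"
proof
  fix t
  consider "t < sum_list lam" | "sum_list lam \<le> t" "t < sum_list lam + r" | "sum_list lam + r \<le> t" by linarith
  then show "next_in_block (lam @ replicate r 1) t = next_in_block lam t"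
  proof cases
    case 1
    then show ?thesis using block_of_bounds[OF 1]
      by (simp add: next_in_block_def block_of_append start_append)
  next
    case 2
    define i where "i = t - sum_list lam"
    have i: "t = sum_list lam + i" "i < r" using 2 by (auto simp: i_def)
    have s: "start (lam @ replicate r 1) (length lam + i) = t"
      "start (lam @ replicate r 1) (Suc (length lam + i)) = Suc t"
      using i start_append_replicate[of i r lam] start_append_replicate[of "Suc i" r lam] by auto
    then have "block_of (lam @ replicate r 1) t = length lam + i" by (intro block_of_eqI) auto
    then show ?thesis using 2 s by (simp add: next_in_block_def)
  next
    case 3
    then show ?thesis by (simp add: next_in_block_def sum_list_replicate)
  qed
qed

context
  fixes lam :: "nat list"
  assumes pos: "\<forall>x\<in>set lam. 0 < x"
begin

lemma start_less: "j < length lam \<Longrightarrow> start lam j < start lam (Suc j)"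
  using pos by (simp add: start_Suc)

lemma block_of_start: "j < length lam \<Longrightarrow> block_of lam (start lam j) = j"
  by (rule block_of_eqI) (auto intro: start_less)

lemma start_less_sum_list: "j < length lam \<Longrightarrow> start lam j < sum_list lam"
  using start_less[of j] start_le[of lam "Suc j"] by linarith

lemma inj_on_start: "inj_on (start lam) {..<length lam}"
  by (rule inj_on_inverseI[of _ "block_of lam"]) (simp add: block_of_start)

lemma starts_subset: "starts lam \<subseteq> {..<sum_list lam}"
  using start_less_sum_list by (auto simp: starts_def)

lemma mem_starts_iff:
  assumes "t < sum_list lam"
  shows "t \<in> starts lam \<longleftrightarrow> start lam (block_of lam t) = t"
  using block_of_bounds(1)[OF assms] block_of_start by (force simp: starts_def)

lemma next_in_block_permutes: "next_in_block lam permutes {..<sum_list lam}"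
proof (rule bij_imp_permutes)
  have sub: "next_in_block lam ` {..<sum_list lam} \<subseteq> {..<sum_list lam}"
  proof
    fix t' assume "t' \<in> next_in_block lam ` {..<sum_list lam}"
    then obtain t where t: "t < sum_list lam" "t' = next_in_block lam t" by auto
    then show "t' \<in> {..<sum_list lam}"
      using block_of_bounds[OF t(1)] start_less_sum_list start_le[of lam "Suc (block_of lam t)"]
      by (auto simp: next_in_block_def)
  qed
  have "{..<sum_list lam} \<subseteq> next_in_block lam ` {..<sum_list lam}"
  proof
    fix t assume "t \<in> {..<sum_list lam}"
    then have t: "t < sum_list lam" by simp
    define j where "j = block_of lam t"
    have j: "j < length lam" "start lam j \<le> t" "t < start lam (Suc j)"
      using block_of_bounds[OF t] by (auto simp: j_def)
    show "t \<in> next_in_block lam ` {..<sum_list lam}"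
    proof (cases "start lam j = t")
      case True
      \<comment> \<open>In the cyclic order, the start of block \<open>j\<close> is preceded by the
        last position of the same block.\<close>
      define s where "s = start lam (Suc j) - 1"
      have s: "start lam j \<le> s" "s < start lam (Suc j)" "Suc s = start lam (Suc j)"
        using start_less[OF j(1)] by (auto simp: s_def)
      have "block_of lam s = j" using s by (intro block_of_eqI)
      moreover have "s < sum_list lam" using s start_le[of lam "Suc j"] by linarith
      ultimately have "next_in_block lam s = t" using s True by (simp add: next_in_block_def)
      then show ?thesis using \<open>s < sum_list lam\<close> by blast
    next
      case False
      then have s: "start lam j \<le> t - 1" "t - 1 < start lam (Suc j)" "Suc (t - 1) = t" using j by auto
      have "block_of lam (t - 1) = j" using s by (intro block_of_eqI)
      then have "next_in_block lam (t - 1) = t" using s t j by (auto simp: next_in_block_def)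
      moreover have "t - 1 < sum_list lam" using t by simp
      ultimately show ?thesis by (metis imageI lessThan_iff)
    qed
  qed
  with sub have "next_in_block lam ` {..<sum_list lam} = {..<sum_list lam}" by blast
  then show "bij_betw (next_in_block lam) {..<sum_list lam} {..<sum_list lam}"
    by (simp add: bij_betw_def eq_card_imp_inj_on)
qed (simp add: next_in_block_def)

text \<open>\<open>\<nu>\<close> runs through a block and then jumps to the start of the block
  chosen by \<open>\<tau>\<close>. So its cycles are the unions of the blocks along the cycles of
  \<open>\<tau>\<close>, and their lengths are sums of parts.\<close>

lemma cycle_type_glued_blocks:
  assumes \<tau>: "\<tau> permutes {..<length lam}"
  defines "\<nu> \<equiv> map_permutation {..<length lam} (start lam) \<tau> \<circ> next_in_block lam"
  shows "image_mset card (mset_set (cycles_of \<nu> (sum_list lam))) =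
         image_mset (\<lambda>C. \<Sum>i\<in>C. lam ! i) (mset_set (cycles_of \<tau> (length lam)))"
proof -
  let ?n = "length lam" and ?k = "sum_list lam"
  define \<tau>' where "\<tau>' = map_permutation {..<?n} (start lam) \<tau>"
  have \<tau>': "\<tau>' permutes starts lam" unfolding \<tau>'_def starts_def
    using inj_on_start \<tau> by (intro map_permutation_permutes) (auto simp: bij_betw_def)
  have \<tau>'_start: "\<tau>' (start lam j) = start lam (\<tau> j)" if "j < ?n" for j
    unfolding \<tau>'_def using map_permutation_apply[OF inj_on_start] that by simp
  have \<nu>: "\<nu> permutes {..<?k}"
    unfolding \<nu>_def \<tau>'_def[symmetric]
    using permutes_compose[OF next_in_block_permutes permutes_subset[OF \<tau>' starts_subset]] .
  have p: "permutation \<nu>" and pt: "permutation \<tau>" using \<nu> \<tau> permutes_imp_permutation by blast+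
  have \<tau>n: "\<tau> j < ?n \<longleftrightarrow> j < ?n" for j using permutes_in_image[OF \<tau>, of j] by simp
  have \<nu>_last: "\<nu> t = start lam (\<tau> (block_of lam t))"
    if "t < ?k" "Suc t = start lam (Suc (block_of lam t))" for t
    using that block_of_bounds(1)[OF that(1)] \<tau>'_start
    by (simp add: \<nu>_def \<tau>'_def[symmetric] next_in_block_def)
  have \<nu>_inner: "\<nu> t = Suc t \<and> block_of lam (Suc t) = block_of lam t \<and> Suc t < ?k"
    if t: "t < ?k" and ne: "Suc t \<noteq> start lam (Suc (block_of lam t))" for t
  proof -
    note b = block_of_bounds[OF t]
    have bs: "block_of lam (Suc t) = block_of lam t" using b ne by (intro block_of_eqI) auto
    have lt: "Suc t < ?k" using b(3) ne start_le[of lam "Suc (block_of lam t)"] by linarith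
    have "Suc t \<notin> starts lam" using mem_starts_iff[OF lt] bs b by auto
    then have "\<tau>' (Suc t) = Suc t" using permutes_not_in[OF \<tau>'] by blast
    then show ?thesis using t ne bs lt by (simp add: \<nu>_def \<tau>'_def[symmetric] next_in_block_def)
  qed
  define U where "U C = {t. t < ?k \<and> block_of lam t \<in> C}" for C
  have U_eq: "U C = (\<Union>j\<in>C. {start lam j..<start lam (Suc j)})" if "C \<subseteq> {..<?n}" for C
  proof (intro equalityI subsetI)
    fix t assume "t \<in> U C"
    then have "t < ?k" "block_of lam t \<in> C" by (auto simp: U_def)
    then show "t \<in> (\<Union>j\<in>C. {start lam j..<start lam (Suc j)})" using block_of_bounds[of t lam] by auto
  next
    fix t assume "t \<in> (\<Union>j\<in>C. {start lam j..<start lam (Suc j)})"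
    then obtain j where j: "j \<in> C" "start lam j \<le> t" "t < start lam (Suc j)" by auto
    then have "block_of lam t = j" by (intro block_of_eqI)
    then show "t \<in> U C" using j start_le[of lam "Suc j"] by (simp add: U_def)
  qed
  have in_block: "start lam j + i \<in> cyc \<nu> (start lam j)" if "j < ?n" "i < lam ! j" for i j
    using that(2)
  proof (induction i)
    case 0
    then show ?case by (simp add: self_in_cyc)
  next
    case (Suc i)
    let ?t = "start lam j + i"
    have b: "block_of lam ?t = j" using Suc.prems that by (intro block_of_eqI) (auto simp: start_Suc)
    have "?t < ?k" using Suc.prems that start_le[of lam "Suc j"] by (simp add: start_Suc)
    then have "\<nu> ?t = Suc ?t" using \<nu>_inner[of ?t] b Suc.prems that by (simp add: start_Suc)
    then show ?case using Suc cyc_step_iff[OF p, of ?t "start lam j"] by simp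
  qed
  have cyc_block: "cyc \<nu> t = cyc \<nu> (start lam (block_of lam t))" if "t < ?k" for t
  proof -
    have "start lam (block_of lam t) + (t - start lam (block_of lam t)) \<in> cyc \<nu> (start lam (block_of lam t))"
      using block_of_bounds[OF that] by (intro in_block) (auto simp: start_Suc)
    then show ?thesis using block_of_bounds[OF that] cyc_eq_iff[OF p] by simp
  qed
  have cyc_start: "cyc \<nu> (start lam (\<tau> j)) = cyc \<nu> (start lam j)" if j: "j < ?n" for j
  proof -
    define t where "t = start lam (Suc j) - 1"
    have t: "start lam j \<le> t" "t < start lam (Suc j)" "Suc t = start lam (Suc j)"
      using start_less[OF j] by (auto simp: t_def)
    have b: "block_of lam t = j" using t by (intro block_of_eqI)
    have lt: "t < ?k" using t start_le[of lam "Suc j"] by linarith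
    have "\<nu> t = start lam (\<tau> j)" using \<nu>_last[OF lt] b t by simp
    then have "start lam (\<tau> j) \<in> cyc \<nu> t" using cyc_step_iff[OF p, of t t] self_in_cyc by simp
    then show ?thesis using cyc_block[OF lt] b cyc_eq_iff[OF p] by simp
  qed
  have cyc_U: "cyc \<nu> t = U (cyc \<tau> (block_of lam t))" if t: "t < ?k" for t
  proof (intro equalityI subsetI)
    fix v assume "v \<in> cyc \<nu> t"
    moreover have "(\<nu> ^^ i) t < ?k \<and> block_of lam ((\<nu> ^^ i) t) \<in> cyc \<tau> (block_of lam t)" for i
    proof (induction i)
      case 0
      then show ?case using t by (simp add: self_in_cyc)
    next
      case (Suc i)
      let ?v = "(\<nu> ^^ i) t"
      have "\<nu> ?v < ?k" using permutes_in_image[OF \<nu>, of ?v] Suc by simp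
      moreover have "block_of lam (\<nu> ?v) \<in> cyc \<tau> (block_of lam t)"
      proof (cases "Suc ?v = start lam (Suc (block_of lam ?v))")
        case True
        then have "\<nu> ?v = start lam (\<tau> (block_of lam ?v))" using \<nu>_last Suc by blast
        then have "block_of lam (\<nu> ?v) = \<tau> (block_of lam ?v)"
          using block_of_start \<tau>n block_of_bounds(1)[of ?v] Suc by simp
        then show ?thesis using Suc cyc_step_iff[OF pt] by simp
      next
        case False
        then show ?thesis using \<nu>_inner[of ?v] Suc by simp
      qed
      ultimately show ?case by simp
    qed
    ultimately show "v \<in> U (cyc \<tau> (block_of lam t))" by (auto simp: U_def cyc_def)
  next
    fix v assume "v \<in> U (cyc \<tau> (block_of lam t))"
    then obtain i where v: "v < ?k" "block_of lam v = (\<tau> ^^ i) (block_of lam t)" by (auto simp: U_def cyc_def)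
    have "(\<tau> ^^ i) (block_of lam t) < ?n \<and>
      cyc \<nu> (start lam ((\<tau> ^^ i) (block_of lam t))) = cyc \<nu> (start lam (block_of lam t))" for i
      by (induction i) (use block_of_bounds(1)[OF t] \<tau>n cyc_start in auto)
    then have "cyc \<nu> v = cyc \<nu> t" using cyc_block[OF t] cyc_block[OF v(1)] v(2) by simp
    then show "v \<in> cyc \<nu> t" using self_in_cyc by blast
  qed
  have cyc_n: "C \<subseteq> {..<?n}" if "C \<in> cycles_of \<tau> ?n" for C
    using that cyc_subset[OF \<tau>] by (auto simp: cycles_of_def)
  have cycles: "cycles_of \<nu> ?k = U ` cycles_of \<tau> ?n"
  proof (intro equalityI subsetI)
    fix C assume "C \<in> cycles_of \<nu> ?k"
    then show "C \<in> U ` cycles_of \<tau> ?n" using cyc_U block_of_bounds(1) by (auto simp: cycles_of_def)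
  next
    fix C assume "C \<in> U ` cycles_of \<tau> ?n"
    then obtain j where j: "j < ?n" "C = U (cyc \<tau> j)" by (auto simp: cycles_of_def)
    then have "C = cyc \<nu> (start lam j)"
      using cyc_U[OF start_less_sum_list[OF j(1)]] block_of_start[OF j(1)] by simp
    then show "C \<in> cycles_of \<nu> ?k" using start_less_sum_list[OF j(1)] by (auto simp: cycles_of_def)
  qed
  have inj: "inj_on U (cycles_of \<tau> ?n)"
  proof (rule inj_on_inverseI[of _ "\<lambda>T. block_of lam ` T"])
    fix C assume "C \<in> cycles_of \<tau> ?n"
    then have C: "C \<subseteq> {..<?n}" by (rule cyc_n)
    show "block_of lam ` U C = C"
    proof (intro equalityI subsetI)
      fix j assume j: "j \<in> C"
      then have "start lam j \<in> U C" using C block_of_start start_less_sum_list by (auto simp: U_def)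
      then show "j \<in> block_of lam ` U C" using j C block_of_start by (metis imageI lessThan_iff subsetD)
    qed (auto simp: U_def)
  qed
  have card_U: "card (U C) = (\<Sum>i\<in>C. lam ! i)" if "C \<in> cycles_of \<tau> ?n" for C
  proof -
    have C: "C \<subseteq> {..<?n}" using cyc_n[OF that] .
    have "card (U C) = (\<Sum>i\<in>C. card {start lam i..<start lam (Suc i)})"
      unfolding U_eq[OF C]
    proof (rule card_UN_disjoint)
      show "finite C" using C finite_subset by blast
      show "\<forall>i\<in>C. \<forall>j\<in>C. i \<noteq> j \<longrightarrow> {start lam i..<start lam (Suc i)} \<inter> {start lam j..<start lam (Suc j)} = {}"
        using block_of_eqI[of lam] by (metis atLeastLessThan_iff disjoint_iff)
    qed simp
    also have "\<dots> = (\<Sum>i\<in>C. lam ! i)" using C by (intro sum.cong) (auto simp: start_Suc)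
    finally show ?thesis .
  qed
  have "image_mset card (mset_set (cycles_of \<nu> ?k)) = image_mset (\<lambda>C. card (U C)) (mset_set (cycles_of \<tau> ?n))"
    unfolding cycles image_mset_mset_set[OF inj, symmetric] by (simp add: multiset.map_comp comp_def)
  also have "\<dots> = image_mset (\<lambda>C. \<Sum>i\<in>C. lam ! i) (mset_set (cycles_of \<tau> ?n))"
    by (intro image_mset_cong card_U) (simp add: cycles_of_def)
  finally show ?thesis .
qed

lemma permutes_starts_iff:
  "\<sigma> permutes starts lam \<longleftrightarrow>
    (\<exists>\<tau>. \<tau> permutes {..<length lam} \<and> \<sigma> = map_permutation {..<length lam} (start lam) \<tau>)"
proof
  have bij: "bij_betw (start lam) {..<length lam} (starts lam)"
    using inj_on_start by (simp add: bij_betw_def starts_def)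
  show "\<sigma> permutes starts lam"
    if "\<exists>\<tau>. \<tau> permutes {..<length lam} \<and> \<sigma> = map_permutation {..<length lam} (start lam) \<tau>"
    using that map_permutation_permutes[OF bij] by blast
  assume \<sigma>: "\<sigma> permutes starts lam"
  have bij': "bij_betw (block_of lam) (starts lam) {..<length lam}"
    by (rule bij_betw_byWitness[of _ "start lam"]) (auto simp: starts_def block_of_start)
  have "map_permutation {..<length lam} (start lam) (map_permutation (starts lam) (block_of lam) \<sigma>) = \<sigma>"
    by (rule map_permutation_compose_inv[OF bij' \<sigma>]) (auto simp: starts_def block_of_start)
  then show "\<exists>\<tau>. \<tau> permutes {..<length lam} \<and> \<sigma> = map_permutation {..<length lam} (start lam) \<tau>"
    using map_permutation_permutes[OF bij' \<sigma>] by metis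
qed

end

section \<open>Refinements of the partition \<open>delta d\<close>\<close>

lemma sorted_rev_delta: "sorted (rev (delta d))"
  unfolding delta_def sorted_wrt_rev sorted_wrt_map
  by (auto simp: sorted_wrt_iff_nth_less intro!: diff_le_mono mult_le_mono)

text \<open>Both lists are non-increasing, so they agree as soon as their multisets do.\<close>

lemma perm_part_eq_delta_iff:
  "perm_part \<tau> mu = delta d \<longleftrightarrow>
    image_mset (\<lambda>C. \<Sum>i\<in>C. mu ! i) (mset_set (cycles_of \<tau> (length mu))) = mset (delta d)"
  (is "_ \<longleftrightarrow> ?M = _")
proof
  assume "perm_part \<tau> mu = delta d"
  then have "mset (delta d) = mset (rev (sorted_list_of_multiset ?M))" by (simp add: perm_part_def)
  then show "?M = mset (delta d)" by simp
next
  assume "?M = mset (delta d)"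
  then have "perm_part \<tau> mu = rev (sort (delta d))"
    by (simp add: perm_part_def sorted_list_of_multiset_mset)
  also have "sort (delta d) = rev (delta d)" using sorted_rev_delta by (intro properties_for_sort) auto
  finally show "perm_part \<tau> mu = delta d" by simp
qed

lemma is_refinement_delta_iff:
  assumes pos: "\<forall>x\<in>set mu. 0 < x" and sum: "sum_list mu = d * d"
  shows "is_refinement mu (delta d) \<longleftrightarrow>
    (\<exists>\<sigma>. \<sigma> permutes starts mu \<and> cycle_trace d (\<sigma> \<circ> next_in_block mu) \<noteq> 0)"
proof -
  have "perm_part \<tau> mu = delta d \<longleftrightarrow>
      cycle_trace d (map_permutation {..<length mu} (start mu) \<tau> \<circ> next_in_block mu) \<noteq> 0"
    if \<tau>: "\<tau> permutes {..<length mu}" for \<tau>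
  proof -
    have "map_permutation {..<length mu} (start mu) \<tau> permutes starts mu"
      using permutes_starts_iff[OF pos] \<tau> by blast
    then have "map_permutation {..<length mu} (start mu) \<tau> \<circ> next_in_block mu permutes {..<d*d}"
      using permutes_compose[OF next_in_block_permutes[OF pos] permutes_subset[OF _ starts_subset[OF pos]]] sum
      by simp
    from cycle_trace_nonzero_iff[OF this] show ?thesis
      using cycle_type_glued_blocks[OF pos \<tau>] sum by (simp add: perm_part_eq_delta_iff)
  qed
  then show ?thesis unfolding is_refinement_def using permutes_starts_iff[OF pos] by metis
qed

text \<open>All parts are at least 1, so sorting leaves the appended ones at the end.\<close>

lemma psum_replicate_1:
  assumes "is_partition lam k"
  shows "psum lam (replicate r 1) = lam @ replicate r 1"
proof -
  have "\<forall>x\<in>set lam. 1 \<le> x" "sorted_wrt (\<ge>) lam" using assms by (auto simp: is_partition_def)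
  moreover have "sorted_wrt (\<ge>) (replicate r (1 :: nat))" by (induction r) auto
  ultimately have "sorted_wrt (\<ge>) (lam @ replicate r 1)"
    by (auto simp: sorted_wrt_append)
  then have "sorted (rev (lam @ replicate r 1))" unfolding sorted_wrt_rev .
  then have "sort (lam @ replicate r 1) = rev (lam @ replicate r 1)"
    by (intro properties_for_sort) auto
  then show ?thesis unfolding psum_def by simp
qed

subsection \<open>Evaluation of the alternated tensor\<close>

text \<open>The coefficients of \<open>ST\<close> collect the permutations by the words that they
  produce; summing over the fibres undoes this. Words whose coefficient is 0 may be included
  freely.\<close>

lemma tensor_eval_coord_ST:
  "tensor_eval_coord d (length lam) (ST lam) A is ls =
    (\<Sum>\<sigma> | \<sigma> permutes {..<sum_list lam}. of_int (sign \<sigma>) *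
       (\<Prod>j<length lam. mat_word d A (map \<sigma> [start lam j..<start lam (Suc j)]) $$ (is ! j, ls ! j)))"
proof -
  define P where "P = {\<sigma>. \<sigma> permutes {..<sum_list lam}}"
  define w where "w \<sigma> = map (map \<sigma>) (blocks lam)" for \<sigma> :: "nat \<Rightarrow> nat"
  define F where "F ws = (\<Prod>j<length lam. mat_word d A (ws ! j) $$ (is ! j, ls ! j))" for ws
  have Fw: "F (w \<sigma>) = (\<Prod>j<length lam. mat_word d A (map \<sigma> [start lam j..<start lam (Suc j)]) $$ (is ! j, ls ! j))" for \<sigma>
    unfolding F_def w_def by (intro prod.cong) (auto simp: blocks_def start_def)
  have finP: "finite P" by (simp add: P_def finite_permutations)
  have ST: "ST lam ws = (\<Sum>\<sigma> | \<sigma> \<in> P \<and> w \<sigma> = ws. of_int (sign \<sigma>) :: 'a)" for ws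
    unfolding ST_def P_def w_def by (intro sum.cong) auto
  have sub: "{ws. (ST lam ws :: 'a) \<noteq> 0} \<subseteq> w ` P"
  proof
    fix ws assume "ws \<in> {ws. (ST lam ws :: 'a) \<noteq> 0}"
    then have ne: "ST lam ws \<noteq> (0 :: 'a)" by simp
    have "{\<sigma>. \<sigma> \<in> P \<and> w \<sigma> = ws} \<noteq> {}"
    proof
      assume "{\<sigma>. \<sigma> \<in> P \<and> w \<sigma> = ws} = {}"
      then have "(ST lam ws :: 'a) = 0" unfolding ST by (simp only: sum.empty)
      with ne show False ..
    qed
    then show "ws \<in> w ` P" by blast
  qed
  have "tensor_eval_coord d (length lam) (ST lam) A is ls = (\<Sum>ws\<in>w ` P. ST lam ws * F ws)"
    unfolding tensor_eval_coord_def F_def[symmetric]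
    using finP sub by (intro sum.mono_neutral_left) auto
  also have "\<dots> = (\<Sum>ws\<in>w ` P. \<Sum>\<sigma> | \<sigma> \<in> P \<and> w \<sigma> = ws. of_int (sign \<sigma>) * F (w \<sigma>))"
    unfolding ST sum_distrib_right by (intro sum.cong) auto
  also have "\<dots> = (\<Sum>\<sigma>\<in>P. of_int (sign \<sigma>) * F (w \<sigma>))"
    using sum.image_gen[OF finP, of "\<lambda>\<sigma>. of_int (sign \<sigma>) * F (w \<sigma>)" w] by simp
  finally show ?thesis unfolding P_def Fw .
qed

section \<open>Entries of matrix words as sums over paths\<close>

lemma sum_PiE_insert:
  assumes "x \<notin> B"
  shows "(\<Sum>u\<in>insert x B \<rightarrow>\<^sub>E D. h u) = (\<Sum>y\<in>D. \<Sum>c\<in>B \<rightarrow>\<^sub>E D. h (c(x := y)))"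
  unfolding sum.cartesian_product
proof (rule sum.reindex_bij_witness[where i = "\<lambda>(y, c). c(x := y)" and j = "\<lambda>u. (u x, restrict u B)"], goal_cases)
  case (1 u)
  then show ?case using assms by (auto simp: PiE_iff extensional_def fun_eq_iff)
next
  case (5 u)
  then have "(restrict u B)(x := u x) = u"
    using assms by (auto simp: PiE_iff extensional_def fun_eq_iff)
  then show ?case by simp
qed (use assms in \<open>auto simp: PiE_iff extensional_def fun_eq_iff split: if_splits\<close>)

lemma mat_word_carrier:
  assumes "\<And>i. A i \<in> carrier_mat d d"
  shows "mat_word d A w \<in> carrier_mat d d"
  by (induction w) (use assms in \<open>auto simp: mat_word_def intro: mult_carrier_mat\<close>)

lemma mat_word_Cons_entry:
  assumes "\<And>i. A i \<in> carrier_mat d d" "i < d" "l < d"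
  shows "mat_word d A (s # w) $$ (i, l) = (\<Sum>x<d. A s $$ (i, x) * mat_word d A w $$ (x, l))"
proof -
  have "mat_word d A (s # w) = A s * mat_word d A w" by (simp add: mat_word_def)
  then show ?thesis
    using assms(1)[of s] mat_word_carrier[of A d w, OF assms(1)] assms(2,3)
    by (simp add: scalar_prod_def lessThan_atLeast0)
qed

text \<open>A sum over the paths from \<open>i\<close> to \<open>l\<close>, with \<open>c\<close>
  listing the inner vertices. The length is written \<open>Suc r\<close> because parts are positive;
  a single letter has no inner vertex.\<close>

lemma mat_word_entry:
  assumes A: "\<And>i. A i \<in> carrier_mat d d" and l: "l < d" and "i < d"
  shows "mat_word d A (map \<sigma> [p..<p + Suc r]) $$ (i, l) =
    (\<Sum>c\<in>{Suc p..<p + Suc r} \<rightarrow>\<^sub>E {..<d}. \<Prod>t\<in>{p..<p + Suc r}.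
       A (\<sigma> t) $$ (if t = p then i else c t, if Suc t = p + Suc r then l else c (Suc t)))"
  using \<open>i < d\<close>
proof (induction r arbitrary: p i)
  case 0
  have "mat_word d A [] = 1\<^sub>m d" by (simp add: mat_word_def)
  then have "mat_word d A (map \<sigma> [p..<p + Suc 0]) $$ (i, l) = (\<Sum>x<d. A (\<sigma> p) $$ (i, x) * 1\<^sub>m d $$ (x, l))"
    using mat_word_Cons_entry[OF A 0 l, where s = "\<sigma> p" and w = "[]"] by simp
  also have "\<dots> = (\<Sum>x<d. if x = l then A (\<sigma> p) $$ (i, x) else 0)" using l by (intro sum.cong) auto
  also have "\<dots> = A (\<sigma> p) $$ (i, l)" using l by simp
  finally show ?case by simp
next
  case (Suc r)
  let ?q = "Suc p"
  let ?I = "{Suc ?q..<?q + Suc r}"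
  have "[p..<p + Suc (Suc r)] = p # [?q..<?q + Suc r]" by (simp add: upt_conv_Cons)
  then have "mat_word d A (map \<sigma> [p..<p + Suc (Suc r)]) $$ (i, l) =
      (\<Sum>x<d. A (\<sigma> p) $$ (i, x) * mat_word d A (map \<sigma> [?q..<?q + Suc r]) $$ (x, l))"
    using mat_word_Cons_entry[OF A Suc.prems l] by simp
  also have "\<dots> = (\<Sum>x<d. \<Sum>c\<in>?I \<rightarrow>\<^sub>E {..<d}. A (\<sigma> p) $$ (i, x) * (\<Prod>t\<in>{?q..<?q + Suc r}.
       A (\<sigma> t) $$ (if t = ?q then x else c t, if Suc t = ?q + Suc r then l else c (Suc t))))"
    unfolding sum_distrib_left[symmetric] by (intro sum.cong) (simp_all only: Suc.IH lessThan_iff)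
  also have "\<dots> = (\<Sum>x<d. \<Sum>c\<in>?I \<rightarrow>\<^sub>E {..<d}. \<Prod>t\<in>{p..<p + Suc (Suc r)}.
       A (\<sigma> t) $$ (if t = p then i else (c(?q := x)) t, if Suc t = p + Suc (Suc r) then l else (c(?q := x)) (Suc t)))"
  proof (intro sum.cong refl)
    fix x c
    have "{p..<p + Suc (Suc r)} = insert p {?q..<?q + Suc r}" by auto
    then have "(\<Prod>t\<in>{p..<p + Suc (Suc r)}.
       A (\<sigma> t) $$ (if t = p then i else (c(?q := x)) t, if Suc t = p + Suc (Suc r) then l else (c(?q := x)) (Suc t))) =
       A (\<sigma> p) $$ (i, x) * (\<Prod>t\<in>{?q..<?q + Suc r}.
       A (\<sigma> t) $$ (if t = p then i else (c(?q := x)) t, if Suc t = p + Suc (Suc r) then l else (c(?q := x)) (Suc t)))"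
      by simp
    also have "(\<Prod>t\<in>{?q..<?q + Suc r}.
       A (\<sigma> t) $$ (if t = p then i else (c(?q := x)) t, if Suc t = p + Suc (Suc r) then l else (c(?q := x)) (Suc t))) =
       (\<Prod>t\<in>{?q..<?q + Suc r}.
       A (\<sigma> t) $$ (if t = ?q then x else c t, if Suc t = ?q + Suc r then l else c (Suc t)))"
      by (intro prod.cong) auto
    finally show "A (\<sigma> p) $$ (i, x) * (\<Prod>t\<in>{?q..<?q + Suc r}.
       A (\<sigma> t) $$ (if t = ?q then x else c t, if Suc t = ?q + Suc r then l else c (Suc t))) =
      (\<Prod>t\<in>{p..<p + Suc (Suc r)}.
       A (\<sigma> t) $$ (if t = p then i else (c(?q := x)) t, if Suc t = p + Suc (Suc r) then l else (c(?q := x)) (Suc t)))"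
      by simp
  qed
  also have "\<dots> = (\<Sum>c\<in>insert ?q ?I \<rightarrow>\<^sub>E {..<d}. \<Prod>t\<in>{p..<p + Suc (Suc r)}.
       A (\<sigma> t) $$ (if t = p then i else c t, if Suc t = p + Suc (Suc r) then l else c (Suc t)))"
    by (rule sum_PiE_insert[symmetric]) simp
  also have "insert ?q ?I = {Suc p..<p + Suc (Suc r)}" by auto
  finally show ?case .
qed

text \<open>The distributive law, used to merge the inner vertices of all blocks into one choice
  \<open>c\<close>.\<close>

lemma prod_sum_PiE_disjoint:
  fixes F :: "nat \<Rightarrow> (nat \<Rightarrow> nat) \<Rightarrow> 'a :: comm_ring_1"
  assumes "\<And>i j. i < n \<Longrightarrow> j < n \<Longrightarrow> i \<noteq> j \<Longrightarrow> I i \<inter> I j = {}"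
    and "\<And>j c c'. j < n \<Longrightarrow> (\<And>t. t \<in> I j \<Longrightarrow> c t = c' t) \<Longrightarrow> F j c = F j c'"
  shows "(\<Prod>j<n. \<Sum>c\<in>I j \<rightarrow>\<^sub>E D. F j c) = (\<Sum>c\<in>(\<Union>j<n. I j) \<rightarrow>\<^sub>E D. \<Prod>j<n. F j c)"
  using assms
proof (induction n)
  case 0
  then show ?case by simp
next
  case (Suc n)
  let ?U = "\<Union>j<n. I j"
  have disj: "?U \<inter> I n = {}" using Suc.prems(1) by (auto simp: less_Suc_eq)
  have IH: "(\<Prod>j<n. \<Sum>c\<in>I j \<rightarrow>\<^sub>E D. F j c) = (\<Sum>c\<in>?U \<rightarrow>\<^sub>E D. \<Prod>j<n. F j c)"
  proof (rule Suc.IH)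
    show "I i \<inter> I j = {}" if "i < n" "j < n" "i \<noteq> j" for i j
      using Suc.prems(1)[of i j] that by simp
    show "F j c = F j c'" if "j < n" "\<And>t. t \<in> I j \<Longrightarrow> c t = c' t" for j c c'
      by (rule Suc.prems(2)) (use that in auto)
  qed
  have "(\<Prod>j<Suc n. \<Sum>c\<in>I j \<rightarrow>\<^sub>E D. F j c) =
      (\<Sum>c\<in>?U \<rightarrow>\<^sub>E D. \<Prod>j<n. F j c) * (\<Sum>c\<in>I n \<rightarrow>\<^sub>E D. F n c)"
    unfolding prod.lessThan_Suc IH ..
  also have "\<dots> = (\<Sum>a\<in>?U \<rightarrow>\<^sub>E D. \<Sum>c\<in>I n \<rightarrow>\<^sub>E D. (\<Prod>j<n. F j a) * F n c)"
    by (rule sum_product)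
  also have "\<dots> = (\<Sum>a\<in>?U \<rightarrow>\<^sub>E D. \<Sum>c\<in>I n \<rightarrow>\<^sub>E D. \<Prod>j<Suc n. F j (merge ?U a c))"
  proof (intro sum.cong refl)
    fix a c
    have "(\<Prod>j<n. F j (merge ?U a c)) = (\<Prod>j<n. F j a)"
      by (intro prod.cong refl Suc.prems(2)) (auto simp: merge_def)
    moreover have "F n (merge ?U a c) = F n c"
    proof (rule Suc.prems(2))
      fix t assume "t \<in> I n"
      then have "t \<notin> ?U" using disj by blast
      then show "merge ?U a c t = c t" unfolding merge_def by (rule if_not_P)
    qed simp
    ultimately show "(\<Prod>j<n. F j a) * F n c = (\<Prod>j<Suc n. F j (merge ?U a c))" by simp
  qed
  also have "\<dots> = (\<Sum>c\<in>(?U \<union> I n) \<rightarrow>\<^sub>E D. \<Prod>j<Suc n. F j c)" by (rule sum_PiE_Un[OF disj, symmetric])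
  also have "?U \<union> I n = (\<Union>j<Suc n. I j)" by (auto simp: less_Suc_eq)
  finally show ?case .
qed

lemma prod_blocks:
  fixes f :: "nat \<Rightarrow> 'a :: comm_monoid_mult"
  shows "(\<Prod>j<n. \<Prod>t\<in>{start lam j..<start lam (Suc j)}. f t) = (\<Prod>t<start lam n. f t)"
proof (induction n)
  case (Suc n)
  have "(\<Prod>t\<in>{0..<start lam n}. f t) * (\<Prod>t\<in>{start lam n..<start lam (Suc n)}. f t) = (\<Prod>t\<in>{0..<start lam (Suc n)}. f t)"
    by (rule prod.atLeastLessThan_concat) (auto intro: start_mono)
  then show ?case using Suc by (simp add: lessThan_atLeast0)
qed simp

text \<open>The inner vertices sit at the positions that are not starts. At the start of a block
  \<open>a\<close> supplies the row index, and \<open>b\<close>, reached by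
  \<open>next_in_block\<close> from the last position, the column index.\<close>

lemma prod_mat_word_entries:
  fixes A :: "nat \<Rightarrow> 'a :: comm_ring_1 mat"
  assumes pos: "\<forall>x\<in>set lam. 0 < x" and A: "\<And>i. A i \<in> carrier_mat d d"
    and ab: "\<And>s. s \<in> starts lam \<Longrightarrow> a s < d" "\<And>s. s \<in> starts lam \<Longrightarrow> b s < d"
  shows "(\<Prod>j<length lam. mat_word d A (map \<sigma> [start lam j..<start lam (Suc j)]) $$ (a (start lam j), b (start lam j))) =
    (\<Sum>c\<in>({..<sum_list lam} - starts lam) \<rightarrow>\<^sub>E {..<d}. \<Prod>t<sum_list lam.
       A (\<sigma> t) $$ (merge (starts lam) a c t, merge (starts lam) b c (next_in_block lam t)))"
proof -
  let ?S = "starts lam" and ?n = "length lam"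
  define I where "I j = {Suc (start lam j)..<start lam (Suc j)}" for j
  define F where "F j c = (\<Prod>t\<in>{start lam j..<start lam (Suc j)}.
     A (\<sigma> t) $$ (if t = start lam j then a (start lam j) else c t,
       if Suc t = start lam (Suc j) then b (start lam j) else c (Suc t)))" for j and c :: "nat \<Rightarrow> nat"
  have S: "start lam j \<in> ?S" if "j < ?n" for j using that by (simp add: starts_def)
  have F: "F j c = (\<Prod>t\<in>{start lam j..<start lam (Suc j)}.
     A (\<sigma> t) $$ (merge ?S a c t, merge ?S b c (next_in_block lam t)))" if j: "j < ?n" for j c
    unfolding F_def
  proof (intro prod.cong refl)
    fix t assume t: "t \<in> {start lam j..<start lam (Suc j)}"
    then have bt: "block_of lam t = j" by (intro block_of_eqI) auto
    have tk: "t < sum_list lam" using t start_le[of lam "Suc j"] by auto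
    have 1: "merge ?S a c t = (if t = start lam j then a (start lam j) else c t)"
      using mem_starts_iff[OF pos tk] bt by (auto simp: merge_def)
    have 2: "merge ?S b c (next_in_block lam t) = (if Suc t = start lam (Suc j) then b (start lam j) else c (Suc t))"
    proof (cases "Suc t = start lam (Suc j)")
      case True
      then show ?thesis using bt tk S[OF j] by (simp add: next_in_block_def merge_def)
    next
      case False
      then have lt: "Suc t < start lam (Suc j)" using t by auto
      then have "block_of lam (Suc t) = j" using t by (intro block_of_eqI) auto
      moreover have "Suc t < sum_list lam" using lt start_le[of lam "Suc j"] by linarith
      ultimately have "Suc t \<notin> ?S" using mem_starts_iff[OF pos] t by auto
      then show ?thesis using False bt tk by (simp add: next_in_block_def merge_def)
    qed
    show "A (\<sigma> t) $$ (if t = start lam j then a (start lam j) else c t,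
       if Suc t = start lam (Suc j) then b (start lam j) else c (Suc t)) =
       A (\<sigma> t) $$ (merge ?S a c t, merge ?S b c (next_in_block lam t))"
      unfolding 1 2 ..
  qed
  have entry: "mat_word d A (map \<sigma> [start lam j..<start lam (Suc j)]) $$ (a (start lam j), b (start lam j)) =
      (\<Sum>c\<in>I j \<rightarrow>\<^sub>E {..<d}. F j c)" if j: "j < ?n" for j
  proof -
    obtain r where "start lam (Suc j) = start lam j + Suc r"
      using start_less[OF pos j] less_iff_Suc_add by auto
    then show ?thesis
      unfolding I_def F_def using mat_word_entry[OF A ab(2) ab(1), OF S S, OF j j] by simp
  qed
  have U: "(\<Union>j<?n. I j) = {..<sum_list lam} - ?S"
  proof (intro equalityI subsetI)
    fix t assume "t \<in> (\<Union>j<?n. I j)"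
    then obtain j where j: "j < ?n" "start lam j < t" "t < start lam (Suc j)" by (auto simp: I_def)
    have "block_of lam t = j" using j by (intro block_of_eqI) auto
    moreover have "t < sum_list lam" using j start_le[of lam "Suc j"] by linarith
    ultimately show "t \<in> {..<sum_list lam} - ?S" using mem_starts_iff[OF pos] j by auto
  next
    fix t assume t: "t \<in> {..<sum_list lam} - ?S"
    then have tk: "t < sum_list lam" by simp
    then have "t \<in> I (block_of lam t)"
      using block_of_bounds[OF tk] mem_starts_iff[OF pos tk] t unfolding I_def by auto
    then show "t \<in> (\<Union>j<?n. I j)" using block_of_bounds(1)[OF tk] by blast
  qed
  have "(\<Prod>j<?n. mat_word d A (map \<sigma> [start lam j..<start lam (Suc j)]) $$ (a (start lam j), b (start lam j))) =
      (\<Prod>j<?n. \<Sum>c\<in>I j \<rightarrow>\<^sub>E {..<d}. F j c)"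
    by (intro prod.cong refl entry) simp
  also have "\<dots> = (\<Sum>c\<in>(\<Union>j<?n. I j) \<rightarrow>\<^sub>E {..<d}. \<Prod>j<?n. F j c)"
  proof (rule prod_sum_PiE_disjoint)
    fix i j assume ij: "i < ?n" "j < ?n" "i \<noteq> j"
    have "block_of lam t = i" if "t \<in> I i" for t i using that by (intro block_of_eqI) (auto simp: I_def)
    then show "I i \<inter> I j = {}" using ij by blast
  next
    fix j c c' assume "j < ?n" and eq: "\<And>t. t \<in> I j \<Longrightarrow> c t = (c' :: nat \<Rightarrow> nat) t"
    show "F j c = F j c'" unfolding F_def
    proof (intro prod.cong refl)
      fix t assume t: "t \<in> {start lam j..<start lam (Suc j)}"
      have 1: "(if t = start lam j then a (start lam j) else c t) = (if t = start lam j then a (start lam j) else c' t)"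
        using t by (auto intro!: eq simp: I_def)
      have 2: "(if Suc t = start lam (Suc j) then b (start lam j) else c (Suc t)) =
          (if Suc t = start lam (Suc j) then b (start lam j) else c' (Suc t))"
        using t by (auto intro!: eq simp: I_def)
      show "A (\<sigma> t) $$ (if t = start lam j then a (start lam j) else c t,
         if Suc t = start lam (Suc j) then b (start lam j) else c (Suc t)) =
        A (\<sigma> t) $$ (if t = start lam j then a (start lam j) else c' t,
         if Suc t = start lam (Suc j) then b (start lam j) else c' (Suc t))"
        unfolding 1 2 ..
    qed
  qed
  also have "\<dots> = (\<Sum>c\<in>({..<sum_list lam} - ?S) \<rightarrow>\<^sub>E {..<d}. \<Prod>t<sum_list lam.
       A (\<sigma> t) $$ (merge ?S a c t, merge ?S b c (next_in_block lam t)))"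
    unfolding U
  proof (intro sum.cong refl)
    fix c
    show "(\<Prod>j<?n. F j c) = (\<Prod>t<sum_list lam.
       A (\<sigma> t) $$ (merge ?S a c t, merge ?S b c (next_in_block lam t)))"
      using prod_blocks[where n = ?n and lam = lam
          and f = "\<lambda>t. A (\<sigma> t) $$ (merge ?S a c t, merge ?S b c (next_in_block lam t))"]
      by (simp add: F)
  qed
  finally show ?thesis .
qed

text \<open>The sign of the permutation matching the sequences \<open>q\<close> and \<open>h\<close> of length \<open>k\<close>, if there is a
  unique one: the determinant of the \<open>k\<close> matrix units coded by \<open>q\<close> at the positions coded by \<open>h\<close>.\<close>
definition match_sign :: "nat \<Rightarrow> (nat \<Rightarrow> nat) \<Rightarrow> (nat \<Rightarrow> nat) \<Rightarrow> int" where
  "match_sign k q h = (\<Sum>\<sigma> | \<sigma> permutes {..<k}. if \<forall>t<k. h t = q (\<sigma> t) then sign \<sigma> else 0)"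

lemma match_sign_not_inj:
  assumes "\<not> inj_on q {..<k}"
  shows "match_sign k q h = 0"
proof -
  obtain s s' where s: "s < k" "s' < k" "s \<noteq> s'" "q s = q s'" using assms by (auto simp: inj_on_def)
  let ?p = "transpose s s'"
  define F where "F \<sigma> = (if \<forall>t<k. h t = q (\<sigma> t) then sign \<sigma> else 0)" for \<sigma>
  have "q (?p x) = q x" for x using s by (auto simp: transpose_def)
  then have "F (?p \<circ> \<sigma>) = - F \<sigma>" if "\<sigma> permutes {..<k}" for \<sigma>
    using permutes_imp_permutation[OF _ that] s(3)
    by (simp add: F_def sign_compose permutation_swap_id sign_swap_id)
  moreover have "?p permutes {..<k}" using s by (intro permutes_swap_id) auto
  ultimately have "(\<Sum>\<sigma> | \<sigma> permutes {..<k}. F \<sigma>) = - (\<Sum>\<sigma> | \<sigma> permutes {..<k}. F \<sigma>)"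
    using setum_permutations_compose_left[of ?p "{..<k}" F] by (simp add: sum_negf)
  then show ?thesis unfolding F_def match_sign_def by simp
qed

text \<open>Completing \<open>h\<close> by \<open>\<rho>\<close> from \<open>k\<close> on turns the
  minor into a full determinant: a matching \<open>\<sigma>\<close> is the inverse of
  \<open>\<rho>\<close> composed with the completed map.\<close>

lemma match_sign_permutes:
  assumes \<rho>: "\<rho> permutes {..<m}" and km: "k \<le> m"
  shows "match_sign k \<rho> h = sign \<rho> * map_sign m (\<lambda>t. if t < k then h t else \<rho> t)"
proof -
  let ?h = "\<lambda>t. if t < k then h t else \<rho> t"
  have sgn: "sign \<rho> * map_sign m ?h = sign \<sigma>"
    if \<sigma>: "\<sigma> permutes {..<k}" and eq: "\<forall>t<k. h t = \<rho> (\<sigma> t)" for \<sigma>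
  proof -
    have \<sigma>m: "\<sigma> permutes {..<m}" using permutes_subset[OF \<sigma>] km by auto
    have "?h t = (\<rho> \<circ> \<sigma>) t" for t using eq permutes_not_in[OF \<sigma>, of t] by auto
    then have "map_sign m ?h = sign \<rho> * sign \<sigma>"
      using map_sign_cong[of m ?h "\<rho> \<circ> \<sigma>"] map_sign_comp[OF \<sigma>m, of \<rho>] map_sign_permutes[OF \<rho>] by simp
    then show ?thesis by simp
  qed
  show ?thesis
  proof (cases "\<exists>\<sigma>. \<sigma> permutes {..<k} \<and> (\<forall>t<k. h t = \<rho> (\<sigma> t))")
    case True
    then obtain \<sigma> where \<sigma>: "\<sigma> permutes {..<k}" "\<forall>t<k. h t = \<rho> (\<sigma> t)" by blast
    have uniq: "\<sigma>' = \<sigma>" if "\<sigma>' permutes {..<k}" "\<forall>t<k. h t = \<rho> (\<sigma>' t)" for \<sigma>'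
    proof
      fix t show "\<sigma>' t = \<sigma> t"
      proof (cases "t < k")
        case True
        then have "\<rho> (\<sigma>' t) = \<rho> (\<sigma> t)" using that(2) \<sigma>(2) by metis
        then show ?thesis using permutes_inj[OF \<rho>] by (simp add: inj_eq)
      next
        case False
        then show ?thesis using permutes_not_in[OF \<sigma>(1), of t] permutes_not_in[OF that(1), of t] by simp
      qed
    qed
    have "match_sign k \<rho> h = (\<Sum>\<sigma>'\<in>{\<sigma>}. if \<forall>t<k. h t = \<rho> (\<sigma>' t) then sign \<sigma>' else 0)"
      unfolding match_sign_def using \<sigma> uniq
      by (intro sum.mono_neutral_right) (auto simp: finite_permutations)
    then show ?thesis using sgn[OF \<sigma>] \<sigma>(2) by simp
  next
    case False
    then have "match_sign k \<rho> h = 0" unfolding match_sign_def by (intro sum.neutral) auto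
    moreover have "map_sign m ?h = 0"
    proof (rule ccontr)
      assume "map_sign m ?h \<noteq> 0"
      then have bij: "bij_betw ?h {..<m} {..<m}" by (auto simp: map_sign_def split: if_splits)
      define \<sigma> where "\<sigma> = inv_into UNIV \<rho> \<circ> restrict_id ?h {..<m}"
      have \<sigma>m: "\<sigma> permutes {..<m}" unfolding \<sigma>_def
        by (intro permutes_compose permutes_restrict_id[OF bij] permutes_inv[OF \<rho>])
      \<comment> \<open>The completed map agrees with \<open>\<rho>\<close> from \<open>k\<close>
        on.\<close>
      have fixed: "\<sigma> t = t" if "t \<ge> k" for t
        using that permutes_inverses[OF \<rho>] permutes_not_in[OF permutes_inv[OF \<rho>], of t]
        by (cases "t < m") (auto simp: \<sigma>_def)
      have "\<sigma> permutes {..<k}"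
        by (rule permutes_superset[OF \<sigma>m]) (auto intro: fixed)
      moreover have "\<forall>t<k. h t = \<rho> (\<sigma> t)"
        using km permutes_inverses[OF \<rho>] by (simp add: \<sigma>_def)
      ultimately show False using False by blast
    qed
    ultimately show ?thesis by simp
  qed
qed

section \<open>Expansion in matrix units\<close>

text \<open>Multilinearity: \<open>q s\<close> is the basis element chosen in the expansion of the
  variable \<open>s\<close>, and each choice contributes its own alternating sum.\<close>

lemma alternation_expand:
  fixes B :: "nat \<Rightarrow> nat \<Rightarrow> 'a :: comm_ring_1"
  assumes h: "\<And>t. t < k \<Longrightarrow> h t < m"
  shows "(\<Sum>\<sigma> | \<sigma> permutes {..<k}. of_int (sign \<sigma>) * (\<Prod>t<k. B (\<sigma> t) (h t))) =
    (\<Sum>q\<in>{..<k} \<rightarrow>\<^sub>E {..<m}. (\<Prod>s<k. B s (q s)) * of_int (match_sign k q h))"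
proof -
  have "of_int (sign \<sigma>) * (\<Prod>t<k. B (\<sigma> t) (h t)) =
      (\<Sum>q\<in>{..<k} \<rightarrow>\<^sub>E {..<m}. (\<Prod>s<k. B s (q s)) * of_int (if \<forall>t<k. h t = q (\<sigma> t) then sign \<sigma> else 0))"
    if \<sigma>: "\<sigma> permutes {..<k}" for \<sigma>
  proof -
    \<comment> \<open>For fixed \<open>\<sigma>\<close> this is the only choice that produces the
      sequence \<open>h\<close>.\<close>
    define q0 where "q0 = restrict (h \<circ> inv_into UNIV \<sigma>) {..<k}"
    note pinv = permutes_inverses[OF \<sigma>]
    have \<sigma>k: "\<sigma> t < k \<longleftrightarrow> t < k" "inv_into UNIV \<sigma> t < k \<longleftrightarrow> t < k" for t
      using permutes_in_image[OF \<sigma>, of t] permutes_in_image[OF permutes_inv[OF \<sigma>], of t] by auto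
    have q0: "q0 \<in> {..<k} \<rightarrow>\<^sub>E {..<m}" using h \<sigma>k by (auto simp: q0_def)
    have q0_iff: "(\<forall>t<k. h t = q (\<sigma> t)) \<longleftrightarrow> q = q0" if q: "q \<in> {..<k} \<rightarrow>\<^sub>E {..<m}" for q
    proof
      assume eq: "\<forall>t<k. h t = q (\<sigma> t)"
      show "q = q0"
      proof (rule PiE_ext[OF q q0])
        fix s assume "s \<in> {..<k}"
        then show "q s = q0 s" using eq[rule_format, of "inv_into UNIV \<sigma> s"] \<sigma>k pinv by (simp add: q0_def)
      qed
    next
      assume "q = q0"
      then show "\<forall>t<k. h t = q (\<sigma> t)" using \<sigma>k pinv by (simp add: q0_def)
    qed
    have "(\<Sum>q\<in>{..<k} \<rightarrow>\<^sub>E {..<m}. (\<Prod>s<k. B s (q s)) * of_int (if \<forall>t<k. h t = q (\<sigma> t) then sign \<sigma> else 0)) =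
        (\<Sum>q\<in>{..<k} \<rightarrow>\<^sub>E {..<m}. if q = q0 then (\<Prod>s<k. B s (q s)) * of_int (sign \<sigma>) else 0)"
      by (intro sum.cong refl) (simp add: q0_iff)
    also have "\<dots> = (\<Prod>s<k. B s (q0 s)) * of_int (sign \<sigma>)"
      using q0 by (simp add: finite_PiE)
    also have "(\<Prod>s<k. B s (q0 s)) = (\<Prod>t<k. B (\<sigma> t) (q0 (\<sigma> t)))"
      using prod.permute[OF \<sigma>, of "\<lambda>s. B s (q0 s)"] by (simp add: comp_def)
    also have "\<dots> = (\<Prod>t<k. B (\<sigma> t) (h t))"
      using \<sigma>k pinv by (intro prod.cong) (auto simp: q0_def)
    finally show ?thesis by (simp add: mult.commute)
  qed
  then have "(\<Sum>\<sigma> | \<sigma> permutes {..<k}. of_int (sign \<sigma>) * (\<Prod>t<k. B (\<sigma> t) (h t))) =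
      (\<Sum>\<sigma> | \<sigma> permutes {..<k}. \<Sum>q\<in>{..<k} \<rightarrow>\<^sub>E {..<m}.
        (\<Prod>s<k. B s (q s)) * of_int (if \<forall>t<k. h t = q (\<sigma> t) then sign \<sigma> else 0))"
    by (intro sum.cong) auto
  also have "\<dots> = (\<Sum>q\<in>{..<k} \<rightarrow>\<^sub>E {..<m}. (\<Prod>s<k. B s (q s)) * of_int (match_sign k q h))"
    unfolding match_sign_def of_int_sum sum_distrib_left by (rule sum.swap)
  finally show ?thesis .
qed

definition edge_code :: "nat \<Rightarrow> nat list \<Rightarrow> (nat \<Rightarrow> nat) \<Rightarrow> (nat \<Rightarrow> nat) \<Rightarrow> (nat \<Rightarrow> nat) \<Rightarrow> nat \<Rightarrow> nat" where
  "edge_code d lam a b c t = merge (starts lam) a c t * d + merge (starts lam) b c (next_in_block lam t)"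

lemma merge_starts_less:
  fixes d :: nat
  assumes "\<And>s. s \<in> starts lam \<Longrightarrow> a s < d" "c \<in> ({..<sum_list lam} - starts lam) \<rightarrow>\<^sub>E {..<d}" "t < sum_list lam"
  shows "merge (starts lam) a c t < d"
  using assms by (auto simp: merge_def PiE_iff)

lemma edge_code_bounds:
  assumes pos: "\<forall>x\<in>set lam. 0 < x" and "\<And>s. s \<in> starts lam \<Longrightarrow> a s < d" "\<And>s. s \<in> starts lam \<Longrightarrow> b s < d"
    and c: "c \<in> ({..<sum_list lam} - starts lam) \<rightarrow>\<^sub>E {..<d}" and t: "t < sum_list lam"
  shows "edge_code d lam a b c t < d * d"
    and "edge_code d lam a b c t div d = merge (starts lam) a c t"
    and "edge_code d lam a b c t mod d = merge (starts lam) b c (next_in_block lam t)"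
proof -
  have "next_in_block lam t < sum_list lam" using permutes_in_image[OF next_in_block_permutes[OF pos], of t] t by simp
  then have "merge (starts lam) a c t < d" "merge (starts lam) b c (next_in_block lam t) < d"
    using merge_starts_less[OF _ c] assms by auto
  then show "edge_code d lam a b c t < d * d"
    "edge_code d lam a b c t div d = merge (starts lam) a c t"
    "edge_code d lam a b c t mod d = merge (starts lam) b c (next_in_block lam t)"
    using code_less by (auto simp: edge_code_def)
qed

text \<open>Separates the matrices from the combinatorics: the integer factor is the coordinate of
  \<open>ST lam\<close> at the matrix units coded by \<open>q\<close>.\<close>

lemma tensor_eval_coord_ST_expand:
  fixes A :: "nat \<Rightarrow> 'a :: comm_ring_1 mat"
  assumes pos: "\<forall>x\<in>set lam. 0 < x" and A: "\<And>i. A i \<in> carrier_mat d d"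
    and a: "\<And>s. s \<in> starts lam \<Longrightarrow> a s < d" and b: "\<And>s. s \<in> starts lam \<Longrightarrow> b s < d"
    and "\<And>j. j < length lam \<Longrightarrow> is ! j = a (start lam j)" "\<And>j. j < length lam \<Longrightarrow> ls ! j = b (start lam j)"
  shows "tensor_eval_coord d (length lam) (ST lam) A is ls =
    (\<Sum>q\<in>{..<sum_list lam} \<rightarrow>\<^sub>E {..<d*d}. (\<Prod>s<sum_list lam. A s $$ (q s div d, q s mod d)) *
       of_int (\<Sum>c\<in>({..<sum_list lam} - starts lam) \<rightarrow>\<^sub>E {..<d}. match_sign (sum_list lam) q (edge_code d lam a b c)))"
proof -
  let ?k = "sum_list lam" and ?S = "starts lam"
  let ?C = "({..<?k} - ?S) \<rightarrow>\<^sub>E {..<d}"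
  let ?B = "\<lambda>s e. A s $$ (e div d, e mod d)"
  have "tensor_eval_coord d (length lam) (ST lam) A is ls =
    (\<Sum>\<sigma> | \<sigma> permutes {..<?k}. of_int (sign \<sigma>) *
       (\<Prod>j<length lam. mat_word d A (map \<sigma> [start lam j..<start lam (Suc j)]) $$ (a (start lam j), b (start lam j))))"
    unfolding tensor_eval_coord_ST using assms(5,6) by simp
  also have "\<dots> = (\<Sum>\<sigma> | \<sigma> permutes {..<?k}. \<Sum>c\<in>?C. of_int (sign \<sigma>) *
       (\<Prod>t<?k. A (\<sigma> t) $$ (merge ?S a c t, merge ?S b c (next_in_block lam t))))"
    unfolding sum_distrib_left[symmetric]
    by (intro sum.cong refl arg_cong2[where f = "(*)"]
        prod_mat_word_entries[where a = a and b = b, OF pos A a b])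
  also have "\<dots> = (\<Sum>c\<in>?C. \<Sum>\<sigma> | \<sigma> permutes {..<?k}. of_int (sign \<sigma>) *
       (\<Prod>t<?k. ?B (\<sigma> t) (edge_code d lam a b c t)))"
    by (subst sum.swap) (intro sum.cong refl arg_cong2[where f = "(*)"] prod.cong,
        simp add: edge_code_bounds(2,3)[OF pos a b])
  also have "\<dots> = (\<Sum>c\<in>?C. \<Sum>q\<in>{..<?k} \<rightarrow>\<^sub>E {..<d*d}.
      (\<Prod>s<?k. ?B s (q s)) * of_int (match_sign ?k q (edge_code d lam a b c)))"
  proof (rule sum.cong[OF refl])
    fix c assume c: "c \<in> ?C"
    show "(\<Sum>\<sigma> | \<sigma> permutes {..<?k}. of_int (sign \<sigma>) * (\<Prod>t<?k. ?B (\<sigma> t) (edge_code d lam a b c t))) =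
      (\<Sum>q\<in>{..<?k} \<rightarrow>\<^sub>E {..<d*d}. (\<Prod>s<?k. ?B s (q s)) * of_int (match_sign ?k q (edge_code d lam a b c)))"
      using edge_code_bounds(1)[OF pos a b c] by (rule alternation_expand)
  qed
  also have "\<dots> = (\<Sum>q\<in>{..<?k} \<rightarrow>\<^sub>E {..<d*d}. (\<Prod>s<?k. ?B s (q s)) *
       of_int (\<Sum>c\<in>?C. match_sign ?k q (edge_code d lam a b c)))"
    unfolding of_int_sum sum_distrib_left by (rule sum.swap)
  finally show ?thesis .
qed

text \<open>An appended part is a start with no inner vertex: tail and head of its edge are both
  prescribed, and nothing is summed over.\<close>

lemma path_sum_padded:
  assumes pos: "\<forall>x\<in>set lam. 0 < x" and k: "sum_list lam \<le> d * d"
  defines "mu \<equiv> lam @ replicate (d * d - sum_list lam) 1"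
  shows "path_sum d (starts mu) (next_in_block mu) a b =
    (\<Sum>c\<in>({..<sum_list lam} - starts lam) \<rightarrow>\<^sub>E {..<d}. map_sign (d*d)
       (\<lambda>t. if t < sum_list lam then edge_code d lam a b c t else a t * d + b t))"
proof -
  let ?k = "sum_list lam"
  have S: "starts mu = starts lam \<union> {?k..<d*d}" using k by (simp add: mu_def starts_append_replicate[unfolded One_nat_def])
  have D: "{..<d*d} - starts mu = {..<?k} - starts lam" using k starts_subset[OF pos] by (auto simp: S)
  have nxt: "next_in_block mu = next_in_block lam" unfolding mu_def by (rule next_in_block_append_replicate)
  have lt: "next_in_block lam t < ?k \<longleftrightarrow> t < ?k" for t
    using permutes_in_image[OF next_in_block_permutes[OF pos], of t] by simp
  have fixed: "next_in_block lam t = t" if "\<not> t < ?k" for t using that by (simp add: next_in_block_def)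
  have "map_sign (d*d) (\<lambda>t. merge (starts mu) a c t * d + merge (starts mu) b c (next_in_block lam t)) =
      map_sign (d*d) (\<lambda>t. if t < ?k then edge_code d lam a b c t else a t * d + b t)" for c
    by (rule map_sign_cong) (auto simp: edge_code_def merge_def S lt fixed not_less[symmetric])
  then show ?thesis unfolding path_sum_def D nxt by simp
qed

text \<open>Extends a choice of distinct matrix units to an enumeration of all of them.\<close>

lemma permutes_extending:
  fixes q :: "nat \<Rightarrow> nat"
  assumes "inj_on q {..<k}" "q ` {..<k} \<subseteq> {..<m}"
  shows "\<exists>\<rho>. \<rho> permutes {..<m} \<and> (\<forall>t<k. \<rho> t = q t)"
proof -
  have km: "k \<le> m" using card_inj_on_le[OF assms finite_lessThan] by simp
  have "card ({..<m} - q ` {..<k}) = card {k..<m}"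
    using assms by (simp add: card_Diff_subset card_image)
  then obtain f where f: "bij_betw f {k..<m} ({..<m} - q ` {..<k})"
    using finite_same_card_bij[of "{k..<m}" "{..<m} - q ` {..<k}"] by auto
  have "bij_betw (\<lambda>t. if t \<in> {..<k} then q t else f t) ({..<k} \<union> {k..<m}) (q ` {..<k} \<union> ({..<m} - q ` {..<k}))"
    using f assms(1) by (intro bij_betw_disjoint_Un) (auto simp: bij_betw_def)
  moreover have "{..<k} \<union> {k..<m} = {..<m}" using km by auto
  moreover have "q ` {..<k} \<union> ({..<m} - q ` {..<k}) = {..<m}" using assms(2) by auto
  ultimately have "restrict_id (\<lambda>t. if t \<in> {..<k} then q t else f t) {..<m} permutes {..<m}"
    using permutes_restrict_id by metis
  then show ?thesis using km by (intro exI[of _ "restrict_id (\<lambda>t. if t \<in> {..<k} then q t else f t) {..<m}"]) auto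
qed

lemma match_sign_cong:
  assumes "\<And>t. t < k \<Longrightarrow> q t = q' t"
  shows "match_sign k q h = match_sign k q' h"
proof -
  have "q (\<sigma> t) = q' (\<sigma> t)" if "\<sigma> permutes {..<k}" "t < k" for \<sigma> t
    using assms permutes_in_image[OF that(1), of t] that(2) by simp
  then show ?thesis unfolding match_sign_def by (intro sum.cong refl if_cong) auto
qed

text \<open>The parts \<open>1\<close> appended to \<open>lam\<close> record the matrix units that are not substituted into \<open>ST lam\<close>.\<close>
lemma not_is_TPI_ST_iff:
  fixes d :: nat
  assumes pos: "\<forall>x\<in>set lam. 0 < x"
  defines "mu \<equiv> lam @ replicate (d * d - sum_list lam) 1"
  shows "\<not> is_TPI d (length lam) (ST lam :: nat list list \<Rightarrow> 'a :: field_char_0) \<longleftrightarrow>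
    sum_list lam \<le> d * d \<and> (\<exists>a\<in>starts mu \<rightarrow>\<^sub>E {..<d}. \<exists>b\<in>starts mu \<rightarrow>\<^sub>E {..<d}.
       path_sum d (starts mu) (next_in_block mu) a b \<noteq> 0)"
    (is "?L \<longleftrightarrow> ?R")
proof
  let ?n = "length lam" and ?k = "sum_list lam"
  let ?C = "({..<?k} - starts lam) \<rightarrow>\<^sub>E {..<d}"
  assume ?L
  then obtain A :: "nat \<Rightarrow> 'a mat" and "is" ls where A: "\<And>i. A i \<in> carrier_mat d d"
    and len: "\<And>j. j < ?n \<Longrightarrow> is ! j < d" "\<And>j. j < ?n \<Longrightarrow> ls ! j < d"
    and nz: "tensor_eval_coord d ?n (ST lam) A is ls \<noteq> 0"
    unfolding is_TPI_def by blast
  define a where "a s = is ! block_of lam s" for s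
  define b where "b s = ls ! block_of lam s" for s
  have a: "a s < d" and b: "b s < d" if "s \<in> starts lam" for s
    using that len block_of_start[OF pos] by (auto simp: a_def b_def starts_def)
  have "tensor_eval_coord d ?n (ST lam) A is ls =
    (\<Sum>q\<in>{..<?k} \<rightarrow>\<^sub>E {..<d*d}. (\<Prod>s<?k. A s $$ (q s div d, q s mod d)) *
       of_int (\<Sum>c\<in>?C. match_sign ?k q (edge_code d lam a b c)))"
    by (rule tensor_eval_coord_ST_expand[OF pos A a b]) (simp_all add: a_def b_def block_of_start[OF pos])
  then obtain q where q: "q \<in> {..<?k} \<rightarrow>\<^sub>E {..<d*d}"
    and nq: "(\<Sum>c\<in>?C. match_sign ?k q (edge_code d lam a b c)) \<noteq> 0"
    using nz by (metis (no_types, lifting) mult_zero_right of_int_0 sum.neutral)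
  have inj: "inj_on q {..<?k}"
  proof (rule ccontr)
    assume "\<not> inj_on q {..<?k}"
    then show False using nq by (simp add: match_sign_not_inj)
  qed
  have img: "q ` {..<?k} \<subseteq> {..<d*d}" using q by auto
  have km: "?k \<le> d * d" using card_inj_on_le[OF inj img finite_lessThan] by simp
  obtain \<rho> where \<rho>: "\<rho> permutes {..<d*d}" "\<And>t. t < ?k \<Longrightarrow> \<rho> t = q t"
    using permutes_extending[OF inj img] by blast
  have "match_sign ?k q h = sign \<rho> * map_sign (d*d) (\<lambda>t. if t < ?k then h t else \<rho> t)" for h
    using match_sign_cong[of ?k q \<rho>] \<rho> match_sign_permutes[OF \<rho>(1) km] by simp
  then have nz': "(\<Sum>c\<in>?C. map_sign (d*d) (\<lambda>t. if t < ?k then edge_code d lam a b c t else \<rho> t)) \<noteq> 0"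
    using nq by (simp add: sum_distrib_left[symmetric])
  define a' where "a' = (\<lambda>t\<in>starts mu. if t < ?k then a t else \<rho> t div d)"
  define b' where "b' = (\<lambda>t\<in>starts mu. if t < ?k then b t else \<rho> t mod d)"
  have S: "starts mu = starts lam \<union> {?k..<d*d}" using km by (simp add: mu_def starts_append_replicate[unfolded One_nat_def])
  have \<rho>m: "\<rho> t < d * d" if "t < d * d" for t using permutes_in_image[OF \<rho>(1), of t] that by simp
  have notS: "t < ?k" if "t \<in> starts lam" for t using that starts_subset[OF pos] by auto
  have d0: "0 < d" if "t < d * d" for t using that by (cases d) auto
  have a': "a' \<in> starts mu \<rightarrow>\<^sub>E {..<d}"
    using a notS \<rho>m by (auto simp: a'_def S less_mult_imp_div_less)
  have b': "b' \<in> starts mu \<rightarrow>\<^sub>E {..<d}"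
    using b notS d0 by (auto simp: b'_def S)
  have "map_sign (d*d) (\<lambda>t. if t < ?k then edge_code d lam a b c t else \<rho> t) =
      map_sign (d*d) (\<lambda>t. if t < ?k then edge_code d lam a' b' c t else a' t * d + b' t)" for c
  proof (rule map_sign_cong)
    fix t assume "t < d * d"
    have "merge (starts lam) a' c = merge (starts lam) a c" "merge (starts lam) b' c = merge (starts lam) b c"
      using notS by (auto simp: merge_def a'_def b'_def S fun_eq_iff)
    then show "(if t < ?k then edge_code d lam a b c t else \<rho> t) =
        (if t < ?k then edge_code d lam a' b' c t else a' t * d + b' t)"
      using \<open>t < d * d\<close> by (auto simp: edge_code_def a'_def b'_def S)
  qed
  then have "path_sum d (starts mu) (next_in_block mu) a' b' \<noteq> 0"
    using nz' path_sum_padded[OF pos km] by (simp add: mu_def)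
  then show ?R using km a' b' by blast
next
  let ?n = "length lam" and ?k = "sum_list lam"
  let ?C = "({..<?k} - starts lam) \<rightarrow>\<^sub>E {..<d}"
  assume ?R
  then obtain a b where km: "?k \<le> d * d" and a: "a \<in> starts mu \<rightarrow>\<^sub>E {..<d}" and b: "b \<in> starts mu \<rightarrow>\<^sub>E {..<d}"
    and nz: "path_sum d (starts mu) (next_in_block mu) a b \<noteq> 0" by blast
  have S: "starts mu = starts lam \<union> {?k..<d*d}" using km by (simp add: mu_def starts_append_replicate[unfolded One_nat_def])
  have ad: "a s < d" and bd: "b s < d" if "s \<in> starts lam" for s using that a b by (auto simp: S)
  define M where "M c = (\<lambda>t. if t < ?k then edge_code d lam a b c t else a t * d + b t)" for c
  have sum_nz: "(\<Sum>c\<in>?C. map_sign (d*d) (M c)) \<noteq> 0"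
    using nz path_sum_padded[OF pos km] by (simp add: mu_def M_def)
  \<comment> \<open>A path system of nonzero sign uses each edge once; the edges at its first
    \<open>?k\<close> positions are the matrix units to substitute.\<close>
  then obtain c0 where c0: "map_sign (d*d) (M c0) \<noteq> 0" by (metis (no_types, lifting) sum.neutral)
  define \<rho> where "\<rho> = restrict_id (M c0) {..<d*d}"
  have \<rho>: "\<rho> permutes {..<d*d}"
    using c0 permutes_restrict_id by (auto simp: \<rho>_def map_sign_def split: if_splits)
  have \<rho>m: "\<rho> t < d * d" if "t < d * d" for t using permutes_in_image[OF \<rho>, of t] that by simp
  \<comment> \<open>From \<open>?k\<close> on, \<open>M c\<close> does not depend on
    \<open>c\<close>, so \<open>\<rho>\<close> completes the edges of every path system in the same
    way.\<close>
  have ms: "match_sign ?k \<rho> (edge_code d lam a b c) = sign \<rho> * map_sign (d*d) (M c)" for c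
  proof -
    have "map_sign (d*d) (\<lambda>t. if t < ?k then edge_code d lam a b c t else \<rho> t) = map_sign (d*d) (M c)"
      by (rule map_sign_cong) (auto simp: M_def \<rho>_def)
    then show ?thesis using match_sign_permutes[OF \<rho> km] by simp
  qed
  define A :: "nat \<Rightarrow> 'a mat" where "A s = mat d d (\<lambda>(i, j). if i * d + j = \<rho> s then 1 else 0)" for s
  have A: "A i \<in> carrier_mat d d" for i by (simp add: A_def)
  have A_entry: "A s $$ (e div d, e mod d) = (if e = \<rho> s then 1 else 0)" if "e < d * d" for s e
  proof -
    have "e div d < d" "e mod d < d" using that by (auto simp: less_mult_imp_div_less) (cases d, auto)
    then show ?thesis by (simp add: A_def)
  qed
  define "is" where "is = map (\<lambda>j. a (start lam j)) [0..<?n]"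
  define ls where "ls = map (\<lambda>j. b (start lam j)) [0..<?n]"
  have "tensor_eval_coord d ?n (ST lam) A is ls =
    (\<Sum>q\<in>{..<?k} \<rightarrow>\<^sub>E {..<d*d}. (\<Prod>s<?k. A s $$ (q s div d, q s mod d)) *
       of_int (\<Sum>c\<in>?C. match_sign ?k q (edge_code d lam a b c)))"
    by (rule tensor_eval_coord_ST_expand[OF pos A ad bd]) (simp_all add: is_def ls_def)
  also have "\<dots> = (\<Sum>q\<in>{..<?k} \<rightarrow>\<^sub>E {..<d*d}. if q = restrict \<rho> {..<?k} then
       of_int (\<Sum>c\<in>?C. match_sign ?k q (edge_code d lam a b c)) else 0)"
  proof (rule sum.cong[OF refl])
    fix q assume q: "q \<in> {..<?k} \<rightarrow>\<^sub>E {..<d*d}"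
    have prod: "(\<Prod>s<?k. A s $$ (q s div d, q s mod d)) = (if \<forall>s<?k. q s = \<rho> s then 1 else 0)"
    proof -
      have "(\<Prod>s<?k. A s $$ (q s div d, q s mod d)) = (\<Prod>s<?k. if q s = \<rho> s then 1 else 0)"
        using q by (intro prod.cong refl A_entry) auto
      also have "\<dots> = (if \<forall>s<?k. q s = \<rho> s then 1 else 0)" by (auto intro: prod.neutral prod_zero)
      finally show ?thesis .
    qed
    have iff: "(\<forall>s<?k. q s = \<rho> s) \<longleftrightarrow> q = restrict \<rho> {..<?k}"
      using q by (auto simp: fun_eq_iff PiE_iff extensional_def)
    show "(\<Prod>s<?k. A s $$ (q s div d, q s mod d)) * of_int (\<Sum>c\<in>?C. match_sign ?k q (edge_code d lam a b c)) =
      (if q = restrict \<rho> {..<?k} then of_int (\<Sum>c\<in>?C. match_sign ?k q (edge_code d lam a b c)) else 0)"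
      unfolding prod iff by simp
  qed
  also have "\<dots> = of_int (\<Sum>c\<in>?C. match_sign ?k (restrict \<rho> {..<?k}) (edge_code d lam a b c))"
    using km \<rho>m by (simp add: finite_PiE)
  also have "(\<Sum>c\<in>?C. match_sign ?k (restrict \<rho> {..<?k}) (edge_code d lam a b c)) =
      (\<Sum>c\<in>?C. sign \<rho> * map_sign (d*d) (M c))"
    unfolding ms[symmetric] by (intro sum.cong refl match_sign_cong) simp
  also have "\<dots> = sign \<rho> * (\<Sum>c\<in>?C. map_sign (d*d) (M c))" by (simp add: sum_distrib_left)
  \<comment> \<open>In characteristic 0 the nonzero integer stays nonzero in the field.\<close>
  finally have "tensor_eval_coord d ?n (ST lam) A is ls \<noteq> 0"
    using sum_nz by (simp del: of_int_sum of_int_mult)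
  moreover have "\<forall>j<?n. is ! j < d \<and> ls ! j < d"
    using ad bd by (simp add: is_def ls_def starts_def)
  moreover have "length is = ?n" "length ls = ?n" by (simp_all add: is_def ls_def)
  ultimately show ?L unfolding is_TPI_def using A by blast
qed

theorem mainTheorem4:
  fixes lam :: "nat list" and d k :: nat
  assumes "d \<ge> 1" and "is_partition lam k"
  shows "\<not> is_TPI d (length lam) (ST lam :: nat list list \<Rightarrow> 'a::field_char_0)
         \<longleftrightarrow> k \<le> d ^ 2 \<and> is_refinement (psum lam (replicate (d ^ 2 - k) 1)) (delta d)"
proof -
  have pos: "\<forall>x\<in>set lam. 0 < x" and k: "sum_list lam = k" using assms(2) by (auto simp: is_partition_def)
  define mu where "mu = lam @ replicate (d * d - k) 1"
  have "(\<exists>a\<in>starts mu \<rightarrow>\<^sub>E {..<d}. \<exists>b\<in>starts mu \<rightarrow>\<^sub>E {..<d}. path_sum d (starts mu) (next_in_block mu) a b \<noteq> 0) \<longleftrightarrow>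
      is_refinement mu (delta d)" if km: "k \<le> d * d"
  proof -
    have pos': "\<forall>x\<in>set mu. 0 < x" using pos by (auto simp: mu_def)
    have sum': "sum_list mu = d * d" using k km by (simp add: mu_def sum_list_replicate)
    show ?thesis
      using path_sum_nonzero_iff[of "starts mu" d "next_in_block mu"] starts_subset[OF pos']
        next_in_block_permutes[OF pos'] is_refinement_delta_iff[OF pos' sum'] sum' by simp
  qed
  then show ?thesis
    using not_is_TPI_ST_iff[OF pos, of d, where 'a = 'a] psum_replicate_1[OF assms(2)] k
    by (auto simp: mu_def power2_eq_square)
qed

end
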